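(* Let $\vec{\mu}$ be a Schmidt vector of length $n$, let $|\psi_{\vec{\mu}}\rangle\in\mathbb{C}^n\otimes\mathbb{C}^n$ be a pure bipartite state with Schmidt vector $\vec{\mu}$, let $p\in(0,1]$, and let $\rho$ be a density matrix on $\mathbb{C}^n\otimes\mathbb{C}^n$. Then $\rho\in S_{\vec{\mu},p}^{+}$ if and only if there exists a decomposition $\{p_i,|\psi_i\rangle\}$ of $\rho$ such that $$p\sum_i p_i\,\vec{\lambda}_{\psi_i}\succ^w\vec{\mu}.$$ Furthermore, $|\psi_{\vec{\mu}}\rangle$ can be converted into $\rho$ by LOCC with probability at least $p$ if and only if $\rho\in S_{\vec{\mu},p}^{+}$.
   Context: Setting: two parties, Alice and Bob, each hold a quantum system with Hilbert space $\mathbb{C}^n$. A Schmidt vector is $\vec{\mu}=(\mu^1,\dots,\mu^n)$ with $\mu^1\ge\dots\ge\mu^n\ge 0$ and $\sum_i\mu^i=1$. For a bipartite pure state $|\psi\rangle$, $\vec{\lambda}_\psi$ denotes the vector of Schmidt coefficients in decreasing order, i.e. the eigenvalues, in decreasing order, of $\mathrm{Tr}_A|\psi\rangle\langle\psi|$. Weak supermajorization: for vectors $\vec\lambda,\vec\mu$ with entries in decreasing order and summing to 1, $p\vec{\lambda}\succ^w\vec{\mu}$ means $p\sum_{i=l}^n\lambda^i\le\sum_{i=l}^n\mu^i$ for all $l=1,\dots,n$. A decomposition $\{p_i,|\psi_i\rangle\}$ of $\rho$ is a finite ensemble of normalized pure states with $p_i\ge0$, $\sum_ip_i=1$, $\rho=\sum_ip_i|\psi_i\rangle\langle\psi_i|$.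 LOCC operations: quantum operations built from local quantum operations (including measurements) by Alice and by Bob together with classical communication between them. Conversion by LOCC with probability at least $p$ means that there is an LOCC protocol that, started on $|\psi_{\vec{\mu}}\rangle$, announces success with probability at least $p$, the output state conditioned on success being $\rho$. $\mathrm{LOCC}_1^A$ is the class of operations consisting of a local measurement/superoperator by Alice given by a set of commuting Kraus operators $A_i$ ($\sum_iA_i^\dagger A_i=\mathbf{1}$), followed by one-way classical communication from Alice to Bob, and local unitary transformations by Alice and Bob which may depend on Alice's outcome; i.e. maps $\mathcal{L}(\sigma)=\sum_i(U_iA_i\otimes V_i)\,\sigma\,(U_iA_i\otimes V_i)^\dagger$ with $U_i,V_i$ unitary. $S_{\vec{\mu},p}$ is the convex closure of the set of (projectors onto) pure states $|\psi\rangle\in\mathbb{C}^n\otimes\mathbb{C}^n$ with $p\vec{\lambda}_\psi\succ^w\vec{\mu}$; for a pure state, $|\psi\rangle\in S_{\vec{\mu},p}$ means $|\psi\rangle\langle\psi|\in S_{\vec{\mu},p}$. Further, $$S_{\vec{\mu},p}^{+}=\{\mathcal{L}(|\psi\rangle\langle\psi|)\;|\;\mathcal{L}\in\mathrm{LOCC}_1^A,\ |\psi\rangle\in S_{\vec{\mu},p}\}.$$ *)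

theory Defs
  imports
    "Jordan_Normal_Form.Schur_Decomposition"
    "Jordan_Normal_Form.Char_Poly"
    "HOL-Library.Multiset"
begin

type_synonym cmat = "complex mat"
type_synonym cvec = "complex vec"

text \<open>Library matrices do not form a type with a zero element (it depends on the dimension), so
  finite sums of square matrices of dimension \<open>d\<close> and convex hulls are written out explicitly.\<close>

definition mat_sum :: "nat \<Rightarrow> nat \<Rightarrow> (nat \<Rightarrow> cmat) \<Rightarrow> cmat" where
  "mat_sum d k F = mat d d (\<lambda>(i, j). \<Sum>t<k. F t $$ (i, j))"

definition convex_closure :: "nat \<Rightarrow> cmat set \<Rightarrow> cmat set" where
  "convex_closure d X = {mat_sum d k (\<lambda>t. complex_of_real (q t) \<cdot>\<^sub>m F t) | k q F.
     (\<forall>t<k. 0 \<le> q t \<and> F t \<in> X) \<and> (\<Sum>t<k. q t) = (1 :: real)}"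

text \<open>The basis vector \<open>|i\<rangle> \<otimes> |j\<rangle>\<close> of \<open>\<complex>\<^sup>a \<otimes> \<complex>\<^sup>b\<close> is the unit vector with index
  \<open>i * b + j\<close> of \<open>\<complex>\<^sup>a\<^sup>b\<close>; the first factor belongs to Alice, the second one to Bob.\<close>

definition kron :: "cmat \<Rightarrow> cmat \<Rightarrow> cmat" (infixl "\<otimes>\<^sub>k" 75) where
  "A \<otimes>\<^sub>k B = mat (dim_row A * dim_row B) (dim_col A * dim_col B)
     (\<lambda>(i, j). A $$ (i div dim_row B, j div dim_col B) * B $$ (i mod dim_row B, j mod dim_col B))"

definition partial_trace_A :: "nat \<Rightarrow> cmat \<Rightarrow> cmat" where
  "partial_trace_A n M = mat n n (\<lambda>(j, j'). \<Sum>i<n. M $$ (i * n + j, i * n + j'))"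

definition conj_by :: "cmat \<Rightarrow> cmat \<Rightarrow> cmat" where
  "conj_by K \<sigma> = K * \<sigma> * mat_adjoint K"

definition unitary_mat :: "nat \<Rightarrow> cmat \<Rightarrow> bool" where
  "unitary_mat n U \<longleftrightarrow> U \<in> carrier_mat n n \<and> mat_adjoint U * U = 1\<^sub>m n \<and> U * mat_adjoint U = 1\<^sub>m n"

definition pure_state :: "nat \<Rightarrow> cvec \<Rightarrow> bool" where
  "pure_state d \<psi> \<longleftrightarrow> \<psi> \<in> carrier_vec d \<and> \<psi> \<bullet>c \<psi> = 1"

definition projector :: "cvec \<Rightarrow> cmat" where
  "projector \<psi> = mat (dim_vec \<psi>) (dim_vec \<psi>) (\<lambda>(i, j). \<psi> $ i * cnj (\<psi> $ j))"

text \<open>In the order on \<open>complex\<close> used by the matrix library, \<open>0 \<le> z\<close> means that \<open>z\<close> is a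
  nonnegative real number; hence the second conjunct says that \<open>\<rho>\<close> is positive semidefinite.\<close>

definition density_matrix :: "nat \<Rightarrow> cmat \<Rightarrow> bool" where
  "density_matrix d \<rho> \<longleftrightarrow> \<rho> \<in> carrier_mat d d
     \<and> (\<forall>v \<in> carrier_vec d. 0 \<le> (\<rho> *\<^sub>v v) \<bullet>c v)
     \<and> (\<Sum>i<d. \<rho> $$ (i, i)) = 1"

text \<open>The eigenvalues of the reduced state (which are real), as the roots of its characteristic
  polynomial with multiplicity, in decreasing order.\<close>

definition schmidt_coeffs :: "nat \<Rightarrow> cvec \<Rightarrow> real vec" where
  "schmidt_coeffs n \<psi> = vec_of_list (rev (sorted_list_of_multiset
     (image_mset Re (proots (char_poly (partial_trace_A n (projector \<psi>)))))))"

definition schmidt_vector :: "nat \<Rightarrow> real vec \<Rightarrow> bool" where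
  "schmidt_vector n \<mu> \<longleftrightarrow> \<mu> \<in> carrier_vec n
     \<and> (\<forall>i j. i \<le> j \<and> j < n \<longrightarrow> \<mu> $ j \<le> \<mu> $ i) \<and> (\<forall>i<n. 0 \<le> \<mu> $ i) \<and> (\<Sum>i<n. \<mu> $ i) = 1"

text \<open>The relation \<open>v \<succ>\<^sup>w w\<close>, for vectors whose entries are in decreasing order; it is applied to
  \<open>v = p \<cdot>\<^sub>v \<lambda>\<close>. Indices start at 0.\<close>

definition weak_supermajorizes :: "real vec \<Rightarrow> real vec \<Rightarrow> bool" where
  "weak_supermajorizes v w \<longleftrightarrow> dim_vec v = dim_vec w
     \<and> (\<forall>l < dim_vec w. (\<Sum>i = l..<dim_vec w. v $ i) \<le> (\<Sum>i = l..<dim_vec w. w $ i))"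

definition decomposition ::
    "nat \<Rightarrow> cmat \<Rightarrow> nat \<Rightarrow> (nat \<Rightarrow> real) \<Rightarrow> (nat \<Rightarrow> cvec) \<Rightarrow> bool" where
  "decomposition d \<rho> k q \<phi> \<longleftrightarrow> (\<forall>i<k. 0 \<le> q i \<and> pure_state d (\<phi> i)) \<and> (\<Sum>i<k. q i) = 1
     \<and> \<rho> = mat_sum d k (\<lambda>i. complex_of_real (q i) \<cdot>\<^sub>m projector (\<phi> i))"

definition average_schmidt ::
    "nat \<Rightarrow> nat \<Rightarrow> (nat \<Rightarrow> real) \<Rightarrow> (nat \<Rightarrow> cvec) \<Rightarrow> real vec" where
  "average_schmidt n k q \<phi> = vec n (\<lambda>l. \<Sum>i<k. q i * schmidt_coeffs n (\<phi> i) $ l)"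

definition S_set :: "nat \<Rightarrow> real vec \<Rightarrow> real \<Rightarrow> cmat set" where
  "S_set n \<mu> p = convex_closure (n * n)
     {projector \<psi> | \<psi>. pure_state (n * n) \<psi> \<and> weak_supermajorizes (p \<cdot>\<^sub>v schmidt_coeffs n \<psi>) \<mu>}"

definition LOCC1A :: "nat \<Rightarrow> (cmat \<Rightarrow> cmat) set" where
  "LOCC1A n = {\<lambda>\<sigma>. mat_sum (n * n) k (\<lambda>i. conj_by ((U i * A i) \<otimes>\<^sub>k V i) \<sigma>) | k A U V.
     (\<forall>i<k. A i \<in> carrier_mat n n \<and> unitary_mat n (U i) \<and> unitary_mat n (V i))
     \<and> (\<forall>i<k. \<forall>j<k. A i * A j = A j * A i)
     \<and> mat_sum n k (\<lambda>i. mat_adjoint (A i) * A i) = 1\<^sub>m n}"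

definition S_plus :: "nat \<Rightarrow> real vec \<Rightarrow> real \<Rightarrow> cmat set" where
  "S_plus n \<mu> p = {\<L> (projector \<psi>) | \<L> \<psi>.
     \<L> \<in> LOCC1A n \<and> pure_state (n * n) \<psi> \<and> projector \<psi> \<in> S_set n \<mu> p}"

text \<open>A local quantum operation with measurement on a system of dimension \<open>a\<close>: there are \<open>k\<close>
  classical outcomes, and outcome \<open>j\<close> comes with the completely positive map given by the Kraus
  operators \<open>K j 0, \<dots>, K j (m j - 1)\<close> into a system of dimension \<open>a' j\<close>. Changing the dimension
  covers adding and discarding ancillas; the case \<open>k = 1\<close> is a local channel.\<close>

definition local_instrument ::
    "nat \<Rightarrow> nat \<Rightarrow> (nat \<Rightarrow> nat) \<Rightarrow> (nat \<Rightarrow> nat) \<Rightarrow> (nat \<Rightarrow> nat \<Rightarrow> cmat) \<Rightarrow> bool" where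
  "local_instrument a k a' m K \<longleftrightarrow> (\<forall>j<k. \<forall>r<m j. K j r \<in> carrier_mat (a' j) a)
     \<and> mat_sum a k (\<lambda>j. mat_sum a (m j) (\<lambda>r. mat_adjoint (K j r) * K j r)) = 1\<^sub>m a"

text \<open>\<open>locc c d a b E\<close>: there is an LOCC protocol, with finitely many rounds, starting on
  \<open>\<complex>\<^sup>a \<otimes> \<complex>\<^sup>b\<close> and ending on \<open>\<complex>\<^sup>c \<otimes> \<complex>\<^sup>d\<close>, that ends with the announcement of a classical
  message \<open>x\<close>, such that \<open>E x\<close> is the (unnormalised) operation performed when \<open>x\<close> is
  announced: the trace of \<open>E x \<sigma>\<close> is the probability of the announcement \<open>x\<close>, and \<open>E x \<sigma>\<close>
  divided by its trace is the output state conditioned on it. In each round one party applies a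
  local instrument and communicates the outcome \<open>j\<close>; the rest \<open>L j\<close> of the protocol may
  depend on \<open>j\<close> (and on all earlier outcomes).\<close>

inductive locc :: "nat \<Rightarrow> nat \<Rightarrow> nat \<Rightarrow> nat \<Rightarrow> ('x \<Rightarrow> cmat \<Rightarrow> cmat) \<Rightarrow> bool" for c d where
  announce: "locc c d c d (\<lambda>x \<sigma>. if x = y then \<sigma> else 0\<^sub>m (c * d) (c * d))"
| alice: "local_instrument a k a' m K \<Longrightarrow> (\<And>j. j < k \<Longrightarrow> locc c d (a' j) b (L j)) \<Longrightarrow>
    locc c d a b (\<lambda>x \<sigma>. mat_sum (c * d) k
      (\<lambda>j. L j x (mat_sum (a' j * b) (m j) (\<lambda>r. conj_by (K j r \<otimes>\<^sub>k 1\<^sub>m b) \<sigma>))))"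
| bob: "local_instrument b k b' m K \<Longrightarrow> (\<And>j. j < k \<Longrightarrow> locc c d a (b' j) (L j)) \<Longrightarrow>
    locc c d a b (\<lambda>x \<sigma>. mat_sum (c * d) k
      (\<lambda>j. L j x (mat_sum (a * b' j) (m j) (\<lambda>r. conj_by (1\<^sub>m a \<otimes>\<^sub>k K j r) \<sigma>))))"

text \<open>The protocol announces \<open>True\<close> (success) or \<open>False\<close> (failure). The target \<open>\<rho>\<close> has trace 1,
  so \<open>E True (projector \<psi>) = s \<cdot> \<rho>\<close> says that \<open>s\<close> is the success probability and, if it is not
  0, that \<open>\<rho>\<close> is the output state conditioned on success.\<close>

definition locc_convertible :: "nat \<Rightarrow> cvec \<Rightarrow> cmat \<Rightarrow> real \<Rightarrow> bool" where
  "locc_convertible n \<psi> \<rho> p \<longleftrightarrow> (\<exists>(E :: bool \<Rightarrow> cmat \<Rightarrow> cmat) s.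
     locc n n n n E \<and> p \<le> s \<and> E True (projector \<psi>) = complex_of_real s \<cdot>\<^sub>m \<rho>)"

end

theory Submission
  imports Defs
begin

text \<open>The tail sums of the Schmidt coefficients of a vector are its squared distances from the
  vectors of Schmidt rank at most \<open>l\<close> (Eckart-Young). Applying the same local operations to a
  vector and to its low-rank approximations does not raise the rank, and the total squared distance
  is conserved; so the average of the tail sums over the branches of an LOCC protocol cannot
  increase. This turns both a protocol and an element of \<open>S_plus\<close> into a decomposition of
  \<open>\<rho>\<close> with the required average.

  Conversely, let \<open>\<nu>\<close> be the average Schmidt vector of a decomposition. From the diagonal
  state with Schmidt vector \<open>\<nu>\<close>, a measurement that is diagonal in the Schmidt basis
  produces the whole ensemble. Starting from \<open>\<mu>\<close> instead, \<open>p \<nu>\<close> plus the weight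
  \<open>1 - p\<close> on the largest coefficient majorizes \<open>\<mu>\<close>, so \<open>\<mu>\<close> is a convex
  combination of permutations of it, and again a single measurement that is diagonal in the Schmidt
  basis, with branches for the permutation, the member of the ensemble and failure, suffices.\<close>

section \<open>Orthonormal families\<close>

text \<open>Tail sums of intermediate states are never formed. Within a protocol only vectors and
  their approximants are transported, by linear maps; spectral information enters at the two ends
  alone, where truncated Schmidt forms attain the tails and the Eckart-Young inequality bounds
  whatever approximants arrive. This copes with changing dimensions, several Kraus operators per
  outcome and discarded outcomes without diagonalizing anything on the way. The transported list of
  vectors is the same for every \<open>l\<close>, hence it is one decomposition that satisfies all
  tail inequalities at once. The factor \<open>p\<close> enters in two ways: a protocol succeeds
  with some \<open>s\<close> at least \<open>p\<close>, while an operation in \<open>LOCC1A\<close>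
  always succeeds but starts from states whose tails are only bounded by those of \<mu> divided by
  \<open>p\<close>. In the converse, the weight \<open>1 - p\<close> goes to the first coefficient
  because no tail with \<open>l > 0\<close> sees it, and with it the totals agree. The permutations
  cost no extra round: a branch undoes its permutation by relabelling the two Schmidt bases of its
  target.\<close>

definition cinner :: "nat \<Rightarrow> (nat \<Rightarrow> complex) \<Rightarrow> (nat \<Rightarrow> complex) \<Rightarrow> complex" where
  "cinner n x y = (\<Sum>i<n. x i * cnj (y i))"

text \<open>Functions on \<open>nat\<close>, of which only the values below \<open>n\<close> count,
  replace library vectors; families can then be extended by function update without carrier
  conditions.\<close>

definition orthonormal :: "nat \<Rightarrow> nat \<Rightarrow> (nat \<Rightarrow> nat \<Rightarrow> complex) \<Rightarrow> bool" where
  "orthonormal n m v \<longleftrightarrow> (\<forall>r<m. \<forall>s<m. cinner n (v r) (v s) = of_bool (r = s))"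

lemma cinner_diff_left: "cinner n (\<lambda>i. x i - y i) z = cinner n x z - cinner n y z"
  by (simp add: cinner_def sum_subtractf algebra_simps)

lemma cinner_scale_left: "cinner n (\<lambda>i. c * x i) z = c * cinner n x z"
  by (simp add: cinner_def sum_distrib_left algebra_simps)

lemma cinner_sum_left: "cinner n (\<lambda>i. \<Sum>r\<in>R. f r i) z = (\<Sum>r\<in>R. cinner n (f r) z)"
  unfolding cinner_def by (simp add: sum_distrib_right) (rule sum.swap)

lemma cinner_commute: "cinner n y x = cnj (cinner n x y)"
  by (simp add: cinner_def cnj_sum mult.commute)

lemma cinner_self: "cinner n x x = complex_of_real (\<Sum>i<n. (cmod (x i))\<^sup>2)"
  unfolding cinner_def of_real_sum complex_norm_square ..

lemma cinner_cong:
  "(\<And>i. i < n \<Longrightarrow> x i = x' i) \<Longrightarrow> (\<And>i. i < n \<Longrightarrow> y i = y' i) \<Longrightarrow> cinner n x y = cinner n x' y'"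
  by (simp add: cinner_def)

lemma orthonormalD: "orthonormal n m v \<Longrightarrow> r < m \<Longrightarrow> s < m \<Longrightarrow> cinner n (v r) (v s) = of_bool (r = s)"
  by (simp add: orthonormal_def)

text \<open>Collapses a Kronecker delta to a single value. The library rules
  \<open>sum_mult_of_bool_eq\<close> and \<open>sum_of_bool_mult_eq\<close> would produce a sum over
  an intersection instead, which is why they are often switched off where this is applied.\<close>

lemma sum_of_bool_mult:
  "finite A \<Longrightarrow> a \<in> A \<Longrightarrow> (\<Sum>x\<in>A. f x * of_bool (x = a)) = (f a :: 'a :: semiring_1)"
  "finite A \<Longrightarrow> a \<in> A \<Longrightarrow> (\<Sum>x\<in>A. f x * of_bool (a = x)) = f a"
  "finite A \<Longrightarrow> a \<in> A \<Longrightarrow> (\<Sum>x\<in>A. of_bool (x = a) * f x) = f a"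
  "finite A \<Longrightarrow> a \<in> A \<Longrightarrow> (\<Sum>x\<in>A. of_bool (a = x) * f x) = f a"
  by (simp_all add: of_bool_def if_distrib[of "(*) _"] if_distribR cong: if_cong)
    (simp_all add: if_distrib[of "\<lambda>z. z * _"] cong: if_cong)

lemma orthonormal_combination:
  assumes "orthonormal n m v" "s < m"
  shows "cinner n (\<lambda>i. \<Sum>r<m. g r * v r i) (v s) = g s"
proof -
  have "cinner n (\<lambda>i. \<Sum>r<m. g r * v r i) (v s) = (\<Sum>r<m. g r * of_bool (r = s))"
    unfolding cinner_sum_left cinner_scale_left using assms by (simp add: orthonormalD)
  then show ?thesis using assms(2) by (simp add: sum_of_bool_mult del: sum_mult_of_bool_eq)
qed

text \<open>Orthonormality says that the square matrix with rows \<open>v r\<close>, times its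
  conjugate transpose, is the identity. A one-sided inverse of a square matrix is two-sided, and the
  product in the other order is completeness.\<close>

lemma orthonormal_completeness:
  assumes "orthonormal n n v" "i < n" "j < n"
  shows "(\<Sum>r<n. v r i * cnj (v r j)) = of_bool (i = j)"
proof -
  define A where "A = mat n n (\<lambda>(r, i). v r i)"
  define B where "B = mat n n (\<lambda>(i, r). cnj (v r i))"
  have "A * B = 1\<^sub>m n"
    using assms(1) by (intro eq_matI) (auto simp: A_def B_def scalar_prod_def lessThan_atLeast0[symmetric]
        orthonormal_def cinner_def)
  then have "B * A = 1\<^sub>m n"
    by (intro mat_mult_left_right_inverse[of A n B]) (auto simp: A_def B_def)
  then have "(B * A) $$ (j, i) = 1\<^sub>m n $$ (j, i)" by simp
  then show ?thesis using assms(2,3)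
    by (auto simp: A_def B_def scalar_prod_def lessThan_atLeast0[symmetric] mult.commute)
qed

lemma orthonormal_expansion:
  assumes "orthonormal n n v" "i < n"
  shows "x i = (\<Sum>r<n. cinner n x (v r) * v r i)"
proof -
  have "(\<Sum>r<n. cinner n x (v r) * v r i) = (\<Sum>r<n. \<Sum>j<n. x j * (v r i * cnj (v r j)))"
    by (simp add: cinner_def sum_distrib_right sum_distrib_left algebra_simps)
  also have "\<dots> = (\<Sum>j<n. x j * (\<Sum>r<n. v r i * cnj (v r j)))"
    by (subst sum.swap) (simp add: sum_distrib_left)
  also have "\<dots> = (\<Sum>j<n. x j * of_bool (i = j))"
    using assms by (simp add: orthonormal_completeness)
  also have "\<dots> = x i" using assms(2) by (simp add: sum_of_bool_mult del: sum_mult_of_bool_eq)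
  finally show ?thesis by simp
qed

lemma parseval_cinner:
  assumes "orthonormal n n v"
  shows "(\<Sum>r<n. cinner n x (v r) * cnj (cinner n y (v r))) = cinner n x y"
proof -
  have "cinner n x y = cinner n (\<lambda>i. \<Sum>r<n. cinner n x (v r) * v r i) y"
    using orthonormal_expansion[OF assms] by (intro cinner_cong) auto
  also have "\<dots> = (\<Sum>r<n. cinner n x (v r) * cnj (cinner n y (v r)))"
    unfolding cinner_sum_left cinner_scale_left by (simp add: cinner_commute[of n y])
  finally show ?thesis by simp
qed

lemma parseval:
  assumes "orthonormal n n v"
  shows "(\<Sum>r<n. (cmod (cinner n x (v r)))\<^sup>2) = (\<Sum>i<n. (cmod (x i))\<^sup>2)"
proof -
  have "complex_of_real (\<Sum>r<n. (cmod (cinner n x (v r)))\<^sup>2) = complex_of_real (\<Sum>i<n. (cmod (x i))\<^sup>2)"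
    using parseval_cinner[OF assms, of x x] unfolding cinner_self of_real_sum
    unfolding complex_norm_square by simp
  then show ?thesis using of_real_eq_iff by blast
qed

text \<open>The new member is returned as an explicit multiple of \<open>z\<close>, so that linear
  relations of \<open>z\<close> can be carried over to it: an eigenvalue equation, or a term of a
  low-rank sum.\<close>

lemma orthonormal_append:
  assumes v: "orthonormal n m v" and zv: "\<And>s. s < m \<Longrightarrow> cinner n z (v s) = 0" and "j < n" "z j \<noteq> 0"
  obtains c where "0 < c" "orthonormal n (Suc m) (v(m := \<lambda>i. complex_of_real c * z i))"
proof -
  define N where "N = (\<Sum>i<n. (cmod (z i))\<^sup>2)"
  have "0 < N" unfolding N_def using assms(3,4)
    by (intro sum_pos2[of _ j]) auto
  define w where "w i = complex_of_real (1 / sqrt N) * z i" for i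
  have wv: "cinner n w (v s) = 0" "cinner n (v s) w = 0" if "s < m" for s
    using zv[OF that] unfolding w_def cinner_commute[of n "v s"] cinner_scale_left by auto
  have "cinner n w w = complex_of_real (1 / sqrt N) * cinner n z w"
    unfolding w_def by (rule cinner_scale_left)
  also have "cinner n z w = cnj (complex_of_real (1 / sqrt N) * cinner n z z)"
    unfolding cinner_commute[of n z w] w_def cinner_scale_left by simp
  also have "cinner n z z = of_real N" by (simp add: cinner_self N_def)
  also have "complex_of_real (1 / sqrt N) * cnj (complex_of_real (1 / sqrt N) * of_real N)
      = of_real (N / (sqrt N * sqrt N))" by (simp only: of_real_mult of_real_divide of_real_1 complex_cnj_mult complex_cnj_divide complex_cnj_complex_of_real complex_cnj_one) simp
  also have "\<dots> = 1" using \<open>0 < N\<close> by (simp only: real_sqrt_mult_self) simp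
  finally have ww: "cinner n w w = 1" .
  have "orthonormal n (Suc m) (v(m := w))"
    using v wv ww unfolding orthonormal_def by (auto simp: less_Suc_eq)
  then have "orthonormal n (Suc m) (v(m := \<lambda>i. complex_of_real (1 / sqrt N) * z i))"
    by (simp only: w_def[abs_def])
  with that[of "1 / sqrt N"] \<open>0 < N\<close> show ?thesis by auto
qed

text \<open>A unit vector orthogonal to fewer than \<open>n\<close> given ones is found by counting: the diagonal
  entries of the projector onto their span sum up to less than \<open>n\<close>, so one of them is less
  than 1, and the corresponding basis vector is not in the span.\<close>

lemma orthonormal_extend_one:
  assumes v: "orthonormal n m v" and "m < n"
  obtains w where "orthonormal n (Suc m) (v(m := w))"
proof -
  have "\<exists>j<n. (\<Sum>r<m. (cmod (v r j))\<^sup>2) < 1"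
  proof (rule ccontr)
    assume "\<not> ?thesis"
    then have "(\<Sum>j<n. 1) \<le> (\<Sum>j<n. \<Sum>r<m. (cmod (v r j))\<^sup>2)"
      by (intro sum_mono) (metis lessThan_iff not_less)
    also have "\<dots> = (\<Sum>r<m. \<Sum>j<n. (cmod (v r j))\<^sup>2)" by (rule sum.swap)
    also have "\<dots> = (\<Sum>r<m. 1)"
    proof (rule sum.cong)
      fix r assume "r \<in> {..<m}"
      then have "cinner n (v r) (v r) = 1" using v by (simp add: orthonormal_def)
      then show "(\<Sum>j<n. (cmod (v r j))\<^sup>2) = 1" unfolding cinner_self using of_real_eq_1_iff by blast
    qed simp
    finally show False using \<open>m < n\<close> by simp
  qed
  then obtain j where j: "j < n" "(\<Sum>r<m. (cmod (v r j))\<^sup>2) < 1" by blast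
  define z where "z i = of_bool (i = j) - (\<Sum>r<m. cnj (v r j) * v r i)" for i
  have zv: "cinner n z (v s) = 0" if "s < m" for s
  proof -
    have "cinner n z (v s) = cinner n (\<lambda>i. of_bool (i = j)) (v s) - cnj (v s j)"
      unfolding z_def cinner_diff_left using orthonormal_combination[OF v that] by simp
    also have "cinner n (\<lambda>i. of_bool (i = j)) (v s) = cnj (v s j)"
      using j by (simp add: cinner_def sum_of_bool_mult del: sum_of_bool_mult_eq)
    finally show ?thesis by simp
  qed
  have "z j = 1 - complex_of_real (\<Sum>r<m. (cmod (v r j))\<^sup>2)"
    unfolding z_def of_real_sum complex_norm_square by (simp add: mult.commute)
  also have "\<dots> = complex_of_real (1 - (\<Sum>r<m. (cmod (v r j))\<^sup>2))" by simp
  finally have "z j \<noteq> 0" using j(2) by (metis diff_gt_0_iff_gt less_irrefl of_real_eq_0_iff)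
  show ?thesis by (rule orthonormal_append[OF v zv j(1) \<open>z j \<noteq> 0\<close>]) (use that in auto)
qed

lemma orthonormal_extend:
  assumes "orthonormal n m v" "m \<le> n"
  obtains W where "orthonormal n n W" "\<And>r. r < m \<Longrightarrow> W r = v r"
proof -
  have "\<exists>W. orthonormal n (m + k) W \<and> (\<forall>r<m. W r = v r)" if "m + k \<le> n" for k
    using that
  proof (induction k)
    case 0
    then show ?case using assms by auto
  next
    case (Suc k)
    then obtain W where W: "orthonormal n (m + k) W" "\<forall>r<m. W r = v r" by auto
    obtain w where "orthonormal n (Suc (m + k)) (W(m + k := w))"
      using orthonormal_extend_one[OF W(1)] Suc.prems by auto
    with W(2) show ?case by (intro exI[of _ "W(m + k := w)"]) (simp del: fun_upd_apply, simp)
  qed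
  from this[of "n - m"] assms(2) that show ?thesis by auto
qed

text \<open>In a full basis extending \<open>w\<close>, subtracting a combination of
  \<open>w\<close> does not change the coefficients from \<open>m\<close> on, and by
  \<open>parseval\<close> these alone account for the left side.\<close>

lemma dist_orthonormal_ge:
  assumes w: "orthonormal n m w" "m \<le> n"
  shows "(\<Sum>i<n. (cmod (x i))\<^sup>2) - (\<Sum>r<m. (cmod (cinner n x (w r)))\<^sup>2)
    \<le> (\<Sum>i<n. (cmod (x i - (\<Sum>r<m. g r * w r i)))\<^sup>2)"
proof -
  obtain W where W: "orthonormal n n W" "\<And>r. r < m \<Longrightarrow> W r = w r"
    using orthonormal_extend[OF w] by blast
  define z where "z i = x i - (\<Sum>r<m. g r * W r i)" for i
  have split: "(\<Sum>r<n. f r) = (\<Sum>r<m. f r) + (\<Sum>r=m..<n. f r)" for f :: "nat \<Rightarrow> real"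
    using w(2) by (metis atLeast0LessThan le0 sum.atLeastLessThan_concat)
  have *: "cinner n z (W s) = cinner n x (W s)" if "m \<le> s" "s < n" for s
  proof -
    have "cinner n (\<lambda>i. \<Sum>r<m. g r * W r i) (W s) = 0"
      unfolding cinner_sum_left cinner_scale_left
      using that W(1) by (intro sum.neutral) (auto simp: orthonormal_def)
    then show ?thesis unfolding z_def cinner_diff_left by simp
  qed
  have "(\<Sum>i<n. (cmod (x i))\<^sup>2) - (\<Sum>r<m. (cmod (cinner n x (W r)))\<^sup>2)
      = (\<Sum>r=m..<n. (cmod (cinner n z (W r)))\<^sup>2)"
    using parseval[OF W(1), of x] split[of "\<lambda>r. (cmod (cinner n x (W r)))\<^sup>2"] by (simp add: *)
  also have "\<dots> \<le> (\<Sum>r<n. (cmod (cinner n z (W r)))\<^sup>2)"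
    by (intro sum_mono2) auto
  also have "\<dots> = (\<Sum>i<n. (cmod (z i))\<^sup>2)" by (rule parseval[OF W(1)])
  finally show ?thesis using W(2) by (simp add: z_def)
qed

lemma bessel:
  assumes w: "orthonormal n m w" "m \<le> n"
  shows "(\<Sum>r<m. (cmod (cinner n x (w r)))\<^sup>2) \<le> (\<Sum>i<n. (cmod (x i))\<^sup>2)"
proof -
  obtain W where W: "orthonormal n n W" "\<And>r. r < m \<Longrightarrow> W r = w r"
    using orthonormal_extend[OF w] by blast
  have "(\<Sum>r<m. (cmod (cinner n x (w r)))\<^sup>2) = (\<Sum>r<m. (cmod (cinner n x (W r)))\<^sup>2)"
    using W(2) by simp
  also have "\<dots> \<le> (\<Sum>r<n. (cmod (cinner n x (W r)))\<^sup>2)"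
    using w(2) by (intro sum_mono2) auto
  finally show ?thesis by (simp add: parseval[OF W(1)])
qed

section \<open>Schmidt decomposition\<close>

lemma complex_eigenvector_exists:
  fixes B :: "complex mat"
  assumes "B \<in> carrier_mat k k" "0 < k"
  obtains u e where "eigenvector B u e"
proof -
  obtain as where as: "char_poly B = (\<Prod>a\<leftarrow>as. [:- a, 1:])" "length as = k"
    using char_poly_factorized[OF assms(1)] by blast
  then obtain a where "a \<in> set as" using assms(2) by (cases as) auto
  then have "poly (char_poly B) a = 0"
    unfolding as(1) poly_prod_list prod_list_zero_iff by auto
  then have "eigenvalue B a" using eigenvalue_root_char_poly[OF assms(1)] by blast
  then show ?thesis using that unfolding eigenvalue_def by blast
qed

text \<open>The compression of \<open>G\<close> to the orthogonal complement of the given eigenvectors has an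
  eigenvector; since the complement is invariant, it is an eigenvector of \<open>G\<close>.\<close>

lemma hermitian_eigenvector_append:
  fixes n :: nat and G :: "nat \<Rightarrow> nat \<Rightarrow> complex"
  defines "T \<equiv> \<lambda>x i. \<Sum>j<n. G i j * x j"
  assumes herm: "\<And>i j. i < n \<Longrightarrow> j < n \<Longrightarrow> G i j = cnj (G j i)"
    and v: "orthonormal n m v" "m < n"
    and ev: "\<And>r i. r < m \<Longrightarrow> i < n \<Longrightarrow> T (v r) i = l r * v r i"
  obtains w e where "orthonormal n (Suc m) (v(m := w))" "\<And>i. i < n \<Longrightarrow> T w i = e * w i"
proof -
  obtain W where W: "orthonormal n n W" "\<And>r. r < m \<Longrightarrow> W r = v r"
    using orthonormal_extend[OF v(1)] v(2) by auto
  define B where "B = mat (n - m) (n - m) (\<lambda>(i, j). cinner n (T (W (m + j))) (W (m + i)))"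
  have "B \<in> carrier_mat (n - m) (n - m)" "0 < n - m" using v(2) by (auto simp: B_def)
  then obtain u e where "eigenvector B u e" by (rule complex_eigenvector_exists)
  then have u: "u \<in> carrier_vec (n - m)" "u \<noteq> 0\<^sub>v (n - m)" and Bu: "B *\<^sub>v u = e \<cdot>\<^sub>v u"
    unfolding eigenvector_def by (auto simp: B_def)
  have Bu': "(\<Sum>j<n - m. cinner n (T (W (m + j))) (W (m + i)) * u $ j) = e * u $ i" if "i < n - m" for i
  proof -
    have "(B *\<^sub>v u) $ i = (e \<cdot>\<^sub>v u) $ i" by (simp add: Bu)
    then show ?thesis using that u(1) by (simp add: B_def scalar_prod_def lessThan_atLeast0)
  qed
  have herm_T: "cinner n (T x) y = cinner n x (T y)" for x y
  proof -
    have "cinner n (T x) y = (\<Sum>i<n. \<Sum>j<n. G i j * x j * cnj (y i))"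
      by (simp add: cinner_def T_def sum_distrib_right)
    also have "\<dots> = (\<Sum>j<n. \<Sum>i<n. G i j * x j * cnj (y i))" by (rule sum.swap)
    also have "\<dots> = (\<Sum>j<n. \<Sum>i<n. cnj (G j i) * x j * cnj (y i))"
      using herm by (intro sum.cong refl) (metis lessThan_iff)
    also have "\<dots> = cinner n x (T y)"
      by (simp add: cinner_def T_def sum_distrib_left algebra_simps)
    finally show ?thesis .
  qed
  define w where "w a = (\<Sum>j<n - m. u $ j * W (m + j) a)" for a
  have wW: "cinner n w (W s) = 0" if "s < m" for s
    using that W(1) v(2) unfolding w_def cinner_sum_left cinner_scale_left
    by (intro sum.neutral) (auto simp: orthonormal_def)
  have wW': "cinner n w (W (m + i)) = u $ i" if "i < n - m" for i
  proof -
    have "cinner n w (W (m + i)) = (\<Sum>j<n - m. u $ j * of_bool (j = i))"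
      using that W(1) unfolding w_def cinner_sum_left cinner_scale_left
      by (intro sum.cong) (auto simp: orthonormal_def)
    then show ?thesis using that by (simp add: sum_of_bool_mult del: sum_mult_of_bool_eq)
  qed
  have Tw: "T w = (\<lambda>i. \<Sum>j<n - m. u $ j * T (W (m + j)) i)"
  proof
    fix i
    have "T w i = (\<Sum>a<n. \<Sum>j<n - m. G i a * (u $ j * W (m + j) a))"
      by (simp add: T_def w_def sum_distrib_left)
    also have "\<dots> = (\<Sum>j<n - m. \<Sum>a<n. G i a * (u $ j * W (m + j) a))" by (rule sum.swap)
    also have "\<dots> = (\<Sum>j<n - m. u $ j * T (W (m + j)) i)"
      by (simp add: T_def sum_distrib_left algebra_simps)
    finally show "T w i = (\<Sum>j<n - m. u $ j * T (W (m + j)) i)" .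
  qed
  \<comment> \<open>It suffices to compare coefficients in \<open>W\<close>. For
    \<open>s < m\<close> both sides vanish, the left one because \<open>T\<close> is symmetric and
    \<open>W s\<close> is an eigenvector; for the other \<open>s\<close> this is the eigenvector
    equation of \<open>B\<close>.\<close>
  have TwW: "cinner n (T w) (W s) = e * cinner n w (W s)" if "s < n" for s
  proof (cases "s < m")
    case True
    have "cinner n (T w) (W s) = cinner n w (\<lambda>i. l s * W s i)"
      unfolding herm_T using ev True W(2) by (intro cinner_cong) auto
    also have "\<dots> = cnj (l s) * cinner n w (W s)"
      by (simp add: cinner_commute[of n w] cinner_scale_left)
    finally show ?thesis using wW[OF True] by simp
  next
    case False
    define i where "i = s - m"
    have s: "s = m + i" "i < n - m" using False that by (auto simp: i_def)
    have "cinner n (T w) (W s) = (\<Sum>j<n - m. u $ j * cinner n (T (W (m + j))) (W s))"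
      unfolding Tw cinner_sum_left cinner_scale_left ..
    also have "\<dots> = e * u $ i" using Bu'[OF s(2)] by (simp add: s(1) mult.commute)
    finally show ?thesis using wW'[OF s(2)] s(1) by simp
  qed
  have Tw_eq: "T w i = e * w i" if "i < n" for i
    using orthonormal_expansion[OF W(1) that, of "T w"] orthonormal_expansion[OF W(1) that, of w]
    by (simp add: TwW sum_distrib_left mult.assoc)
  have "\<exists>j<n. w j \<noteq> 0"
  proof (rule ccontr)
    assume "\<not> ?thesis"
    then have "cinner n w (W (m + i)) = 0" for i by (auto simp: cinner_def intro!: sum.neutral)
    then have "u = 0\<^sub>v (n - m)" using wW' u(1) by (intro eq_vecI) auto
    with u(2) show False by simp
  qed
  then obtain j where j: "j < n" "w j \<noteq> 0" by blast
  have wv: "cinner n w (v s) = 0" if "s < m" for s using wW[OF that] W(2)[OF that] by simp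
  obtain c where c: "orthonormal n (Suc m) (v(m := \<lambda>i. complex_of_real c * w i))"
    using orthonormal_append[OF v(1) wv j] by blast
  have "T (\<lambda>i. complex_of_real c * w i) i = e * (complex_of_real c * w i)" if "i < n" for i
  proof -
    have "T (\<lambda>i. complex_of_real c * w i) i = complex_of_real c * T w i"
      by (simp add: T_def sum_distrib_left algebra_simps)
    then show ?thesis using Tw_eq[OF that] by simp
  qed
  from that[OF c this] show ?thesis .
qed

lemma hermitian_spectral:
  fixes n :: nat and G :: "nat \<Rightarrow> nat \<Rightarrow> complex"
  assumes herm: "\<And>i j. i < n \<Longrightarrow> j < n \<Longrightarrow> G i j = cnj (G j i)"
  obtains v l where "orthonormal n n v"
    "\<And>r i. r < n \<Longrightarrow> i < n \<Longrightarrow> (\<Sum>j<n. G i j * v r j) = l r * v r i"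
proof -
  have "\<exists>v l. orthonormal n m v \<and> (\<forall>r<m. \<forall>i<n. (\<Sum>j<n. G i j * v r j) = l r * v r i)" if "m \<le> n" for m
    using that
  proof (induction m)
    case 0
    then show ?case by (auto simp: orthonormal_def)
  next
    case (Suc m)
    then obtain v l where v: "orthonormal n m v"
      "\<And>r i. r < m \<Longrightarrow> i < n \<Longrightarrow> (\<Sum>j<n. G i j * v r j) = l r * v r i" by auto
    have "m < n" using Suc.prems by simp
    from hermitian_eigenvector_append[OF herm v(1) this v(2)]
    obtain w e where w: "orthonormal n (Suc m) (v(m := w))" "\<And>i. i < n \<Longrightarrow> (\<Sum>j<n. G i j * w j) = e * w i"
      by metis
    show ?case
    proof (intro exI conjI allI impI)
      show "orthonormal n (Suc m) (v(m := w))" by (rule w(1))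
      fix r i assume "r < Suc m" "i < n"
      then show "(\<Sum>j<n. G i j * (v(m := w)) r j) = (l(m := e)) r * (v(m := w)) r i"
        using w(2)[of i] v(2)[of r i] by (auto simp: less_Suc_eq)
    qed
  qed
  from this[of n] show ?thesis using that by (metis order_refl)
qed

lemma decreasing_arrangement:
  fixes f :: "nat \<Rightarrow> real"
  obtains \<sigma> where "\<sigma> permutes {..<n}" "\<And>i j. i \<le> j \<Longrightarrow> j < n \<Longrightarrow> f (\<sigma> j) \<le> f (\<sigma> i)"
proof -
  define xs where "xs = sort_key (\<lambda>r. - f r) [0..<n]"
  define \<sigma> where "\<sigma> i = (if i < n then xs ! i else i)" for i
  have xs: "length xs = n" "distinct xs" "set xs = {..<n}" by (auto simp: xs_def)
  have "bij_betw ((!) xs) {..<n} {..<n}"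
    by (rule bij_betw_nth[OF xs(2)]) (simp_all only: xs)
  moreover have "bij_betw \<sigma> {..<n} {..<n} = bij_betw ((!) xs) {..<n} {..<n}"
    by (rule bij_betw_cong) (simp add: \<sigma>_def)
  ultimately have "bij_betw \<sigma> {..<n} {..<n}" by blast
  then have "\<sigma> permutes {..<n}" by (rule bij_imp_permutes) (simp add: \<sigma>_def)
  moreover have "f (\<sigma> j) \<le> f (\<sigma> i)" if "i \<le> j" "j < n" for i j
  proof -
    have "sorted (map (\<lambda>r. - f r) xs)" by (simp add: xs_def)
    then have "map (\<lambda>r. - f r) xs ! i \<le> map (\<lambda>r. - f r) xs ! j"
      using that xs(1) by (intro sorted_nth_mono) auto
    then show ?thesis using that xs(1) by (simp add: \<sigma>_def)
  qed
  ultimately show ?thesis by (rule that)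
qed

lemma orthonormal_cnj: "orthonormal n m v \<Longrightarrow> orthonormal n m (\<lambda>r i. cnj (v r i))"
proof -
  have "cinner n (\<lambda>i. cnj (x i)) (\<lambda>i. cnj (y i)) = cnj (cinner n x y)" for x y
    by (simp add: cinner_def)
  then show "orthonormal n m v \<Longrightarrow> orthonormal n m (\<lambda>r i. cnj (v r i))" by (simp add: orthonormal_def)
qed

lemma orthonormal_permute:
  assumes "orthonormal n m v" "\<sigma> permutes {..<m}"
  shows "orthonormal n m (\<lambda>r. v (\<sigma> r))"
  unfolding orthonormal_def
proof (intro allI impI)
  fix r s assume "r < m" "s < m"
  then have "\<sigma> r < m" "\<sigma> s < m" using permutes_in_image[OF assms(2)] by auto
  then show "cinner n (v (\<sigma> r)) (v (\<sigma> s)) = of_bool (r = s)"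
    using assms(1) inj_eq[OF permutes_inj[OF assms(2)]] by (simp add: orthonormal_def)
qed

lemma triple_sum_swap: "(\<Sum>a\<in>A. \<Sum>b\<in>B. \<Sum>c\<in>C. f a b c) = (\<Sum>c\<in>C. \<Sum>b\<in>B. \<Sum>a\<in>A. f a b c)"
proof -
  have "(\<Sum>a\<in>A. \<Sum>b\<in>B. \<Sum>c\<in>C. f a b c) = (\<Sum>b\<in>B. \<Sum>a\<in>A. \<Sum>c\<in>C. f a b c)" by (rule sum.swap)
  also have "\<dots> = (\<Sum>b\<in>B. \<Sum>c\<in>C. \<Sum>a\<in>A. f a b c)" by (intro sum.cong refl sum.swap)
  also have "\<dots> = (\<Sum>c\<in>C. \<Sum>b\<in>B. \<Sum>a\<in>A. f a b c)" by (rule sum.swap)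
  finally show ?thesis .
qed

text \<open>The eigenvectors of the Gram matrix \<open>G\<close> have pairwise orthogonal images
  under \<open>X\<close>. The lengths of the images are the singular values, and the nonzero images,
  normalised, are the left vectors. As \<open>v\<close> appears unconjugated in the expansion, the
  conjugates of the eigenvectors are returned.\<close>

lemma singular_value_decomposition:
  fixes X :: "nat \<Rightarrow> nat \<Rightarrow> complex"
  obtains s :: "nat \<Rightarrow> real" and u v where "orthonormal n n u" "orthonormal n n v"
    "\<And>r. 0 \<le> s r" "\<And>i j. i \<le> j \<Longrightarrow> j < n \<Longrightarrow> s j \<le> s i"
    "\<And>i k. i < n \<Longrightarrow> k < n \<Longrightarrow> X i k = (\<Sum>r<n. complex_of_real (s r) * u r i * v r k)"
proof -
  define G where "G i j = (\<Sum>k<n. cnj (X k i) * X k j)" for i j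
  define T where "T x i = (\<Sum>k<n. X i k * x k)" for x i
  have "G i j = cnj (G j i)" for i j by (simp add: G_def mult.commute)
  from hermitian_spectral[of n G, OF this] obtain v0 l0 where v0: "orthonormal n n v0"
    "\<And>r i. r < n \<Longrightarrow> i < n \<Longrightarrow> (\<Sum>j<n. G i j * v0 r j) = l0 r * v0 r i"
    by metis
  \<comment> \<open>Sorting goes by the squared lengths of the images, which are visibly real and
    nonnegative, whereas \<open>l0\<close> is only given as a complex function.\<close>
  define nr where "nr r = (\<Sum>i<n. (cmod (T (v0 r) i))\<^sup>2)" for r
  obtain \<sigma> where \<sigma>: "\<sigma> permutes {..<n}" "\<And>i j. i \<le> j \<Longrightarrow> j < n \<Longrightarrow> nr (\<sigma> j) \<le> nr (\<sigma> i)"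
    using decreasing_arrangement[where f=nr and n=n] by blast
  define v where "v r = v0 (\<sigma> r)" for r
  define s where "s r = sqrt (nr (\<sigma> r))" for r
  have \<sigma>_less: "\<sigma> r < n" if "r < n" for r using permutes_in_image[OF \<sigma>(1)] that by auto
  have v: "orthonormal n n v" unfolding v_def[abs_def] by (rule orthonormal_permute[OF v0(1) \<sigma>(1)])
  have s_nonneg: "0 \<le> s r" for r by (simp add: s_def nr_def sum_nonneg)
  have s_mono: "s j \<le> s i" if "i \<le> j" "j < n" for i j using \<sigma>(2)[OF that] by (simp add: s_def)
  have orth: "cinner n (T (v r)) (T (v q)) = complex_of_real ((s r)\<^sup>2) * of_bool (r = q)"
    if "r < n" "q < n" for r q
  proof -
    have *: "cinner n (T x) (T y) = cinner n (\<lambda>i. \<Sum>j<n. G i j * x j) y" for x y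
    proof -
      have "cinner n (T x) (T y) = (\<Sum>k<n. \<Sum>j<n. \<Sum>i<n. X k j * x j * (cnj (X k i) * cnj (y i)))"
        by (simp add: cinner_def T_def sum_product)
      also have "\<dots> = (\<Sum>i<n. \<Sum>j<n. \<Sum>k<n. X k j * x j * (cnj (X k i) * cnj (y i)))"
        by (rule triple_sum_swap)
      also have "\<dots> = cinner n (\<lambda>i. \<Sum>j<n. G i j * x j) y"
        by (simp add: cinner_def G_def sum_distrib_left sum_distrib_right algebra_simps)
      finally show ?thesis .
    qed
    have "cinner n (T (v r)) (T (v q)) = cinner n (\<lambda>i. l0 (\<sigma> r) * v0 (\<sigma> r) i) (v q)"
      unfolding * using v0(2) \<sigma>_less that by (intro cinner_cong) (auto simp: v_def)
    also have "\<dots> = l0 (\<sigma> r) * of_bool (r = q)"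
      unfolding cinner_scale_left using v that by (simp add: v_def[symmetric] orthonormal_def)
    finally have eq: "cinner n (T (v r)) (T (v q)) = l0 (\<sigma> r) * of_bool (r = q)" .
    show ?thesis
    proof (cases "r = q")
      case True
      have "cinner n (T (v r)) (T (v r)) = complex_of_real (nr (\<sigma> r))"
        unfolding cinner_self by (simp add: nr_def v_def)
      moreover have "(s r)\<^sup>2 = nr (\<sigma> r)" by (simp add: s_def nr_def sum_nonneg)
      ultimately show ?thesis using True by simp
    qed (use eq in simp)
  qed
  \<comment> \<open>The number of nonzero singular values, since \<open>s\<close> decreases. The
    disjunct \<open>r = n\<close> makes the least element exist when none vanishes.\<close>
  define m where "m = (LEAST r. r = n \<or> s r = 0)"
  have m: "m \<le> n" unfolding m_def by (rule Least_le) simp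
  have s_pos: "s r \<noteq> 0" if "r < m" for r
    using not_less_Least[of r "\<lambda>r. r = n \<or> s r = 0"] that by (simp add: m_def)
  have s_zero: "s r = 0" if "m \<le> r" "r < n" for r
  proof -
    have "m = n \<or> s m = 0" unfolding m_def by (rule LeastI[of _ n]) simp
    then have "s m = 0" using that by simp
    then show ?thesis using s_mono[OF that] s_nonneg[of r] by simp
  qed
  define u0 where "u0 r i = T (v r) i / complex_of_real (s r)" for r i
  have "orthonormal n m u0"
    unfolding orthonormal_def
  proof (intro allI impI)
    fix r q assume rq: "r < m" "q < m"
    have "cinner n (u0 r) (u0 q) = cinner n (T (v r)) (T (v q)) / (complex_of_real (s r) * complex_of_real (s q))"
      by (simp add: cinner_def u0_def sum_divide_distrib)
    also have "\<dots> = of_bool (r = q)" using rq m s_pos[OF rq(1)] s_pos[OF rq(2)] by (simp add: orth power2_eq_square)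
    finally show "cinner n (u0 r) (u0 q) = of_bool (r = q)" .
  qed
  \<comment> \<open>From \<open>m\<close> on the images \<open>T (v r)\<close> are zero, so any
    completion of the left vectors will do.\<close>
  from orthonormal_extend[OF this m]
  obtain u where u: "orthonormal n n u" "\<And>r. r < m \<Longrightarrow> u r = u0 r"
    by metis
  have Tv: "T (v r) i = complex_of_real (s r) * u r i" if "r < n" "i < n" for r i
  proof (cases "r < m")
    case True
    then show ?thesis using s_pos u(2) by (simp add: u0_def)
  next
    case False
    then have "s r = 0" using s_zero that by simp
    then have "cinner n (T (v r)) (T (v r)) = 0" using orth[OF that(1) that(1)] by simp
    then have "(\<Sum>i<n. (cmod (T (v r) i))\<^sup>2) = 0" unfolding cinner_self of_real_eq_0_iff .
    then have "T (v r) i = 0" using that(2) by (subst (asm) sum_nonneg_eq_0_iff) auto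
    then show ?thesis using \<open>s r = 0\<close> by simp
  qed
  \<comment> \<open>Row \<open>i\<close> of \<open>X\<close> is expanded in the conjugated basis
    because its coefficients there are exactly \<open>T (v r) i\<close>.\<close>
  have v': "orthonormal n n (\<lambda>r i. cnj (v r i))" by (rule orthonormal_cnj[OF v])
  have "X i k = (\<Sum>r<n. complex_of_real (s r) * u r i * cnj (v r k))" if "i < n" "k < n" for i k
  proof -
    have "X i k = (\<Sum>r<n. cinner n (X i) (\<lambda>j. cnj (v r j)) * cnj (v r k))"
      by (rule orthonormal_expansion[OF v' that(2)])
    also have "\<dots> = (\<Sum>r<n. complex_of_real (s r) * u r i * cnj (v r k))"
      using Tv that by (intro sum.cong) (auto simp: cinner_def T_def)
    finally show ?thesis .
  qed
  from that[OF u(1) v' s_nonneg s_mono this] show ?thesis .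
qed

subsection \<open>Vectors of a bipartite system\<close>

lemma pair_index:
  fixes i k a b :: nat
  assumes "i < a" "k < b"
  shows "i * b + k < a * b" "(i * b + k) div b = i" "(i * b + k) mod b = k"
proof -
  have "i * b + k < i * b + b" using assms by simp
  also have "\<dots> = Suc i * b" by simp
  also have "\<dots> \<le> a * b" using assms by (intro mult_le_mono1) simp
  finally show "i * b + k < a * b" .
qed (use assms in auto)

lemma sum_pair_index: "(\<Sum>j<a * b. f j) = (\<Sum>i<a. \<Sum>k<b. f (i * b + k))"
  for a b :: nat and f :: "nat \<Rightarrow> 'a :: comm_monoid_add"
proof -
  have "(\<Sum>i<a. \<Sum>k<b. f (i * b + k)) = (\<Sum>i<a. sum f {i * b..<i * b + b})"
  proof (rule sum.cong)
    fix i
    show "(\<Sum>k<b. f (i * b + k)) = sum f {i * b..<i * b + b}"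
      by (rule sum.reindex_bij_witness[of _ "\<lambda>j. j - i * b" "\<lambda>k. i * b + k"]) auto
  qed simp
  then show ?thesis by (simp add: sum.nat_group)
qed

lemma pair_index_vec_eqI:
  assumes "v \<in> carrier_vec (a * b)" "w \<in> carrier_vec (a * b)"
    "\<And>i k. i < a \<Longrightarrow> k < b \<Longrightarrow> v $ (i * b + k) = w $ (i * b + k)"
  shows "v = w"
proof (rule eq_vecI)
  fix j assume "j < dim_vec w"
  then have j: "j < a * b" using assms(2) by auto
  then have "j div b < a" "j mod b < b"
    by (auto simp: less_mult_imp_div_less intro!: mod_less_divisor)
      (metis gr_zeroI mult_0_right not_less0)
  from assms(3)[OF this] show "v $ j = w $ j" by simp
qed (use assms in auto)

definition norm_sq :: "cvec \<Rightarrow> real" where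
  "norm_sq v = (\<Sum>i<dim_vec v. (cmod (v $ i))\<^sup>2)"

lemma norm_sq_nonneg: "0 \<le> norm_sq v"
  by (simp add: norm_sq_def sum_nonneg)

lemma norm_sq_pair:
  "v \<in> carrier_vec (a * b) \<Longrightarrow> norm_sq v = (\<Sum>i<a. \<Sum>k<b. (cmod (v $ (i * b + k)))\<^sup>2)"
  by (simp add: norm_sq_def sum_pair_index)

lemma cscalar_prod_self: "v \<bullet>c v = complex_of_real (norm_sq v)"
  unfolding norm_sq_def of_real_sum complex_norm_square
  by (simp add: scalar_prod_def lessThan_atLeast0)

lemma pure_state_iff: "pure_state d \<phi> \<longleftrightarrow> \<phi> \<in> carrier_vec d \<and> norm_sq \<phi> = 1"
  by (simp add: pure_state_def cscalar_prod_self)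

text \<open>Neither sign, order nor orthonormality is built in, so that truncations, differences,
  multiples and permutations of a Schmidt decomposition keep this form.\<close>

definition schmidt_form ::
    "nat \<Rightarrow> (nat \<Rightarrow> real) \<Rightarrow> (nat \<Rightarrow> nat \<Rightarrow> complex) \<Rightarrow> (nat \<Rightarrow> nat \<Rightarrow> complex) \<Rightarrow> cvec" where
  "schmidt_form n s u v =
    vec (n * n) (\<lambda>i. \<Sum>l<n. complex_of_real (s l) * u l (i div n) * v l (i mod n))"

lemma schmidt_form_carrier [simp]: "schmidt_form n s u v \<in> carrier_vec (n * n)"
  by (simp add: schmidt_form_def)

lemma schmidt_form_dim [simp]: "dim_vec (schmidt_form n s u v) = n * n"
  by (simp add: schmidt_form_def)

lemma schmidt_form_index:
  "i < n \<Longrightarrow> k < n \<Longrightarrow>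
    schmidt_form n s u v $ (i * n + k) = (\<Sum>l<n. complex_of_real (s l) * u l i * v l k)"
  by (simp add: schmidt_form_def pair_index)

lemma schmidt_form_cong:
  "(\<And>l. l < n \<Longrightarrow> s l = s' l) \<Longrightarrow> schmidt_form n s u v = schmidt_form n s' u v"
  by (simp add: schmidt_form_def)

lemma schmidt_form_smult:
  "complex_of_real c \<cdot>\<^sub>v schmidt_form n s u v = schmidt_form n (\<lambda>l. c * s l) u v"
  by (intro eq_vecI) (simp_all add: schmidt_form_def sum_distrib_left mult.assoc)

lemma schmidt_form_diff:
  "schmidt_form n s u v - schmidt_form n t u v = schmidt_form n (\<lambda>l. s l - t l) u v"
  by (intro eq_vecI) (simp_all add: schmidt_form_def sum_subtractf algebra_simps)

text \<open>Parseval along the basis \<open>v\<close> of the second factor removes the cross terms;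
  what remains is the unit length of each \<open>u q\<close>.\<close>

lemma norm_sq_schmidt_form:
  assumes u: "orthonormal n n u" and v: "orthonormal n n v"
  shows "norm_sq (schmidt_form n s u v) = (\<Sum>l<n. (s l)\<^sup>2)"
proof -
  have *: "cinner n (\<lambda>k. \<Sum>l<n. complex_of_real (s l) * u l i * v l k) (v q) = complex_of_real (s q) * u q i"
    if "q < n" for q i
    using orthonormal_combination[OF v that, of "\<lambda>l. complex_of_real (s l) * u l i"] by simp
  have uu: "(\<Sum>i<n. (cmod (u q i))\<^sup>2) = 1" if "q < n" for q
    using orthonormalD[OF u that that] unfolding cinner_self by (simp del: of_real_sum)
  have "norm_sq (schmidt_form n s u v)
      = (\<Sum>i<n. \<Sum>k<n. (cmod (\<Sum>l<n. complex_of_real (s l) * u l i * v l k))\<^sup>2)"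
    by (simp add: norm_sq_pair[of _ n n] schmidt_form_index)
  also have "\<dots> = (\<Sum>i<n. \<Sum>q<n. (cmod (complex_of_real (s q) * u q i))\<^sup>2)"
    by (subst parseval[OF v, symmetric]) (simp add: *)
  also have "\<dots> = (\<Sum>q<n. (s q)\<^sup>2 * (\<Sum>i<n. (cmod (u q i))\<^sup>2))"
    by (subst sum.swap) (simp add: norm_mult power_mult_distrib sum_distrib_left)
  also have "\<dots> = (\<Sum>q<n. (s q)\<^sup>2)" by (simp add: uu)
  finally show ?thesis .
qed

lemma schmidt_decomposition:
  assumes "\<phi> \<in> carrier_vec (n * n)"
  obtains s u v where "orthonormal n n u" "orthonormal n n v" "\<And>r. 0 \<le> s r"
    "\<And>i j. i \<le> j \<Longrightarrow> j < n \<Longrightarrow> s j \<le> s i" "\<phi> = schmidt_form n s u v"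
proof -
  show ?thesis
  proof (rule singular_value_decomposition[of n "\<lambda>i k. \<phi> $ (i * n + k)"])
    fix s u v
    assume *: "orthonormal n n u" "orthonormal n n v" "\<And>r. 0 \<le> s r"
      "\<And>i j. i \<le> j \<Longrightarrow> j < n \<Longrightarrow> s j \<le> s i"
      "\<And>i k. i < n \<Longrightarrow> k < n \<Longrightarrow> \<phi> $ (i * n + k) = (\<Sum>r<n. complex_of_real (s r) * u r i * v r k)"
    have "\<phi> = schmidt_form n s u v"
      using assms by (intro pair_index_vec_eqI) (auto simp: schmidt_form_index *(5))
    from that[OF *(1-4) this] show ?thesis .
  qed
qed

text \<open>Tracing out the first factor eliminates \<open>u\<close> and leaves the diagonal matrix
  \<open>D\<close> conjugated by the unitary \<open>V\<close>. Similar matrices share the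
  characteristic polynomial, so the multiset of roots is the diagonal.\<close>

lemma schmidt_coeffs_schmidt_form:
  assumes u: "orthonormal n n u" and v: "orthonormal n n v" and s: "\<And>r. r < n \<Longrightarrow> 0 \<le> s r"
    and mono: "\<And>i j. i \<le> j \<Longrightarrow> j < n \<Longrightarrow> s j \<le> s i"
  shows "schmidt_coeffs n (schmidt_form n s u v) = vec n (\<lambda>r. (s r)\<^sup>2)"
proof -
  define V where "V = mat n n (\<lambda>(j, r). v r j)"
  define V' where "V' = mat n n (\<lambda>(r, j). cnj (v r j))"
  define D where "D = mat n n (\<lambda>(i, j). if i = j then complex_of_real ((s i)\<^sup>2) else 0)"
  let ?M = "partial_trace_A n (projector (schmidt_form n s u v))"
  have "V * V' = 1\<^sub>m n"
    using v by (intro eq_matI) (auto simp: V_def V'_def scalar_prod_def lessThan_atLeast0[symmetric] orthonormal_completeness)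
  moreover have "V' * V = 1\<^sub>m n"
    using orthonormalD[OF v]
    by (intro eq_matI) (auto simp: V_def V'_def scalar_prod_def lessThan_atLeast0[symmetric] cinner_def mult.commute)
  moreover have "?M = V * D * V'"
  proof (rule eq_matI)
    fix j j' assume "j < dim_row (V * D * V')" "j' < dim_col (V * D * V')"
    then have j: "j < n" "j' < n" by (auto simp: V_def V'_def)
    have VD: "(V * D) $$ (j, r) = v r j * complex_of_real ((s r)\<^sup>2)" if "r < n" for r
      using that j by (simp add: V_def D_def scalar_prod_def lessThan_atLeast0[symmetric] if_distrib cong: if_cong)
    have "?M $$ (j, j') = (\<Sum>i<n. schmidt_form n s u v $ (i * n + j) * cnj (schmidt_form n s u v $ (i * n + j')))"
      using j by (simp add: partial_trace_A_def projector_def pair_index)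
    \<comment> \<open>Regrouped as an inner product over Alice's index, so that orthonormality of
      \<open>u\<close> collapses the double sum over \<open>l\<close> and \<open>q\<close>.\<close>
    also have "\<dots> = cinner n (\<lambda>i. \<Sum>l<n. (complex_of_real (s l) * v l j) * u l i)
        (\<lambda>i. \<Sum>q<n. (complex_of_real (s q) * v q j') * u q i)"
      unfolding cinner_def
      using j by (intro sum.cong refl) (simp add: schmidt_form_index mult.assoc mult.left_commute mult.commute)
    also have "\<dots> = (\<Sum>r<n. (complex_of_real (s r) * v r j) * cnj (complex_of_real (s r) * v r j'))"
      by (subst parseval_cinner[OF u, symmetric]) (simp add: orthonormal_combination[OF u])
    also have "\<dots> = (\<Sum>r<n. v r j * complex_of_real ((s r)\<^sup>2) * cnj (v r j'))"
      by (simp add: power2_eq_square algebra_simps)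
    also have "\<dots> = (V * D * V') $$ (j, j')"
      using j VD by (auto simp: V_def V'_def D_def scalar_prod_def lessThan_atLeast0[symmetric] intro!: sum.cong)
    finally show "?M $$ (j, j') = (V * D * V') $$ (j, j')" .
  qed (auto simp: V_def V'_def partial_trace_A_def)
  ultimately have "similar_mat_wit ?M D V V'"
    by (intro similar_mat_witI[of _ _ n]) (auto simp: V_def V'_def D_def partial_trace_A_def)
  then have "char_poly ?M = char_poly D"
    by (intro char_poly_similar) (auto simp: similar_mat_def)
  also have "\<dots> = (\<Prod>a\<leftarrow>diag_mat D. [:- a, 1:])"
    by (rule char_poly_upper_triangular[of _ n]) (auto simp: D_def)
  also have "diag_mat D = map (\<lambda>r. complex_of_real ((s r)\<^sup>2)) [0..<n]"
    by (auto simp: diag_mat_def D_def)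
  finally have "proots (char_poly ?M) = mset (map (\<lambda>r. complex_of_real ((s r)\<^sup>2)) [0..<n])"
  proof -
    assume *: "char_poly ?M = (\<Prod>a\<leftarrow>map (\<lambda>r. complex_of_real ((s r)\<^sup>2)) [0..<n]. [:- a, 1:])"
    have "proots (\<Prod>a\<leftarrow>as. [:- a, 1:]) = mset as" for as :: "complex list"
    proof (induction as)
      case (Cons a as)
      have "(\<Prod>a\<leftarrow>as. [:- a, 1:]) \<noteq> 0" by (auto simp: prod_list_zero_iff)
      then show ?case using Cons by (simp add: proots_mult del: mult_pCons_left)
    qed simp
    then show ?thesis unfolding * by blast
  qed
  then have "image_mset Re (proots (char_poly ?M)) = mset (map (\<lambda>r. (s r)\<^sup>2) [0..<n])"
    by (simp add: image_mset.compositionality o_def del: mset_map flip: mset_map)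
  \<comment> \<open>The squares already decrease, so sorting reverses the list; the
    \<open>rev\<close> in \<open>schmidt_coeffs\<close> undoes that.\<close>
  moreover have "sort (map (\<lambda>r. (s r)\<^sup>2) [0..<n]) = rev (map (\<lambda>r. (s r)\<^sup>2) [0..<n])"
  proof (rule properties_for_sort)
    show "sorted (rev (map (\<lambda>r. (s r)\<^sup>2) [0..<n]))"
      unfolding sorted_iff_nth_mono by (auto simp: rev_nth intro!: power_mono mono s)
  qed simp
  ultimately have "schmidt_coeffs n (schmidt_form n s u v) = vec_of_list (map (\<lambda>r. (s r)\<^sup>2) [0..<n])"
    unfolding schmidt_coeffs_def by (simp only: sorted_list_of_multiset_mset rev_rev_ident)
  then show ?thesis by (intro eq_vecI) (auto simp: vec_of_list_index)
qed

text \<open>Together with \<open>schmidt_coeffs_schmidt_form\<close> this is the whole interface to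
  \<open>schmidt_coeffs\<close>; characteristic polynomials do not occur any more from here
  on.\<close>

lemma pure_state_schmidt:
  assumes "pure_state (n * n) \<phi>"
  shows "schmidt_vector n (schmidt_coeffs n \<phi>)"
    and "\<exists>u v. orthonormal n n u \<and> orthonormal n n v
      \<and> \<phi> = schmidt_form n (\<lambda>r. sqrt (schmidt_coeffs n \<phi> $ r)) u v"
proof -
  have \<phi>: "\<phi> \<in> carrier_vec (n * n)" "norm_sq \<phi> = 1" using assms by (auto simp: pure_state_iff)
  obtain s u v where *: "orthonormal n n u" "orthonormal n n v" "\<And>r. 0 \<le> s r"
    "\<And>i j. i \<le> j \<Longrightarrow> j < n \<Longrightarrow> s j \<le> s i" "\<phi> = schmidt_form n s u v"
    using schmidt_decomposition[OF \<phi>(1)] by blast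
  have sc: "schmidt_coeffs n \<phi> = vec n (\<lambda>r. (s r)\<^sup>2)"
    unfolding *(5) by (rule schmidt_coeffs_schmidt_form) (use * in auto)
  have "(\<Sum>l<n. (s l)\<^sup>2) = 1" using \<phi>(2) norm_sq_schmidt_form[OF *(1,2)] by (simp add: *(5))
  then show "schmidt_vector n (schmidt_coeffs n \<phi>)"
    unfolding schmidt_vector_def sc using *(3,4) by (auto intro!: power_mono)
  have "\<phi> = schmidt_form n (\<lambda>r. sqrt (schmidt_coeffs n \<phi> $ r)) u v"
    unfolding sc by (subst *(5), rule schmidt_form_cong) (simp add: *(3))
  with *(1,2) show "\<exists>u v. orthonormal n n u \<and> orthonormal n n v
      \<and> \<phi> = schmidt_form n (\<lambda>r. sqrt (schmidt_coeffs n \<phi> $ r)) u v" by blast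
qed

subsection \<open>Approximation by vectors of small Schmidt rank\<close>

text \<open>The products may vanish, so a sum of exactly \<open>l\<close> of them means rank at most
  \<open>l\<close>. In this form the property visibly passes through product operators, also between
  different dimensions.\<close>

definition schmidt_rank_le :: "nat \<Rightarrow> nat \<Rightarrow> nat \<Rightarrow> cvec \<Rightarrow> bool" where
  "schmidt_rank_le a b l y \<longleftrightarrow> y \<in> carrier_vec (a * b)
     \<and> (\<exists>f g. \<forall>i<a. \<forall>k<b. y $ (i * b + k) = (\<Sum>r<l. f r i * g r k))"

text \<open>Gram-Schmidt on the left factors, one product at a time: the part of \<open>f l\<close>
  in the span of \<open>w\<close> is absorbed into \<open>h\<close>, and a nonzero remainder becomes
  a new member of \<open>w\<close>.\<close>

lemma schmidt_rank_orthonormal: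
  fixes n l :: nat and f g :: "nat \<Rightarrow> nat \<Rightarrow> complex"
  shows "\<exists>m w h. m \<le> l \<and> m \<le> n \<and> orthonormal n m w
    \<and> (\<forall>i<n. \<forall>k. (\<Sum>r<l. f r i * g r k) = (\<Sum>r<m. w r i * h r k))"
proof (induction l)
  case 0
  show ?case by (intro exI[of _ 0]) (auto simp: orthonormal_def)
next
  case (Suc l)
  then obtain m w h where m: "m \<le> l" "m \<le> n" and w: "orthonormal n m w"
    and eq: "\<And>i k. i < n \<Longrightarrow> (\<Sum>r<l. f r i * g r k) = (\<Sum>r<m. w r i * h r k)"
    by blast
  define c where "c r = cinner n (f l) (w r)" for r
  define z where "z i = f l i - (\<Sum>r<m. c r * w r i)" for i
  define h' where "h' r k = h r k + c r * g l k" for r k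
  have step: "(\<Sum>r<Suc l. f r i * g r k) = (\<Sum>r<m. w r i * h' r k) + z i * g l k" if "i < n" for i k
    using eq[OF that, of k]
    by (simp add: h'_def z_def algebra_simps sum.distrib sum_distrib_left sum_distrib_right)
  show ?case
  proof (cases "\<exists>j<n. z j \<noteq> 0")
    case False
    then have "\<forall>i<n. \<forall>k. (\<Sum>r<Suc l. f r i * g r k) = (\<Sum>r<m. w r i * h' r k)" using step by auto
    with m w show ?thesis by (intro exI[of _ m] exI[of _ w] exI[of _ h']) auto
  next
    case True
    then obtain j where j: "j < n" "z j \<noteq> 0" by blast
    \<comment> \<open>A full orthonormal family would expand \<open>f l\<close> completely and leave
      no remainder.\<close>
    have "m < n"
    proof (rule ccontr)
      assume "\<not> m < n"
      with m have "m = n" by simp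
      then have "z j = 0" using orthonormal_expansion[of n w j "f l"] w j(1) by (simp add: z_def c_def)
      with j show False by simp
    qed
    have zw: "cinner n z (w s) = 0" if "s < m" for s
      using orthonormal_combination[OF w that] unfolding z_def cinner_diff_left by (simp add: c_def)
    obtain e where e: "0 < e" "orthonormal n (Suc m) (w(m := \<lambda>i. complex_of_real e * z i))"
      using orthonormal_append[OF w zw j] by blast
    show ?thesis
    proof (intro exI conjI allI impI)
      show "Suc m \<le> Suc l" "Suc m \<le> n" using m \<open>m < n\<close> by auto
      show "orthonormal n (Suc m) (w(m := \<lambda>i. complex_of_real e * z i))" by (rule e(2))
      fix i k assume "i < n"
      then show "(\<Sum>r<Suc l. f r i * g r k) = (\<Sum>r<Suc m. (w(m := \<lambda>i. complex_of_real e * z i)) r i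
          * (h'(m := \<lambda>k. g l k / complex_of_real e)) r k)"
        unfolding step[OF \<open>i < n\<close>] using e(1) by simp
    qed
  qed
qed

text \<open>Removing a total weight of at most \<open>l\<close>, at most 1 per place, takes away
  most when it sits on the \<open>l\<close> largest entries. The value \<open>x l\<close> separates
  the two blocks: entries before it are at least \<open>x l\<close>, entries from \<open>l\<close>
  on at most \<open>x l\<close>.\<close>

lemma decreasing_weighted_sum_ge:
  fixes x d :: "nat \<Rightarrow> real"
  assumes mono: "\<And>i j. i \<le> j \<Longrightarrow> j < n \<Longrightarrow> x j \<le> x i" and x: "\<And>i. i < n \<Longrightarrow> 0 \<le> x i"
    and d: "\<And>i. i < n \<Longrightarrow> 0 \<le> d i" "\<And>i. i < n \<Longrightarrow> d i \<le> 1" "(\<Sum>i<n. d i) \<le> real l" and "l < n"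
  shows "(\<Sum>i = l..<n. x i) \<le> (\<Sum>i<n. x i * (1 - d i))"
proof -
  have split: "(\<Sum>i<n. f i) = (\<Sum>i<l. f i) + (\<Sum>i = l..<n. f i)" for f :: "nat \<Rightarrow> real"
    using \<open>l < n\<close> by (metis atLeast0LessThan le0 less_imp_le sum.atLeastLessThan_concat)
  have "0 \<le> x l * (real l - (\<Sum>i<n. d i))" using x[OF \<open>l < n\<close>] d(3) by simp
  also have "\<dots> = (\<Sum>i<l. x l * (1 - d i)) - (\<Sum>i = l..<n. x l * d i)"
    unfolding split by (simp add: sum_subtractf sum_distrib_left algebra_simps)
  also have "\<dots> \<le> (\<Sum>i<l. x i * (1 - d i)) - (\<Sum>i = l..<n. x i * d i)"
    using d mono \<open>l < n\<close> by (intro diff_mono sum_mono mult_right_mono) auto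
  also have "\<dots> = (\<Sum>i<n. x i * (1 - d i)) - (\<Sum>i = l..<n. x i)"
    unfolding split by (simp add: sum_subtractf algebra_simps)
  finally show ?thesis by simp
qed

text \<open>The Eckart-Young inequality: expanding in \<open>v\<close> reduces it to the distances of the
  vectors \<open>s q * u q\<close> from a subspace of dimension at most \<open>l\<close>.\<close>

lemma schmidt_tail_le_distance:
  assumes u: "orthonormal n n u" and v: "orthonormal n n v" and s: "\<And>r. r < n \<Longrightarrow> 0 \<le> s r"
    and mono: "\<And>i j. i \<le> j \<Longrightarrow> j < n \<Longrightarrow> s j \<le> s i"
    and y: "schmidt_rank_le n n l y" and "l < n"
  shows "(\<Sum>i = l..<n. (s i)\<^sup>2) \<le> norm_sq (schmidt_form n s u v - y)"
proof -
  obtain f g where fg: "y \<in> carrier_vec (n * n)"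
    "\<And>i k. i < n \<Longrightarrow> k < n \<Longrightarrow> y $ (i * n + k) = (\<Sum>r<l. f r i * g r k)"
    using y unfolding schmidt_rank_le_def by blast
  obtain m w h where m: "m \<le> l" "m \<le> n" and w: "orthonormal n m w"
    and eq: "\<And>i k. i < n \<Longrightarrow> (\<Sum>r<l. f r i * g r k) = (\<Sum>r<m. w r i * h r k)"
    using schmidt_rank_orthonormal[of l n f g] by blast
  define z where "z i k = (\<Sum>l<n. complex_of_real (s l) * u l i * v l k) - (\<Sum>r<m. w r i * h r k)" for i k
  define G where "G q r = cinner n (h r) (v q)" for q r
  \<comment> \<open>The squared length of the projection of \<open>u q\<close> onto the span of
    \<open>w\<close>. It is at most 1 by \<open>bessel\<close>, and the total is \<open>m\<close>
    because \<open>u\<close> is a full basis: the hypotheses of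
    \<open>decreasing_weighted_sum_ge\<close>.\<close>
  define d where "d q = (\<Sum>r<m. (cmod (cinner n (u q) (w r)))\<^sup>2)" for q
  have zv: "cinner n (z i) (v q) = complex_of_real (s q) * u q i - (\<Sum>r<m. G q r * w r i)"
    if "q < n" for i q
  proof -
    have "cinner n (\<lambda>k. \<Sum>r<m. w r i * h r k) (v q) = (\<Sum>r<m. G q r * w r i)"
      unfolding cinner_sum_left cinner_scale_left by (simp add: G_def mult.commute)
    then show ?thesis
      using orthonormal_combination[OF v that, of "\<lambda>l. complex_of_real (s l) * u l i"]
      unfolding z_def cinner_diff_left by simp
  qed
  have unit: "(\<Sum>i<n. (cmod (x q i))\<^sup>2) = 1" if "orthonormal n k x" "q < k" for k x q
    using orthonormalD[OF that(1,2,2)] unfolding cinner_self by (simp del: of_real_sum)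
  have "norm_sq (schmidt_form n s u v - y) = (\<Sum>i<n. \<Sum>k<n. (cmod (z i k))\<^sup>2)"
    using fg by (simp add: norm_sq_pair[of _ n n] schmidt_form_index z_def eq pair_index(1))
  also have "\<dots> = (\<Sum>i<n. \<Sum>q<n. (cmod (complex_of_real (s q) * u q i - (\<Sum>r<m. G q r * w r i)))\<^sup>2)"
    by (subst parseval[OF v, symmetric]) (simp add: zv)
  also have "\<dots> = (\<Sum>q<n. \<Sum>i<n. (cmod (complex_of_real (s q) * u q i - (\<Sum>r<m. G q r * w r i)))\<^sup>2)"
    by (rule sum.swap)
  finally have norm_eq: "norm_sq (schmidt_form n s u v - y) = \<dots>" .
  have "(\<Sum>q<n. d q) = (\<Sum>r<m. \<Sum>q<n. (cmod (cinner n (w r) (u q)))\<^sup>2)"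
    unfolding d_def by (subst sum.swap) (simp add: cinner_commute[of n "u _"])
  also have "\<dots> = real m" using unit[OF w] by (simp add: parseval[OF u])
  finally have d_sum: "(\<Sum>q<n. d q) \<le> real l" using m(1) by simp
  have d_le: "d q \<le> 1" if "q < n" for q
    using bessel[OF w m(2), of "u q"] unit[OF u that] by (simp add: d_def)
  have "(\<Sum>i = l..<n. (s i)\<^sup>2) \<le> (\<Sum>q<n. (s q)\<^sup>2 * (1 - d q))"
    by (rule decreasing_weighted_sum_ge)
      (use d_le d_sum \<open>l < n\<close> mono s in \<open>auto simp: d_def intro!: power_mono sum_nonneg\<close>)
  also have "\<dots> \<le> (\<Sum>q<n. \<Sum>i<n. (cmod (complex_of_real (s q) * u q i - (\<Sum>r<m. G q r * w r i)))\<^sup>2)"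
  proof (rule sum_mono)
    fix q assume "q \<in> {..<n}"
    then have "(s q)\<^sup>2 * (1 - d q) = (\<Sum>i<n. (cmod (complex_of_real (s q) * u q i))\<^sup>2)
        - (\<Sum>r<m. (cmod (cinner n (\<lambda>i. complex_of_real (s q) * u q i) (w r)))\<^sup>2)"
      unfolding cinner_scale_left using unit[OF u, of q]
      by (simp add: norm_mult power_mult_distrib d_def algebra_simps flip: sum_distrib_left)
    also have "\<dots> \<le> (\<Sum>i<n. (cmod (complex_of_real (s q) * u q i - (\<Sum>r<m. G q r * w r i)))\<^sup>2)"
      by (rule dist_orthonormal_ge[OF w m(2)])
    finally show "(s q)\<^sup>2 * (1 - d q)
        \<le> (\<Sum>i<n. (cmod (complex_of_real (s q) * u q i - (\<Sum>r<m. G q r * w r i)))\<^sup>2)" .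
  qed
  finally show ?thesis unfolding norm_eq .
qed

text \<open>Truncations attain the bound of \<open>schmidt_tail_le_distance\<close>. They are the
  approximants with which a protocol is started.\<close>

lemma schmidt_form_truncation:
  fixes s :: "nat \<Rightarrow> real"
  assumes u: "orthonormal n n u" and v: "orthonormal n n v"
  defines "y \<equiv> \<lambda>l. schmidt_form n (\<lambda>r. if r < l then s r else 0) u v"
  shows "schmidt_rank_le n n l (y l)"
    and "l < n \<Longrightarrow> norm_sq (schmidt_form n s u v - y l) = (\<Sum>i = l..<n. (s i)\<^sup>2)"
proof -
  \<comment> \<open>The test \<open>r < n\<close> on the right pads with zero products when
    \<open>l\<close> exceeds \<open>n\<close>; the rank claim covers every \<open>l\<close>.\<close>
  have "(\<Sum>r<n. complex_of_real (if r < l then s r else 0) * u r i * v r k)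
      = (\<Sum>r<l. (if r < n then complex_of_real (s r) * u r i else 0) * v r k)" for i k
  proof -
    have "(\<Sum>r<n. complex_of_real (if r < l then s r else 0) * u r i * v r k)
        = (\<Sum>r\<in>{..<n} \<inter> {..<l}. complex_of_real (s r) * u r i * v r k)"
      by (intro sum.mono_neutral_cong_right) auto
    also have "\<dots> = (\<Sum>r<l. (if r < n then complex_of_real (s r) * u r i else 0) * v r k)"
      by (intro sum.mono_neutral_cong_left) auto
    finally show ?thesis .
  qed
  then show "schmidt_rank_le n n l (y l)"
    unfolding schmidt_rank_le_def y_def
    by (intro conjI exI[of _ "\<lambda>r i. if r < n then complex_of_real (s r) * u r i else 0"] exI[of _ v])
      (auto simp: schmidt_form_index)
  assume "l < n"
  have "norm_sq (schmidt_form n s u v - y l) = (\<Sum>r<n. (s r - (if r < l then s r else 0))\<^sup>2)"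
    unfolding y_def schmidt_form_diff by (rule norm_sq_schmidt_form[OF u v])
  also have "\<dots> = (\<Sum>i = l..<n. (s i)\<^sup>2)"
    by (intro sum.mono_neutral_cong_right) auto
  finally show "norm_sq (schmidt_form n s u v - y l) = (\<Sum>i = l..<n. (s i)\<^sup>2)" .
qed

section \<open>Monotonicity under LOCC\<close>

lemma mat_adjoint_dim [simp]: "dim_row (mat_adjoint A) = dim_col A" "dim_col (mat_adjoint A) = dim_row A"
  for A :: cmat
  by (simp_all add: mat_adjoint_def)

lemma mat_adjoint_index [simp]:
  "i < dim_col A \<Longrightarrow> j < dim_row A \<Longrightarrow> mat_adjoint A $$ (i, j) = cnj (A $$ (j, i))" for A :: cmat
  by (simp add: mat_adjoint_def mat_of_rows_def)

lemma mat_sum_dim [simp]: "dim_row (mat_sum d k F) = d" "dim_col (mat_sum d k F) = d"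
  by (simp_all add: mat_sum_def)

lemma mat_sum_index [simp]: "i < d \<Longrightarrow> j < d \<Longrightarrow> mat_sum d k F $$ (i, j) = (\<Sum>t<k. F t $$ (i, j))"
  by (simp add: mat_sum_def)

lemma mat_sum_cong: "(\<And>t. t < k \<Longrightarrow> F t = G t) \<Longrightarrow> mat_sum d k F = mat_sum d k G"
  by (simp add: mat_sum_def)

subsection \<open>Ensembles of unnormalised vectors\<close>

text \<open>Probabilities are absorbed into the lengths of the vectors. A Kraus operator then acts
  by \<open>map\<close>, and branches are merged by \<open>concat\<close>, without any
  renormalisation.\<close>

definition ensemble :: "nat \<Rightarrow> cvec list \<Rightarrow> cmat" where
  "ensemble d xs = mat d d (\<lambda>(i, j). \<Sum>x\<leftarrow>xs. x $ i * cnj (x $ j))"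

lemma ensemble_carrier [simp]: "ensemble d xs \<in> carrier_mat d d"
  by (simp add: ensemble_def)

lemma ensemble_dim [simp]: "dim_row (ensemble d xs) = d" "dim_col (ensemble d xs) = d"
  by (simp_all add: ensemble_def)

lemma ensemble_index [simp]:
  "i < d \<Longrightarrow> j < d \<Longrightarrow> ensemble d xs $$ (i, j) = (\<Sum>x\<leftarrow>xs. x $ i * cnj (x $ j))"
  by (simp add: ensemble_def)

lemma sum_list_concat_upt:
  "(\<Sum>x\<leftarrow>concat (map F [0..<k]). f x) = (\<Sum>t<k. \<Sum>x\<leftarrow>F t. f x)"
  for f :: "_ \<Rightarrow> 'b :: comm_monoid_add"
  by (induction k) simp_all

lemma mat_sum_ensemble: "mat_sum d k (\<lambda>t. ensemble d (F t)) = ensemble d (concat (map F [0..<k]))"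
  by (intro eq_matI) (simp_all add: sum_list_concat_upt)

lemma ensemble_singleton: "x \<in> carrier_vec d \<Longrightarrow> ensemble d [x] = projector x"
  by (intro eq_matI) (auto simp: projector_def)

lemma conj_by_ensemble:
  assumes K: "K \<in> carrier_mat d' d" and xs: "\<And>x. x \<in> set xs \<Longrightarrow> x \<in> carrier_vec d"
  shows "conj_by K (ensemble d xs) = ensemble d' (map ((*\<^sub>v) K) xs)"
proof (rule eq_matI)
  fix i j assume "i < dim_row (ensemble d' (map ((*\<^sub>v) K) xs))" "j < dim_col (ensemble d' (map ((*\<^sub>v) K) xs))"
  then have ij: "i < d'" "j < d'" by auto
  have "conj_by K (ensemble d xs) $$ (i, j)
      = (\<Sum>b<d. (\<Sum>a<d. K $$ (i, a) * (\<Sum>x\<leftarrow>xs. x $ a * cnj (x $ b))) * cnj (K $$ (j, b)))"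
    using K ij by (auto simp: conj_by_def scalar_prod_def lessThan_atLeast0[symmetric] intro!: sum.cong)
  also have "\<dots> = (\<Sum>x\<leftarrow>xs. (\<Sum>a<d. K $$ (i, a) * x $ a) * cnj (\<Sum>b<d. K $$ (j, b) * x $ b))"
  proof (induction xs)
    case (Cons x xs)
    have "(\<Sum>b<d. (\<Sum>a<d. K $$ (i, a) * (x $ a * cnj (x $ b))) * cnj (K $$ (j, b)))
        = (\<Sum>a<d. K $$ (i, a) * x $ a) * cnj (\<Sum>b<d. K $$ (j, b) * x $ b)"
      by (simp add: sum_distrib_left sum_distrib_right mult_ac)
    with Cons show ?case by (simp add: distrib_left distrib_right sum.distrib)
  qed simp
  also have "\<dots> = ensemble d' (map ((*\<^sub>v) K) xs) $$ (i, j)"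
  proof -
    have "(K *\<^sub>v x) $ q = (\<Sum>a<d. K $$ (q, a) * x $ a)" if "x \<in> set xs" "q < d'" for x q
      using K xs[OF that(1)] that(2) by (auto simp: scalar_prod_def lessThan_atLeast0[symmetric] intro!: sum.cong)
    then show ?thesis using ij by (simp add: o_def cong: map_cong)
  qed
  finally show "conj_by K (ensemble d xs) $$ (i, j) = ensemble d' (map ((*\<^sub>v) K) xs) $$ (i, j)" .
qed (use K in \<open>auto simp: conj_by_def\<close>)

subsection \<open>Local operations\<close>

lemma kron_carrier:
  "A \<in> carrier_mat a' a \<Longrightarrow> B \<in> carrier_mat b' b \<Longrightarrow> A \<otimes>\<^sub>k B \<in> carrier_mat (a' * b') (a * b)"
  by (auto simp: kron_def)

lemma kron_mult_vec_index:
  assumes "A \<in> carrier_mat a' a" "B \<in> carrier_mat b' b" "z \<in> carrier_vec (a * b)" "i < a'" "k < b'"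
  shows "((A \<otimes>\<^sub>k B) *\<^sub>v z) $ (i * b' + k)
    = (\<Sum>p<a. \<Sum>q<b. A $$ (i, p) * B $$ (k, q) * z $ (p * b + q))"
proof -
  have "((A \<otimes>\<^sub>k B) *\<^sub>v z) $ (i * b' + k) = (\<Sum>j<a * b. (A \<otimes>\<^sub>k B) $$ (i * b' + k, j) * z $ j)"
    using assms pair_index(1)[OF assms(4,5)] kron_carrier[OF assms(1,2)]
    by (auto simp: scalar_prod_def lessThan_atLeast0[symmetric] intro!: sum.cong)
  also have "\<dots> = (\<Sum>p<a. \<Sum>q<b. A $$ (i, p) * B $$ (k, q) * z $ (p * b + q))"
    unfolding sum_pair_index
    using assms by (intro sum.cong refl) (auto simp: kron_def pair_index)
  finally show ?thesis .
qed

text \<open>Each product term goes to a product term: \<open>A\<close> acts on \<open>f r\<close>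
  and \<open>B\<close> on \<open>g r\<close>.\<close>

lemma schmidt_rank_le_kron:
  assumes A: "A \<in> carrier_mat a' a" and B: "B \<in> carrier_mat b' b" and y: "schmidt_rank_le a b l y"
  shows "schmidt_rank_le a' b' l ((A \<otimes>\<^sub>k B) *\<^sub>v y)"
proof -
  obtain f g where fg: "y \<in> carrier_vec (a * b)"
    "\<And>i k. i < a \<Longrightarrow> k < b \<Longrightarrow> y $ (i * b + k) = (\<Sum>r<l. f r i * g r k)"
    using y unfolding schmidt_rank_le_def by blast
  have "((A \<otimes>\<^sub>k B) *\<^sub>v y) $ (i * b' + k)
      = (\<Sum>r<l. (\<Sum>p<a. A $$ (i, p) * f r p) * (\<Sum>q<b. B $$ (k, q) * g r q))"
    if "i < a'" "k < b'" for i k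
  proof -
    have "((A \<otimes>\<^sub>k B) *\<^sub>v y) $ (i * b' + k)
        = (\<Sum>p<a. \<Sum>q<b. \<Sum>r<l. (A $$ (i, p) * f r p) * (B $$ (k, q) * g r q))"
      unfolding kron_mult_vec_index[OF A B fg(1) that]
      using fg(2) by (intro sum.cong refl) (simp add: sum_distrib_left mult_ac)
    also have "\<dots> = (\<Sum>r<l. \<Sum>q<b. \<Sum>p<a. (A $$ (i, p) * f r p) * (B $$ (k, q) * g r q))"
      by (rule triple_sum_swap)
    also have "\<dots> = (\<Sum>r<l. \<Sum>p<a. \<Sum>q<b. (A $$ (i, p) * f r p) * (B $$ (k, q) * g r q))"
      by (intro sum.cong refl sum.swap)
    finally show ?thesis by (simp add: sum_product)
  qed
  moreover have "(A \<otimes>\<^sub>k B) *\<^sub>v y \<in> carrier_vec (a' * b')"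
    using kron_carrier[OF A B] fg(1) by simp
  ultimately show ?thesis unfolding schmidt_rank_le_def
    by (intro conjI exI[of _ "\<lambda>r i. \<Sum>p<a. A $$ (i, p) * f r p"] exI[of _ "\<lambda>r k. \<Sum>q<b. B $$ (k, q) * g r q"]) auto
qed

lemma isometry_sum:
  fixes c :: "'t \<Rightarrow> nat \<Rightarrow> complex"
  assumes "\<And>p q. p < a \<Longrightarrow> q < a \<Longrightarrow> (\<Sum>t\<in>S. c t p * cnj (c t q)) = of_bool (p = q)"
  shows "(\<Sum>t\<in>S. (cmod (\<Sum>p<a. c t p * x p))\<^sup>2) = (\<Sum>p<a. (cmod (x p))\<^sup>2)"
proof -
  have "complex_of_real (\<Sum>t\<in>S. (cmod (\<Sum>p<a. c t p * x p))\<^sup>2)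
      = (\<Sum>t\<in>S. \<Sum>p<a. \<Sum>q<a. x p * cnj (x q) * (c t p * cnj (c t q)))"
    unfolding of_real_sum complex_norm_square by (simp add: sum_product mult_ac)
  also have "\<dots> = (\<Sum>q<a. \<Sum>p<a. \<Sum>t\<in>S. x p * cnj (x q) * (c t p * cnj (c t q)))"
    by (rule triple_sum_swap)
  also have "\<dots> = (\<Sum>q<a. \<Sum>p<a. x p * cnj (x q) * of_bool (p = q))"
    using assms by (simp add: sum_distrib_left[symmetric])
  also have "\<dots> = (\<Sum>q<a. x q * cnj (x q))"
    by (intro sum.cong refl, subst sum_of_bool_mult) auto
  also have "\<dots> = complex_of_real (\<Sum>p<a. (cmod (x p))\<^sup>2)"
    unfolding of_real_sum complex_norm_square ..
  finally show ?thesis unfolding of_real_eq_iff .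
qed

text \<open>All Kraus operators of all outcomes, stacked on top of each other, form one matrix;
  completeness of the instrument says that its columns are orthonormal.\<close>

lemma local_instrument_isometry:
  assumes "local_instrument a k a' m K"
  shows "(\<Sum>j<k. \<Sum>r<m j. \<Sum>i<a' j. (cmod (\<Sum>p<a. K j r $$ (i, p) * x p))\<^sup>2) = (\<Sum>p<a. (cmod (x p))\<^sup>2)"
proof -
  let ?S = "SIGMA j:{..<k}. SIGMA r:{..<m j}. {..<a' j}"
  define c where "c = (\<lambda>(j, r, i) p. K j r $$ (i, p))"
  have Sig: "(\<Sum>t\<in>?S. F t) = (\<Sum>j<k. \<Sum>r<m j. \<Sum>i<a' j. F (j, r, i))" for F :: "_ \<Rightarrow> 'z :: comm_monoid_add"
  proof -
    have "(\<Sum>j<k. \<Sum>r<m j. \<Sum>i<a' j. F (j, r, i)) = (\<Sum>j<k. \<Sum>x\<in>{..<m j} \<times> {..<a' j}. F (j, x))"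
      by (simp add: sum.cartesian_product split_def)
    also have "\<dots> = (\<Sum>t\<in>?S. F t)"
      by (subst sum.Sigma) (simp_all add: split_def)
    finally show ?thesis by simp
  qed
  have "(\<Sum>t\<in>?S. c t p * cnj (c t q)) = of_bool (p = q)" if pq: "p < a" "q < a" for p q
  proof -
    have carr: "K j r \<in> carrier_mat (a' j) a" if "j < k" "r < m j" for j r
      using assms that unfolding local_instrument_def by blast
    have "of_bool (p = q) = 1\<^sub>m a $$ (q, p)" using pq by auto
    also have "1\<^sub>m a = mat_sum a k (\<lambda>j. mat_sum a (m j) (\<lambda>r. mat_adjoint (K j r) * K j r))"
      using assms unfolding local_instrument_def by simp
    also have "\<dots> $$ (q, p) = (\<Sum>j<k. \<Sum>r<m j. (mat_adjoint (K j r) * K j r) $$ (q, p))"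
      using pq by simp
    also have "\<dots> = (\<Sum>j<k. \<Sum>r<m j. \<Sum>i<a' j. K j r $$ (i, p) * cnj (K j r $$ (i, q)))"
    proof (intro sum.cong refl)
      fix j r assume "j \<in> {..<k}" "r \<in> {..<m j}"
      then have "K j r \<in> carrier_mat (a' j) a" using carr by auto
      then show "(mat_adjoint (K j r) * K j r) $$ (q, p) = (\<Sum>i<a' j. K j r $$ (i, p) * cnj (K j r $$ (i, q)))"
        using pq by (auto simp: scalar_prod_def lessThan_atLeast0[symmetric] mult.commute intro!: sum.cong)
    qed
    finally show ?thesis unfolding Sig by (simp add: c_def)
  qed
  from isometry_sum[where c=c and S="?S" and a=a and x=x, OF this] show ?thesis unfolding Sig by (simp add: c_def)
qed

lemma one_mat_row_sum:
  "i < b \<Longrightarrow> (\<Sum>q<b. 1\<^sub>m b $$ (i, q) * f q) = (f i :: complex)"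
  by (subst sum.cong[OF refl, of _ _ "\<lambda>q. if q = i then f q else 0"]) auto

text \<open>For each fixed index of Bob, the slice of \<open>z\<close> is a vector of Alice's to
  which \<open>local_instrument_isometry\<close> applies. The rest exchanges the order of
  summation.\<close>

lemma alice_isometry:
  assumes K: "local_instrument a k a' m K" and z: "z \<in> carrier_vec (a * b)"
  shows "(\<Sum>j<k. \<Sum>r<m j. norm_sq ((K j r \<otimes>\<^sub>k 1\<^sub>m b) *\<^sub>v z)) = norm_sq z"
proof -
  have "norm_sq ((K j r \<otimes>\<^sub>k 1\<^sub>m b) *\<^sub>v z)
      = (\<Sum>q<b. \<Sum>i<a' j. (cmod (\<Sum>p<a. K j r $$ (i, p) * z $ (p * b + q)))\<^sup>2)"
    if "j < k" "r < m j" for j r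
  proof -
    have carr: "K j r \<in> carrier_mat (a' j) a" using K that unfolding local_instrument_def by blast
    have "(\<Sum>p<a. \<Sum>q'<b. K j r $$ (i, p) * 1\<^sub>m b $$ (q, q') * z $ (p * b + q'))
        = (\<Sum>p<a. K j r $$ (i, p) * z $ (p * b + q))" if "q < b" for i q
      using one_mat_row_sum[OF that] by (simp only: mult.assoc flip: sum_distrib_left)
    then have "norm_sq ((K j r \<otimes>\<^sub>k 1\<^sub>m b) *\<^sub>v z)
      = (\<Sum>i<a' j. \<Sum>q<b. (cmod (\<Sum>p<a. K j r $$ (i, p) * z $ (p * b + q)))\<^sup>2)"
      using kron_mult_vec_index[OF carr one_carrier_mat z]
        mult_mat_vec_carrier[OF kron_carrier[OF carr one_carrier_mat] z]
      by (subst norm_sq_pair[of _ "a' j" b]) (auto simp del: index_one_mat)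
    then show ?thesis by (simp only: sum.swap[of _ "{..<a' j}"])
  qed
  then have "(\<Sum>j<k. \<Sum>r<m j. norm_sq ((K j r \<otimes>\<^sub>k 1\<^sub>m b) *\<^sub>v z))
      = (\<Sum>j<k. \<Sum>r<m j. \<Sum>q<b. \<Sum>i<a' j. (cmod (\<Sum>p<a. K j r $$ (i, p) * z $ (p * b + q)))\<^sup>2)"
    by simp
  also have "\<dots> = (\<Sum>j<k. \<Sum>q<b. \<Sum>r<m j. \<Sum>i<a' j. (cmod (\<Sum>p<a. K j r $$ (i, p) * z $ (p * b + q)))\<^sup>2)"
    by (intro sum.cong refl sum.swap)
  also have "\<dots> = (\<Sum>q<b. \<Sum>j<k. \<Sum>r<m j. \<Sum>i<a' j. (cmod (\<Sum>p<a. K j r $$ (i, p) * z $ (p * b + q)))\<^sup>2)"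
    by (rule sum.swap)
  also have "\<dots> = (\<Sum>q<b. \<Sum>p<a. (cmod (z $ (p * b + q)))\<^sup>2)"
    by (simp only: local_instrument_isometry[OF K])
  also have "\<dots> = norm_sq z" using norm_sq_pair[OF z] by (simp only: sum.swap[of _ "{..<b}"])
  finally show ?thesis .
qed

lemma bob_isometry:
  assumes K: "local_instrument b k b' m K" and z: "z \<in> carrier_vec (a * b)"
  shows "(\<Sum>j<k. \<Sum>r<m j. norm_sq ((1\<^sub>m a \<otimes>\<^sub>k K j r) *\<^sub>v z)) = norm_sq z"
proof -
  have "norm_sq ((1\<^sub>m a \<otimes>\<^sub>k K j r) *\<^sub>v z)
      = (\<Sum>i<a. \<Sum>q<b' j. (cmod (\<Sum>p<b. K j r $$ (q, p) * z $ (i * b + p)))\<^sup>2)"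
    if "j < k" "r < m j" for j r
  proof -
    have carr: "K j r \<in> carrier_mat (b' j) b" using K that unfolding local_instrument_def by blast
    have "(\<Sum>i'<a. \<Sum>p<b. 1\<^sub>m a $$ (i, i') * K j r $$ (q, p) * z $ (i' * b + p))
        = (\<Sum>p<b. K j r $$ (q, p) * z $ (i * b + p))" if "i < a" for i q
      using one_mat_row_sum[OF that] by (simp only: mult.assoc flip: sum_distrib_left)
    then show ?thesis
      using kron_mult_vec_index[OF one_carrier_mat carr z]
        mult_mat_vec_carrier[OF kron_carrier[OF one_carrier_mat carr] z]
      by (subst norm_sq_pair[of _ a "b' j"]) (auto simp del: index_one_mat)
  qed
  then have "(\<Sum>j<k. \<Sum>r<m j. norm_sq ((1\<^sub>m a \<otimes>\<^sub>k K j r) *\<^sub>v z))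
      = (\<Sum>j<k. \<Sum>r<m j. \<Sum>i<a. \<Sum>q<b' j. (cmod (\<Sum>p<b. K j r $$ (q, p) * z $ (i * b + p)))\<^sup>2)"
    by simp
  also have "\<dots> = (\<Sum>j<k. \<Sum>i<a. \<Sum>r<m j. \<Sum>q<b' j. (cmod (\<Sum>p<b. K j r $$ (q, p) * z $ (i * b + p)))\<^sup>2)"
    by (intro sum.cong refl sum.swap)
  also have "\<dots> = (\<Sum>i<a. \<Sum>j<k. \<Sum>r<m j. \<Sum>q<b' j. (cmod (\<Sum>p<b. K j r $$ (q, p) * z $ (i * b + p)))\<^sup>2)"
    by (rule sum.swap)
  also have "\<dots> = (\<Sum>i<a. \<Sum>p<b. (cmod (z $ (i * b + p)))\<^sup>2)"
    by (simp only: local_instrument_isometry[OF K])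
  also have "\<dots> = norm_sq z" using norm_sq_pair[OF z] by simp
  finally show ?thesis .
qed

subsection \<open>Approximated ensembles\<close>

text \<open>The second component of a pair lists, for every \<open>l\<close>, the approximation of the first one
  by a vector of Schmidt rank at most \<open>l\<close>.\<close>

definition approximated :: "nat \<Rightarrow> nat \<Rightarrow> (cvec \<times> (nat \<Rightarrow> cvec)) list \<Rightarrow> bool" where
  "approximated a b zs \<longleftrightarrow>
     (\<forall>(\<phi>, y) \<in> set zs. \<phi> \<in> carrier_vec (a * b) \<and> (\<forall>l. schmidt_rank_le a b l (y l)))"

definition approx_cost :: "nat \<Rightarrow> (cvec \<times> (nat \<Rightarrow> cvec)) list \<Rightarrow> real" where
  "approx_cost l zs = (\<Sum>(\<phi>, y)\<leftarrow>zs. norm_sq (\<phi> - y l))"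

text \<open>One list \<open>ws\<close> must serve all \<open>l\<close> simultaneously, since in the
  end a single decomposition has to satisfy every tail inequality. The existential quantifier
  reflects that a mixed output has many decompositions, of which the protocol singles out
  one.\<close>

definition monotone_operation :: "nat \<Rightarrow> nat \<Rightarrow> nat \<Rightarrow> nat \<Rightarrow> (cmat \<Rightarrow> cmat) \<Rightarrow> bool" where
  "monotone_operation c d a b F \<longleftrightarrow> (\<forall>zs. approximated a b zs \<longrightarrow>
     (\<exists>ws. approximated c d ws \<and> F (ensemble (a * b) (map fst zs)) = ensemble (c * d) (map fst ws)
       \<and> (\<forall>l. approx_cost l ws \<le> approx_cost l zs)))"

text \<open>The induction step for both parties at once: \<open>M j r\<close> stands for a Kraus
  operator tensored with an identity on either side. By linearity differences go to differences, so
  \<open>iso\<close> conserves the total cost over the branches before the continuations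
  \<open>L j\<close> act.\<close>

lemma monotone_operation_step:
  assumes L: "\<And>j. j < k \<Longrightarrow> monotone_operation c d (a' j) (b' j) (L j)"
    and M: "\<And>j r. j < k \<Longrightarrow> r < m j \<Longrightarrow> M j r \<in> carrier_mat (a' j * b' j) (a * b)"
    and rank: "\<And>j r l y. j < k \<Longrightarrow> r < m j \<Longrightarrow> schmidt_rank_le a b l y \<Longrightarrow>
      schmidt_rank_le (a' j) (b' j) l (M j r *\<^sub>v y)"
    and iso: "\<And>z. z \<in> carrier_vec (a * b) \<Longrightarrow> (\<Sum>j<k. \<Sum>r<m j. norm_sq (M j r *\<^sub>v z)) = norm_sq z"
  shows "monotone_operation c d a b
    (\<lambda>\<sigma>. mat_sum (c * d) k (\<lambda>j. L j (mat_sum (a' j * b' j) (m j) (\<lambda>r. conj_by (M j r) \<sigma>))))"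
  unfolding monotone_operation_def
proof (intro allI impI)
  fix zs assume zs: "approximated a b zs"
  have zsD: "\<phi> \<in> carrier_vec (a * b)" "schmidt_rank_le a b l (y l)" "y l \<in> carrier_vec (a * b)"
    if "(\<phi>, y) \<in> set zs" for \<phi> y l
    using zs that unfolding approximated_def schmidt_rank_le_def by fast+
  \<comment> \<open>The same operator acts on a vector and on all its approximants.\<close>
  define app where "app j r z = (M j r *\<^sub>v fst z, \<lambda>l. M j r *\<^sub>v (snd z l :: cvec))"
    for j r and z :: "cvec \<times> (nat \<Rightarrow> cvec)"
  define zs' where "zs' j = concat (map (\<lambda>r. map (app j r) zs) [0..<m j])" for j
  have "approximated (a' j) (b' j) (zs' j)" if "j < k" for j
    using that M zsD(1) rank zsD(2)
    by (fastforce simp: approximated_def zs'_def app_def intro!: mult_mat_vec_carrier)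
  then have "\<exists>ws. approximated c d ws \<and> L j (ensemble (a' j * b' j) (map fst (zs' j))) = ensemble (c * d) (map fst ws)
       \<and> (\<forall>l. approx_cost l ws \<le> approx_cost l (zs' j))" if "j < k" for j
    using L that unfolding monotone_operation_def by blast
  then obtain ws where ws: "\<And>j. j < k \<Longrightarrow> approximated c d (ws j)"
    "\<And>j. j < k \<Longrightarrow> L j (ensemble (a' j * b' j) (map fst (zs' j))) = ensemble (c * d) (map fst (ws j))"
    "\<And>j l. j < k \<Longrightarrow> approx_cost l (ws j) \<le> approx_cost l (zs' j)"
    by metis
  let ?ws = "concat (map ws [0..<k])"
  have zs'_eq: "mat_sum (a' j * b' j) (m j) (\<lambda>r. conj_by (M j r) (ensemble (a * b) (map fst zs)))
      = ensemble (a' j * b' j) (map fst (zs' j))" if "j < k" for j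
  proof -
    have "conj_by (M j r) (ensemble (a * b) (map fst zs))
        = ensemble (a' j * b' j) (map fst (map (app j r) zs))" if "r < m j" for r
    proof -
      have "conj_by (M j r) (ensemble (a * b) (map fst zs))
          = ensemble (a' j * b' j) (map ((*\<^sub>v) (M j r)) (map fst zs))"
        using M[OF \<open>j < k\<close> that] zsD(1) by (intro conj_by_ensemble) auto
      then show ?thesis by (simp add: app_def o_def)
    qed
    then have "mat_sum (a' j * b' j) (m j) (\<lambda>r. conj_by (M j r) (ensemble (a * b) (map fst zs)))
        = mat_sum (a' j * b' j) (m j) (\<lambda>r. ensemble (a' j * b' j) (map fst (map (app j r) zs)))"
      by (intro mat_sum_cong)
    then show ?thesis by (simp add: mat_sum_ensemble zs'_def map_concat o_def)
  qed
  show "\<exists>ws. approximated c d ws \<and>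
      mat_sum (c * d) k (\<lambda>j. L j (mat_sum (a' j * b' j) (m j)
        (\<lambda>r. conj_by (M j r) (ensemble (a * b) (map fst zs))))) = ensemble (c * d) (map fst ws)
      \<and> (\<forall>l. approx_cost l ws \<le> approx_cost l zs)"
  proof (intro exI conjI allI)
    show "approximated c d ?ws" using ws(1) unfolding approximated_def by fastforce
    have "mat_sum (c * d) k (\<lambda>j. L j (mat_sum (a' j * b' j) (m j)
        (\<lambda>r. conj_by (M j r) (ensemble (a * b) (map fst zs)))))
      = mat_sum (c * d) k (\<lambda>j. ensemble (c * d) (map fst (ws j)))"
      by (intro mat_sum_cong) (simp add: zs'_eq ws(2))
    then show "mat_sum (c * d) k (\<lambda>j. L j (mat_sum (a' j * b' j) (m j)
        (\<lambda>r. conj_by (M j r) (ensemble (a * b) (map fst zs))))) = ensemble (c * d) (map fst ?ws)"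
      by (simp add: mat_sum_ensemble map_concat o_def)
    fix l
    have "approx_cost l ?ws = (\<Sum>j<k. approx_cost l (ws j))"
      unfolding approx_cost_def by (rule sum_list_concat_upt)
    also have "\<dots> \<le> (\<Sum>j<k. approx_cost l (zs' j))" using ws(3) by (intro sum_mono) auto
    also have "\<dots> = (\<Sum>j<k. \<Sum>r<m j. \<Sum>z\<leftarrow>zs. norm_sq (M j r *\<^sub>v (fst z - snd z l)))"
    proof (intro sum.cong refl)
      fix j assume j: "j \<in> {..<k}"
      have "approx_cost l (zs' j) = (\<Sum>r<m j. approx_cost l (map (app j r) zs))"
        unfolding approx_cost_def zs'_def by (rule sum_list_concat_upt)
      also have "\<dots> = (\<Sum>r<m j. \<Sum>z\<leftarrow>zs. norm_sq (M j r *\<^sub>v (fst z - snd z l)))"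
      proof (intro sum.cong refl)
        fix r assume "r \<in> {..<m j}"
        then have "M j r *\<^sub>v (\<phi> - y l) = M j r *\<^sub>v \<phi> - M j r *\<^sub>v y l" if "(\<phi>, y) \<in> set zs" for \<phi> y
          using M[of j r] j zsD[OF that] by (intro mult_minus_distrib_mat_vec) auto
        then show "approx_cost l (map (app j r) zs) = (\<Sum>z\<leftarrow>zs. norm_sq (M j r *\<^sub>v (fst z - snd z l)))"
          unfolding approx_cost_def by (auto simp: app_def o_def split_def intro!: arg_cong[of _ _ sum_list])
      qed
      finally show "approx_cost l (zs' j) = (\<Sum>r<m j. \<Sum>z\<leftarrow>zs. norm_sq (M j r *\<^sub>v (fst z - snd z l)))" .
    qed
    also have "\<dots> = approx_cost l zs"
    proof -
      have "(\<Sum>j<k. \<Sum>r<m j. \<Sum>z\<leftarrow>us. norm_sq (M j r *\<^sub>v (fst z - snd z l))) = approx_cost l us"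
        if "set us \<subseteq> set zs" for us
        using that
      proof (induction us)
        case Nil
        then show ?case by (simp add: approx_cost_def)
      next
        case (Cons z us)
        have "fst z - snd z l \<in> carrier_vec (a * b)" using Cons.prems zsD[of "fst z" "snd z"] by auto
        with Cons show ?case by (simp add: approx_cost_def sum.distrib iso split_def)
      qed
      then show ?thesis by simp
    qed
    finally show "approx_cost l ?ws \<le> approx_cost l zs" .
  qed
qed

lemma locc_monotone_operation:
  assumes "locc c d a b E"
  shows "monotone_operation c d a b (E x)"
  using assms
proof (induction rule: locc.induct)
  case (announce y)
  \<comment> \<open>A branch announcing another message is dropped, leaving the empty ensemble of
    cost 0. This is where the total cost can decrease.\<close>
  have "approx_cost l [] \<le> approx_cost l zs" for l zs
    by (auto simp: approx_cost_def norm_sq_nonneg intro!: sum_list_nonneg)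
  moreover have "0\<^sub>m (c * d) (c * d) = ensemble (c * d) (map fst [])" by (intro eq_matI) auto
  moreover have "approximated c d []" by (simp add: approximated_def)
  ultimately have "monotone_operation c d c d (\<lambda>\<sigma>. 0\<^sub>m (c * d) (c * d))"
    unfolding monotone_operation_def by metis
  moreover have "monotone_operation c d c d (\<lambda>\<sigma>. \<sigma>)"
    unfolding monotone_operation_def by blast
  ultimately show ?case by (cases "x = y") simp_all
next
  case (alice a k a' m K b L)
  have K: "K j r \<in> carrier_mat (a' j) a" if "j < k" "r < m j" for j r
    using alice(1) that unfolding local_instrument_def by blast
  show ?case
    by (rule monotone_operation_step)
      (use alice in \<open>auto intro: kron_carrier[OF K] schmidt_rank_le_kron[OF K one_carrier_mat] alice_isometry\<close>)
next
  case (bob b k b' m K a L)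
  have K: "K j r \<in> carrier_mat (b' j) b" if "j < k" "r < m j" for j r
    using bob(1) that unfolding local_instrument_def by blast
  show ?case
    by (rule monotone_operation_step)
      (use bob in \<open>auto intro: kron_carrier[OF one_carrier_mat K] schmidt_rank_le_kron[OF one_carrier_mat K] bob_isometry\<close>)
qed

subsection \<open>Decompositions from protocols\<close>

lemma norm_sq_smult: "norm_sq (complex_of_real c \<cdot>\<^sub>v v) = c\<^sup>2 * norm_sq v"
  by (simp add: norm_sq_def norm_mult power_mult_distrib sum_distrib_left)

lemma projector_smult:
  "complex_of_real (c\<^sup>2) \<cdot>\<^sub>m projector x = projector (complex_of_real c \<cdot>\<^sub>v x)"
  by (intro eq_matI) (auto simp: projector_def power2_eq_square)

lemma mat_sum_projector:
  assumes "\<And>t. t < k \<Longrightarrow> x t \<in> carrier_vec d"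
  shows "mat_sum d k (\<lambda>t. projector (x t)) = ensemble d (map x [0..<k])"
proof -
  have "mat_sum d k (\<lambda>t. projector (x t)) = mat_sum d k (\<lambda>t. ensemble d [x t])"
    using assms by (intro mat_sum_cong) (simp add: ensemble_singleton)
  then show ?thesis by (simp add: mat_sum_ensemble)
qed

lemma pure_state_unit_vec: "0 < d \<Longrightarrow> pure_state d (unit_vec d 0)"
  by (simp add: pure_state_def)

text \<open>Kraus operators may annihilate a vector, yet \<open>decomposition\<close> asks for pure
  states even at weight 0; the first basis vector then serves as the direction.\<close>

lemma normalisation:
  assumes "w \<in> carrier_vec d" "0 < d"
  obtains \<phi> where "pure_state d \<phi>" "w = complex_of_real (sqrt (norm_sq w)) \<cdot>\<^sub>v \<phi>"
proof (cases "norm_sq w = 0")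
  case True
  then have "\<forall>i<d. w $ i = 0" using assms(1)
    unfolding norm_sq_def by (subst (asm) sum_nonneg_eq_0_iff) auto
  then have "w = complex_of_real (sqrt (norm_sq w)) \<cdot>\<^sub>v unit_vec d 0"
    using True assms(1) by (intro eq_vecI) auto
  with pure_state_unit_vec[OF assms(2)] that show ?thesis by blast
next
  case False
  then have pos: "0 < norm_sq w" using norm_sq_nonneg[of w] by simp
  let ?\<phi> = "complex_of_real (1 / sqrt (norm_sq w)) \<cdot>\<^sub>v w"
  have "pure_state d ?\<phi>" using assms(1) pos unfolding pure_state_iff norm_sq_smult
    by (simp add: power_divide)
  moreover have "w = complex_of_real (sqrt (norm_sq w)) \<cdot>\<^sub>v ?\<phi>"
    using pos assms(1) by (intro eq_vecI) (auto simp flip: of_real_mult)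
  ultimately show ?thesis by (rule that)
qed

text \<open>A mixture as input and a free bound \<open>B\<close> let this serve both directions into
  decompositions: for a protocol, the input is one pure state and \<open>B\<close> the tails of
  \<mu>; for \<open>S_plus\<close>, the input is a mixture from the convex closure, \<open>B\<close>
  the tails of \<mu> divided by \<open>p\<close>, and \<open>s = 1\<close>.\<close>

lemma locc_decomposition:
  assumes E: "locc n n n n E" and "0 < n"
    and \<phi>: "\<And>t. t < k \<Longrightarrow> 0 \<le> q t \<and> pure_state (n * n) (\<phi> t)"
    and B: "\<And>l. l < n \<Longrightarrow> (\<Sum>t<k. q t * (\<Sum>i = l..<n. schmidt_coeffs n (\<phi> t) $ i)) \<le> B l"
    and out: "E x (mat_sum (n * n) k (\<lambda>t. complex_of_real (q t) \<cdot>\<^sub>m projector (\<phi> t))) = complex_of_real s \<cdot>\<^sub>m \<rho>"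
    and "0 < s" and \<rho>: "density_matrix (n * n) \<rho>"
  shows "\<exists>k' q' \<phi>'. decomposition (n * n) \<rho> k' q' \<phi>'
    \<and> (\<forall>l<n. s * (\<Sum>i = l..<n. average_schmidt n k' q' \<phi>' $ i) \<le> B l)"
proof -
  let ?sc = "\<lambda>\<phi>. schmidt_coeffs n \<phi>"
  have "\<exists>u v. orthonormal n n u \<and> orthonormal n n v \<and> \<phi> t = schmidt_form n (\<lambda>r. sqrt (?sc (\<phi> t) $ r)) u v"
    if "t < k" for t
    using pure_state_schmidt(2) \<phi>[OF that] by blast
  then obtain u v where uv: "\<And>t. t < k \<Longrightarrow> orthonormal n n (u t)" "\<And>t. t < k \<Longrightarrow> orthonormal n n (v t)"
    "\<And>t. t < k \<Longrightarrow> \<phi> t = schmidt_form n (\<lambda>r. sqrt (?sc (\<phi> t) $ r)) (u t) (v t)"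
    by metis
  \<comment> \<open>Schmidt coefficients of \<phi> scaled by the square root of its probability, so
    that the vector \<open>z t\<close> carries its weight in its length.\<close>
  define S where "S t r = sqrt (q t) * sqrt (?sc (\<phi> t) $ r)" for t r
  define z where "z t = schmidt_form n (S t) (u t) (v t)" for t
  define y where "y t l = schmidt_form n (\<lambda>r. if r < l then S t r else 0) (u t) (v t)" for t l
  have z_eq: "complex_of_real (q t) \<cdot>\<^sub>m projector (\<phi> t) = projector (z t)" if "t < k" for t
  proof -
    have "z t = complex_of_real (sqrt (q t)) \<cdot>\<^sub>v \<phi> t"
      using that by (subst uv(3)) (simp_all add: schmidt_form_smult z_def S_def[abs_def])
    moreover have "(sqrt (q t))\<^sup>2 = q t" using \<phi>[OF that] by simp
    ultimately show ?thesis using projector_smult[of "sqrt (q t)" "\<phi> t"] by simp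
  qed
  define zs where "zs = map (\<lambda>t. (z t, y t)) [0..<k]"
  have "approximated n n zs"
    using uv schmidt_form_truncation(1) by (auto simp: approximated_def zs_def z_def y_def)
  moreover have "approx_cost l zs \<le> B l" if "l < n" for l
  proof -
    have "approx_cost l zs = (\<Sum>t<k. norm_sq (z t - y t l))"
      by (simp add: approx_cost_def zs_def o_def interv_sum_list_conv_sum_set_nat lessThan_atLeast0)
    also have "\<dots> = (\<Sum>t<k. q t * (\<Sum>i = l..<n. ?sc (\<phi> t) $ i))"
    proof (intro sum.cong refl)
      fix t assume "t \<in> {..<k}"
      then have t: "t < k" by simp
      have "schmidt_vector n (?sc (\<phi> t))" using pure_state_schmidt(1) \<phi>[OF t] by blast
      then have "(S t i)\<^sup>2 = q t * ?sc (\<phi> t) $ i" if "i < n" for i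
        using that \<phi>[OF t] by (simp add: S_def power_mult_distrib schmidt_vector_def)
      then show "norm_sq (z t - y t l) = q t * (\<Sum>i = l..<n. ?sc (\<phi> t) $ i)"
        unfolding z_def y_def schmidt_form_truncation(2)[OF uv(1)[OF t] uv(2)[OF t] \<open>l < n\<close>]
        by (simp add: sum_distrib_left)
    qed
    also have "\<dots> \<le> B l" by (rule B[OF that])
    finally show ?thesis .
  qed
  moreover have "mat_sum (n * n) k (\<lambda>t. complex_of_real (q t) \<cdot>\<^sub>m projector (\<phi> t)) = ensemble (n * n) (map fst zs)"
  proof -
    have "mat_sum (n * n) k (\<lambda>t. complex_of_real (q t) \<cdot>\<^sub>m projector (\<phi> t)) = mat_sum (n * n) k (\<lambda>t. projector (z t))"
      by (intro mat_sum_cong) (simp add: z_eq)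
    also have "\<dots> = ensemble (n * n) (map z [0..<k])" by (rule mat_sum_projector) (simp add: z_def)
    finally show ?thesis by (simp add: zs_def o_def)
  qed
  ultimately obtain ws where ws: "approximated n n ws" "complex_of_real s \<cdot>\<^sub>m \<rho> = ensemble (n * n) (map fst ws)"
    "\<And>l. l < n \<Longrightarrow> approx_cost l ws \<le> B l"
    using locc_monotone_operation[OF E, of x] out unfolding monotone_operation_def by (metis order_trans)
  define K where "K = length ws"
  define w where "w t = fst (ws ! t)" for t
  define g where "g t = snd (ws ! t)" for t
  have w: "w t \<in> carrier_vec (n * n)" "schmidt_rank_le n n l (g t l)" if "t < K" for t l
  proof -
    have "(w t, g t) \<in> set ws" using that by (simp add: w_def g_def K_def)
    with ws(1) show "w t \<in> carrier_vec (n * n)" "schmidt_rank_le n n l (g t l)"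
      unfolding approximated_def by auto
  qed
  have "0 < n * n" using \<open>0 < n\<close> by simp
  then have "\<exists>f. pure_state (n * n) f \<and> w t = complex_of_real (sqrt (norm_sq (w t))) \<cdot>\<^sub>v f" if "t < K" for t
    using normalisation w(1)[OF that] by metis
  then obtain \<phi>' where \<phi>': "\<And>t. t < K \<Longrightarrow> pure_state (n * n) (\<phi>' t)"
    "\<And>t. t < K \<Longrightarrow> w t = complex_of_real (sqrt (norm_sq (w t))) \<cdot>\<^sub>v \<phi>' t"
    by metis
  \<comment> \<open>Dividing by the success probability conditions on success. That these weights
    sum to 1 comes from the trace of \<rho>.\<close>
  define q' where "q' t = norm_sq (w t) / s" for t
  have sum_ws: "(\<Sum>x\<leftarrow>ws. F x) = (\<Sum>t<K. F (ws ! t))" for F :: "_ \<Rightarrow> 'z :: comm_monoid_add"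
    by (simp add: sum_list_sum_nth K_def lessThan_atLeast0)
  have \<rho>_index: "complex_of_real s * \<rho> $$ (i, j) = (\<Sum>t<K. w t $ i * cnj (w t $ j))"
    if "i < n * n" "j < n * n" for i j
  proof -
    have "complex_of_real s * \<rho> $$ (i, j) = (complex_of_real s \<cdot>\<^sub>m \<rho>) $$ (i, j)"
      using that \<rho> by (auto simp: density_matrix_def)
    also have "\<dots> = (\<Sum>t<K. w t $ i * cnj (w t $ j))"
      unfolding ws(2) using that by (simp add: o_def sum_ws w_def)
    finally show ?thesis .
  qed
  have "decomposition (n * n) \<rho> K q' \<phi>'"
    unfolding decomposition_def
  proof (intro conjI allI impI)
    fix t assume "t < K"
    then show "0 \<le> q' t" "pure_state (n * n) (\<phi>' t)"
      using \<open>0 < s\<close> norm_sq_nonneg \<phi>'(1) by (auto simp: q'_def)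
  next
    have "complex_of_real s * (\<Sum>i<n * n. \<rho> $$ (i, i)) = (\<Sum>i<n * n. \<Sum>t<K. w t $ i * cnj (w t $ i))"
      by (simp add: sum_distrib_left \<rho>_index)
    also have "\<dots> = (\<Sum>t<K. \<Sum>i<n * n. w t $ i * cnj (w t $ i))" by (rule sum.swap)
    also have "\<dots> = (\<Sum>t<K. complex_of_real (norm_sq (w t)))"
      unfolding norm_sq_def of_real_sum complex_norm_square using carrier_vecD[OF w(1)] by (intro sum.cong) auto
    finally have "complex_of_real s = complex_of_real (\<Sum>t<K. norm_sq (w t))"
      using \<rho> by (simp add: density_matrix_def)
    then have "s = (\<Sum>t<K. norm_sq (w t))" unfolding of_real_eq_iff .
    then show "(\<Sum>t<K. q' t) = 1" using \<open>0 < s\<close> by (simp add: q'_def flip: sum_divide_distrib)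
  next
    show "\<rho> = mat_sum (n * n) K (\<lambda>t. complex_of_real (q' t) \<cdot>\<^sub>m projector (\<phi>' t))"
    proof (rule eq_matI)
      fix i j assume "i < dim_row (mat_sum (n * n) K (\<lambda>t. complex_of_real (q' t) \<cdot>\<^sub>m projector (\<phi>' t)))"
        "j < dim_col (mat_sum (n * n) K (\<lambda>t. complex_of_real (q' t) \<cdot>\<^sub>m projector (\<phi>' t)))"
      then have ij: "i < n * n" "j < n * n" by auto
      have "w t $ i * cnj (w t $ j) = complex_of_real s * (complex_of_real (q' t) * (\<phi>' t $ i * cnj (\<phi>' t $ j)))"
        if "t < K" for t
      proof -
        have d: "dim_vec (\<phi>' t) = n * n" using \<phi>'(1)[OF that] by (auto simp: pure_state_def)
        have *: "w t $ i = complex_of_real (sqrt (norm_sq (w t))) * \<phi>' t $ i" if "i < n * n" for i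
          by (subst \<phi>'(2)[OF \<open>t < K\<close>]) (use d that in simp)
        have "w t $ i * cnj (w t $ j)
            = complex_of_real (sqrt (norm_sq (w t)) * sqrt (norm_sq (w t))) * (\<phi>' t $ i * cnj (\<phi>' t $ j))"
          unfolding *[OF ij(1)] *[OF ij(2)] by (simp only: of_real_mult complex_cnj_mult complex_cnj_complex_of_real mult_ac)
        also have "sqrt (norm_sq (w t)) * sqrt (norm_sq (w t)) = s * q' t"
          using norm_sq_nonneg[of "w t"] \<open>0 < s\<close> by (simp add: q'_def)
        finally show ?thesis by simp
      qed
      then have "complex_of_real s * \<rho> $$ (i, j)
          = complex_of_real s * (\<Sum>t<K. complex_of_real (q' t) * (\<phi>' t $ i * cnj (\<phi>' t $ j)))"
        using \<rho>_index[OF ij] by (simp add: sum_distrib_left)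
      then have "\<rho> $$ (i, j) = (\<Sum>t<K. complex_of_real (q' t) * (\<phi>' t $ i * cnj (\<phi>' t $ j)))"
        using \<open>0 < s\<close> by simp
      moreover have "dim_vec (\<phi>' t) = n * n" if "t < K" for t
        using \<phi>'(1)[OF that] by (auto simp: pure_state_def)
      ultimately show "\<rho> $$ (i, j) = mat_sum (n * n) K (\<lambda>t. complex_of_real (q' t) \<cdot>\<^sub>m projector (\<phi>' t)) $$ (i, j)"
        using ij by (simp add: projector_def)
    qed (use \<rho> in \<open>auto simp: density_matrix_def\<close>)
  qed
  moreover have "s * (\<Sum>i = l..<n. average_schmidt n K q' \<phi>' $ i) \<le> B l" if "l < n" for l
  proof -
    have "s * (\<Sum>i = l..<n. average_schmidt n K q' \<phi>' $ i)
        = (\<Sum>i = l..<n. \<Sum>t<K. norm_sq (w t) * ?sc (\<phi>' t) $ i)"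
      using \<open>0 < s\<close> by (simp add: average_schmidt_def q'_def sum_distrib_left)
    also have "\<dots> = (\<Sum>t<K. \<Sum>i = l..<n. norm_sq (w t) * ?sc (\<phi>' t) $ i)" by (rule sum.swap)
    \<comment> \<open>The transported \<open>g t l\<close> need not be the best approximant of
      \<open>w t\<close>, but it has Schmidt rank at most \<open>l\<close>, so its distance is no
      less than the tail.\<close>
    also have "\<dots> \<le> (\<Sum>t<K. norm_sq (w t - g t l))"
    proof (rule sum_mono)
      fix t assume "t \<in> {..<K}"
      then have t: "t < K" by simp
      obtain a b where ab: "orthonormal n n a" "orthonormal n n b"
        "\<phi>' t = schmidt_form n (\<lambda>r. sqrt (?sc (\<phi>' t) $ r)) a b"
        using pure_state_schmidt(2)[OF \<phi>'(1)[OF t]] by blast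
      have sv: "schmidt_vector n (?sc (\<phi>' t))" by (rule pure_state_schmidt(1)[OF \<phi>'(1)[OF t]])
      have w_eq: "w t = schmidt_form n (\<lambda>r. sqrt (norm_sq (w t)) * sqrt (?sc (\<phi>' t) $ r)) a b"
        unfolding schmidt_form_smult[symmetric] ab(3)[symmetric] by (rule \<phi>'(2)[OF t])
      have "(\<Sum>i = l..<n. norm_sq (w t) * ?sc (\<phi>' t) $ i)
          = (\<Sum>i = l..<n. (sqrt (norm_sq (w t)) * sqrt (?sc (\<phi>' t) $ i))\<^sup>2)"
        using sv norm_sq_nonneg[of "w t"] by (intro sum.cong) (auto simp: power_mult_distrib schmidt_vector_def)
      also have "\<dots> \<le> norm_sq (schmidt_form n (\<lambda>r. sqrt (norm_sq (w t)) * sqrt (?sc (\<phi>' t) $ r)) a b - g t l)"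
        by (rule schmidt_tail_le_distance[OF ab(1,2)])
          (use sv norm_sq_nonneg w(2)[OF t] \<open>l < n\<close> in
            \<open>auto simp: schmidt_vector_def intro!: mult_left_mono real_sqrt_le_mono\<close>)
      finally show "(\<Sum>i = l..<n. norm_sq (w t) * ?sc (\<phi>' t) $ i) \<le> norm_sq (w t - g t l)"
        unfolding w_eq[symmetric] .
    qed
    also have "\<dots> = approx_cost l ws" by (simp add: approx_cost_def sum_ws w_def g_def split_def)
    also have "\<dots> \<le> B l" by (rule ws(3)[OF that])
    finally show ?thesis .
  qed
  ultimately show ?thesis by blast
qed

section \<open>One-way protocols\<close>

lemma mat_adjoint_mult:
  fixes A B :: cmat
  assumes "A \<in> carrier_mat a b" "B \<in> carrier_mat b c"
  shows "mat_adjoint (A * B) = mat_adjoint B * mat_adjoint A"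
  using assms by (intro eq_matI) (auto simp: scalar_prod_def lessThan_atLeast0[symmetric] mult.commute intro!: sum.cong)

lemma mat_sum_one: "X \<in> carrier_mat d d \<Longrightarrow> mat_sum d (Suc 0) (\<lambda>_. X) = X"
  by (intro eq_matI) auto

text \<open>A round of \<open>locc\<close> belongs to one party, so a joint product operator is
  realised as Alice's part followed by Bob's.\<close>

lemma kron_split_mult_vec:
  assumes A: "A \<in> carrier_mat a' a" and B: "B \<in> carrier_mat b' b" and z: "z \<in> carrier_vec (a * b)"
  shows "(1\<^sub>m a' \<otimes>\<^sub>k B) *\<^sub>v ((A \<otimes>\<^sub>k 1\<^sub>m b) *\<^sub>v z) = (A \<otimes>\<^sub>k B) *\<^sub>v z"
proof (rule pair_index_vec_eqI[of _ a' b'])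
  have Az: "(A \<otimes>\<^sub>k 1\<^sub>m b) *\<^sub>v z \<in> carrier_vec (a' * b)"
    by (rule mult_mat_vec_carrier[OF kron_carrier[OF A one_carrier_mat] z])
  show "(1\<^sub>m a' \<otimes>\<^sub>k B) *\<^sub>v ((A \<otimes>\<^sub>k 1\<^sub>m b) *\<^sub>v z) \<in> carrier_vec (a' * b')"
    by (rule mult_mat_vec_carrier[OF kron_carrier[OF one_carrier_mat B] Az])
  show "(A \<otimes>\<^sub>k B) *\<^sub>v z \<in> carrier_vec (a' * b')"
    by (rule mult_mat_vec_carrier[OF kron_carrier[OF A B] z])
  fix i k assume ik: "i < a'" "k < b'"
  have 1: "((A \<otimes>\<^sub>k 1\<^sub>m b) *\<^sub>v z) $ (i * b + q) = (\<Sum>p<a. A $$ (i, p) * z $ (p * b + q))" if "q < b" for q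
    using one_mat_row_sum[OF that] unfolding kron_mult_vec_index[OF A one_carrier_mat z ik(1) that]
    by (simp only: mult.assoc flip: sum_distrib_left)
  have "((1\<^sub>m a' \<otimes>\<^sub>k B) *\<^sub>v ((A \<otimes>\<^sub>k 1\<^sub>m b) *\<^sub>v z)) $ (i * b' + k)
      = (\<Sum>q<b. B $$ (k, q) * ((A \<otimes>\<^sub>k 1\<^sub>m b) *\<^sub>v z) $ (i * b + q))"
    unfolding kron_mult_vec_index[OF one_carrier_mat B Az ik] using one_mat_row_sum[OF ik(1)]
    by (simp only: mult.assoc flip: sum_distrib_left)
  also have "\<dots> = (\<Sum>q<b. \<Sum>p<a. A $$ (i, p) * B $$ (k, q) * z $ (p * b + q))"
    by (intro sum.cong refl, subst 1) (simp_all add: sum_distrib_left mult_ac)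
  also have "\<dots> = ((A \<otimes>\<^sub>k B) *\<^sub>v z) $ (i * b' + k)"
    unfolding kron_mult_vec_index[OF A B z ik] by (rule sum.swap)
  finally show "((1\<^sub>m a' \<otimes>\<^sub>k B) *\<^sub>v ((A \<otimes>\<^sub>k 1\<^sub>m b) *\<^sub>v z)) $ (i * b' + k) = ((A \<otimes>\<^sub>k B) *\<^sub>v z) $ (i * b' + k)" .
qed

text \<open>Alice measures and sends the outcome \<open>t\<close>, Bob applies \<open>V t\<close>,
  and \<open>g t\<close> is announced; thus \<open>g\<close> selects the outcomes that count as
  success.\<close>

lemma locc_one_way:
  assumes K: "\<And>t. t < k \<Longrightarrow> K t \<in> carrier_mat n n" "mat_sum n k (\<lambda>t. mat_adjoint (K t) * K t) = 1\<^sub>m n"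
    and V: "\<And>t. t < k \<Longrightarrow> unitary_mat n (V t)"
  obtains E :: "bool \<Rightarrow> cmat \<Rightarrow> cmat" where "locc n n n n E"
    "\<And>xs. (\<And>x. x \<in> set xs \<Longrightarrow> x \<in> carrier_vec (n * n)) \<Longrightarrow> E True (ensemble (n * n) xs)
      = mat_sum (n * n) k (\<lambda>t. if g t then ensemble (n * n) (map ((*\<^sub>v) (K t \<otimes>\<^sub>k V t)) xs) else 0\<^sub>m (n * n) (n * n))"
proof -
  \<comment> \<open>The sums of a single term are the shape that the rule \<open>bob\<close>
    produces for one outcome with one Kraus operator.\<close>
  define L where "L j = (\<lambda>x \<sigma>. mat_sum (n * n) (Suc 0) (\<lambda>_. if x = g j
    then mat_sum (n * n) (Suc 0) (\<lambda>_. conj_by (1\<^sub>m n \<otimes>\<^sub>k V j) \<sigma>) else 0\<^sub>m (n * n) (n * n)))" for j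
  define E where "E = (\<lambda>x \<sigma>. mat_sum (n * n) k (\<lambda>j. L j x
    (mat_sum (n * n) (Suc 0) (\<lambda>_. conj_by (K j \<otimes>\<^sub>k 1\<^sub>m n) \<sigma>))))"
  have one: "mat_sum n (Suc 0) (\<lambda>_. mat_adjoint M * M) = mat_adjoint M * M" if "M \<in> carrier_mat n n" for M
    using that by (intro mat_sum_one) auto
  have "locc n n n n (L j)" if "j < k" for j
  proof -
    have "V j \<in> carrier_mat n n" "mat_adjoint (V j) * V j = 1\<^sub>m n" using V[OF that] by (auto simp: unitary_mat_def)
    then have "local_instrument n (Suc 0) (\<lambda>_. n) (\<lambda>_. Suc 0) (\<lambda>_ _. V j)"
      unfolding local_instrument_def by (simp add: one mat_sum_one)
    from locc.bob[OF this, of n n n "\<lambda>_ x \<sigma>. if x = g j then \<sigma> else 0\<^sub>m (n * n) (n * n)"] show ?thesis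
      unfolding L_def using locc.announce[of n n "g j"] by simp
  qed
  moreover have "local_instrument n k (\<lambda>_. n) (\<lambda>_. Suc 0) (\<lambda>j _. K j)"
    unfolding local_instrument_def using K(1)
    by (simp add: mat_sum_cong[OF one[OF K(1)]] K(2))
  ultimately have "locc n n n n E"
    unfolding E_def by (intro locc.alice[of n k "\<lambda>_. n" "\<lambda>_. Suc 0" "\<lambda>j _. K j"]) auto
  moreover have "E True (ensemble (n * n) xs)
      = mat_sum (n * n) k (\<lambda>t. if g t then ensemble (n * n) (map ((*\<^sub>v) (K t \<otimes>\<^sub>k V t)) xs) else 0\<^sub>m (n * n) (n * n))"
    if xs: "\<And>x. x \<in> set xs \<Longrightarrow> x \<in> carrier_vec (n * n)" for xs
    unfolding E_def
  proof (rule mat_sum_cong)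
    fix t assume t: "t < k"
    have Vt: "V t \<in> carrier_mat n n" using V[OF t] by (auto simp: unitary_mat_def)
    have K1: "K t \<otimes>\<^sub>k 1\<^sub>m n \<in> carrier_mat (n * n) (n * n)" and V1: "1\<^sub>m n \<otimes>\<^sub>k V t \<in> carrier_mat (n * n) (n * n)"
      using K(1)[OF t] Vt by (auto intro: kron_carrier)
    have "conj_by (K t \<otimes>\<^sub>k 1\<^sub>m n) (ensemble (n * n) xs) = ensemble (n * n) (map ((*\<^sub>v) (K t \<otimes>\<^sub>k 1\<^sub>m n)) xs)"
      using conj_by_ensemble[OF K1 xs] .
    moreover have "conj_by (1\<^sub>m n \<otimes>\<^sub>k V t) (ensemble (n * n) (map ((*\<^sub>v) (K t \<otimes>\<^sub>k 1\<^sub>m n)) xs))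
        = ensemble (n * n) (map ((*\<^sub>v) (1\<^sub>m n \<otimes>\<^sub>k V t)) (map ((*\<^sub>v) (K t \<otimes>\<^sub>k 1\<^sub>m n)) xs))"
      using K1 xs by (intro conj_by_ensemble[OF V1]) auto
    moreover have "map ((*\<^sub>v) (1\<^sub>m n \<otimes>\<^sub>k V t)) (map ((*\<^sub>v) (K t \<otimes>\<^sub>k 1\<^sub>m n)) xs) = map ((*\<^sub>v) (K t \<otimes>\<^sub>k V t)) xs"
      using kron_split_mult_vec[OF K(1)[OF t] Vt] xs by simp
    ultimately show "L t True (mat_sum (n * n) (Suc 0) (\<lambda>_. conj_by (K t \<otimes>\<^sub>k 1\<^sub>m n) (ensemble (n * n) xs)))
        = (if g t then ensemble (n * n) (map ((*\<^sub>v) (K t \<otimes>\<^sub>k V t)) xs) else 0\<^sub>m (n * n) (n * n))"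
      unfolding L_def by (simp add: mat_sum_one del: map_map)
  qed
  ultimately show ?thesis by (rule that)
qed

text \<open>Alice's unitary is merged into her Kraus operator, which leaves the completeness
  relation intact, and every outcome counts as success.\<close>

lemma LOCC1A_locc:
  assumes "\<L> \<in> LOCC1A n"
  obtains E :: "bool \<Rightarrow> cmat \<Rightarrow> cmat" where "locc n n n n E"
    "\<And>\<psi>. \<psi> \<in> carrier_vec (n * n) \<Longrightarrow> E True (projector \<psi>) = \<L> (projector \<psi>)"
proof -
  obtain k A U V where \<L>: "\<L> = (\<lambda>\<sigma>. mat_sum (n * n) k (\<lambda>i. conj_by ((U i * A i) \<otimes>\<^sub>k V i) \<sigma>))"
    and AUV: "\<And>i. i < k \<Longrightarrow> A i \<in> carrier_mat n n" "\<And>i. i < k \<Longrightarrow> unitary_mat n (U i)"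
      "\<And>i. i < k \<Longrightarrow> unitary_mat n (V i)"
    and A: "mat_sum n k (\<lambda>i. mat_adjoint (A i) * A i) = 1\<^sub>m n"
    using assms unfolding LOCC1A_def by blast
  have U: "U i \<in> carrier_mat n n" "mat_adjoint (U i) * U i = 1\<^sub>m n" if "i < k" for i
    using AUV(2)[OF that] by (auto simp: unitary_mat_def)
  have "mat_adjoint (U i * A i) * (U i * A i) = mat_adjoint (A i) * A i" if "i < k" for i
  proof -
    have c: "mat_adjoint (A i) \<in> carrier_mat n n" "mat_adjoint (U i) \<in> carrier_mat n n"
      using AUV(1)[OF that] U(1)[OF that] by (auto intro!: carrier_matI)
    have "mat_adjoint (U i * A i) * (U i * A i) = mat_adjoint (A i) * (mat_adjoint (U i) * (U i * A i))"
      using AUV(1)[OF that] U(1)[OF that] c mat_adjoint_mult[OF U(1) AUV(1), OF that that]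
      by (simp add: assoc_mult_mat[of _ n n _ n _ n])
    also have "mat_adjoint (U i) * (U i * A i) = (mat_adjoint (U i) * U i) * A i"
      using AUV(1)[OF that] U(1)[OF that] c by (simp add: assoc_mult_mat[of _ n n _ n _ n])
    also have "\<dots> = A i" using U(2)[OF that] AUV(1)[OF that] by simp
    finally show ?thesis .
  qed
  then have "mat_sum n k (\<lambda>i. mat_adjoint (U i * A i) * (U i * A i)) = 1\<^sub>m n"
    using A mat_sum_cong[of k "\<lambda>i. mat_adjoint (U i * A i) * (U i * A i)" "\<lambda>i. mat_adjoint (A i) * A i"] by simp
  moreover have UA: "U i * A i \<in> carrier_mat n n" if "i < k" for i
    using AUV(1)[OF that] U(1)[OF that] by simp
  ultimately obtain E :: "bool \<Rightarrow> cmat \<Rightarrow> cmat" where E: "locc n n n n E"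
    "\<And>xs. (\<And>x. x \<in> set xs \<Longrightarrow> x \<in> carrier_vec (n * n)) \<Longrightarrow> E True (ensemble (n * n) xs)
      = mat_sum (n * n) k (\<lambda>t. if True then ensemble (n * n) (map ((*\<^sub>v) ((U t * A t) \<otimes>\<^sub>k V t)) xs) else 0\<^sub>m (n * n) (n * n))"
    using locc_one_way[of k "\<lambda>i. U i * A i" n V "\<lambda>_. True"] AUV(3) by blast
  have "E True (projector \<psi>) = \<L> (projector \<psi>)" if \<psi>: "\<psi> \<in> carrier_vec (n * n)" for \<psi>
  proof -
    have "E True (ensemble (n * n) [\<psi>])
        = mat_sum (n * n) k (\<lambda>t. ensemble (n * n) (map ((*\<^sub>v) ((U t * A t) \<otimes>\<^sub>k V t)) [\<psi>]))"
      using E(2)[of "[\<psi>]"] \<psi> by simp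
    also have "\<dots> = mat_sum (n * n) k (\<lambda>t. conj_by ((U t * A t) \<otimes>\<^sub>k V t) (ensemble (n * n) [\<psi>]))"
    proof (rule mat_sum_cong)
      fix t assume t: "t < k"
      have "(U t * A t) \<otimes>\<^sub>k V t \<in> carrier_mat (n * n) (n * n)"
        using UA[OF t] AUV(3)[OF t] by (auto simp: unitary_mat_def intro: kron_carrier)
      then show "ensemble (n * n) (map ((*\<^sub>v) ((U t * A t) \<otimes>\<^sub>k V t)) [\<psi>])
          = conj_by ((U t * A t) \<otimes>\<^sub>k V t) (ensemble (n * n) [\<psi>])"
        using \<psi> by (intro conj_by_ensemble[symmetric]) auto
    qed
    finally show ?thesis using \<psi> by (simp add: \<L> ensemble_singleton)
  qed
  with E(1) show ?thesis by (rule that)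
qed

subsection \<open>Kraus operators that are diagonal between two bases\<close>

text \<open>The operator that sends the basis vector \<open>b l\<close> to \<open>d l\<close> times
  \<open>a l\<close>: a unitary for \<open>d = 1\<close>, and for \<open>a = b\<close> a member of a
  commuting family.\<close>

definition diag_op ::
    "nat \<Rightarrow> (nat \<Rightarrow> real) \<Rightarrow> (nat \<Rightarrow> nat \<Rightarrow> complex) \<Rightarrow> (nat \<Rightarrow> nat \<Rightarrow> complex) \<Rightarrow> cmat" where
  "diag_op n d a b = mat n n (\<lambda>(i, j). \<Sum>l<n. complex_of_real (d l) * a l i * cnj (b l j))"

lemma diag_op_carrier [simp]: "diag_op n d a b \<in> carrier_mat n n"
  by (simp add: diag_op_def)

lemma diag_op_dim [simp]: "dim_row (diag_op n d a b) = n" "dim_col (diag_op n d a b) = n"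
  by (simp_all add: diag_op_def)

lemma diag_op_index:
  "i < n \<Longrightarrow> j < n \<Longrightarrow> diag_op n d a b $$ (i, j) = (\<Sum>l<n. complex_of_real (d l) * a l i * cnj (b l j))"
  by (simp add: diag_op_def)

lemma diag_op_apply:
  assumes b: "orthonormal n n b" and "i < n"
  shows "(\<Sum>p<n. diag_op n d a b $$ (i, p) * (\<Sum>l<n. s l * b l p))
    = (\<Sum>l<n. complex_of_real (d l) * s l * a l i)"
proof -
  have "(\<Sum>p<n. diag_op n d a b $$ (i, p) * (\<Sum>l<n. s l * b l p))
      = (\<Sum>p<n. \<Sum>r<n. complex_of_real (d r) * a r i * ((\<Sum>l<n. s l * b l p) * cnj (b r p)))"
  proof (intro sum.cong refl)
    fix p assume "p \<in> {..<n}"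
    then show "diag_op n d a b $$ (i, p) * (\<Sum>l<n. s l * b l p)
        = (\<Sum>r<n. complex_of_real (d r) * a r i * ((\<Sum>l<n. s l * b l p) * cnj (b r p)))"
      using assms(2) by (simp only: diag_op_index lessThan_iff, subst sum_distrib_right)
        (simp only: mult_ac)
  qed
  also have "\<dots> = (\<Sum>r<n. \<Sum>p<n. complex_of_real (d r) * a r i * ((\<Sum>l<n. s l * b l p) * cnj (b r p)))"
    by (rule sum.swap)
  also have "\<dots> = (\<Sum>r<n. complex_of_real (d r) * a r i * cinner n (\<lambda>p. \<Sum>l<n. s l * b l p) (b r))"
    by (simp add: cinner_def sum_distrib_left)
  also have "\<dots> = (\<Sum>r<n. complex_of_real (d r) * a r i * s r)"
    using orthonormal_combination[OF b] by simp
  finally show ?thesis by (simp add: mult_ac)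
qed

lemma diag_op_mult:
  assumes c: "orthonormal n n c"
  shows "diag_op n e a c * diag_op n d c b = diag_op n (\<lambda>l. e l * d l) a b"
proof (rule eq_matI)
  fix i j assume "i < dim_row (diag_op n (\<lambda>l. e l * d l) a b)" "j < dim_col (diag_op n (\<lambda>l. e l * d l) a b)"
  then have ij: "i < n" "j < n" by auto
  have "(diag_op n e a c * diag_op n d c b) $$ (i, j)
      = (\<Sum>p<n. diag_op n e a c $$ (i, p) * diag_op n d c b $$ (p, j))"
    using ij by (simp add: scalar_prod_def lessThan_atLeast0)
  also have "\<dots> = (\<Sum>p<n. diag_op n e a c $$ (i, p) * (\<Sum>l<n. complex_of_real (d l) * cnj (b l j) * c l p))"
    using ij by (intro sum.cong refl) (simp add: diag_op_index mult_ac)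
  also have "\<dots> = (\<Sum>l<n. complex_of_real (e l) * (complex_of_real (d l) * cnj (b l j)) * a l i)"
    by (rule diag_op_apply[OF c ij(1)])
  also have "\<dots> = diag_op n (\<lambda>l. e l * d l) a b $$ (i, j)"
    using ij by (simp add: diag_op_index mult_ac)
  finally show "(diag_op n e a c * diag_op n d c b) $$ (i, j) = diag_op n (\<lambda>l. e l * d l) a b $$ (i, j)" .
qed simp_all

lemma diag_op_adjoint: "mat_adjoint (diag_op n d a b) = diag_op n d b a"
  by (intro eq_matI) (simp_all add: diag_op_index mult_ac)

lemma diag_op_one:
  assumes "orthonormal n n b" "\<And>l. l < n \<Longrightarrow> d l = 1"
  shows "diag_op n d b b = 1\<^sub>m n"
  using assms by (intro eq_matI) (auto simp: diag_op_index orthonormal_completeness)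

lemma diag_op_unitary:
  assumes "orthonormal n n a" "orthonormal n n b"
  shows "unitary_mat n (diag_op n (\<lambda>_. 1) a b)"
  unfolding unitary_mat_def diag_op_adjoint using assms by (simp add: diag_op_mult diag_op_one)

text \<open>The output basis may depend on the outcome because it cancels against the adjoint;
  completeness becomes one scalar condition per basis vector.\<close>

lemma diag_op_kraus:
  assumes a: "\<And>t. t < k \<Longrightarrow> orthonormal n n (a t)" and b: "orthonormal n n b"
    and d: "\<And>l. l < n \<Longrightarrow> (\<Sum>t<k. (d t l)\<^sup>2) = 1"
  shows "mat_sum n k (\<lambda>t. mat_adjoint (diag_op n (d t) (a t) b) * diag_op n (d t) (a t) b) = 1\<^sub>m n"
proof -
  have "mat_sum n k (\<lambda>t. mat_adjoint (diag_op n (d t) (a t) b) * diag_op n (d t) (a t) b)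
      = mat_sum n k (\<lambda>t. diag_op n (\<lambda>l. d t l * d t l) b b)"
    using a by (intro mat_sum_cong) (simp add: diag_op_adjoint diag_op_mult)
  also have "\<dots> = diag_op n (\<lambda>l. \<Sum>t<k. (d t l)\<^sup>2) b b"
  proof (rule eq_matI)
    fix i j assume "i < dim_row (diag_op n (\<lambda>l. \<Sum>t<k. (d t l)\<^sup>2) b b)"
      "j < dim_col (diag_op n (\<lambda>l. \<Sum>t<k. (d t l)\<^sup>2) b b)"
    then have ij: "i < n" "j < n" by auto
    have "(\<Sum>t<k. \<Sum>l<n. complex_of_real (d t l * d t l) * b l i * cnj (b l j))
        = (\<Sum>l<n. \<Sum>t<k. complex_of_real (d t l * d t l) * b l i * cnj (b l j))" by (rule sum.swap)
    then show "mat_sum n k (\<lambda>t. diag_op n (\<lambda>l. d t l * d t l) b b) $$ (i, j)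
        = diag_op n (\<lambda>l. \<Sum>t<k. (d t l)\<^sup>2) b b $$ (i, j)"
      using ij by (simp add: diag_op_index sum_distrib_right power2_eq_square)
  qed simp_all
  also have "\<dots> = 1\<^sub>m n" by (rule diag_op_one[OF b d])
  finally show ?thesis .
qed

text \<open>The basic move of both constructions: Alice rescales the Schmidt coefficients, and both
  parties exchange their Schmidt bases for arbitrary families.\<close>

lemma diag_op_schmidt_form:
  assumes b: "orthonormal n n b" and b': "orthonormal n n b'"
  shows "(diag_op n d a b \<otimes>\<^sub>k diag_op n (\<lambda>_. 1) a' b') *\<^sub>v schmidt_form n s b b'
    = schmidt_form n (\<lambda>l. d l * s l) a a'"
proof (rule pair_index_vec_eqI[of _ n n])
  let ?A = "diag_op n d a b" and ?B = "diag_op n (\<lambda>_. 1) a' b'"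
  show "(?A \<otimes>\<^sub>k ?B) *\<^sub>v schmidt_form n s b b' \<in> carrier_vec (n * n)"
    by (rule mult_mat_vec_carrier[OF kron_carrier[of _ n n _ n n]]) simp_all
  fix i k assume ik: "i < n" "k < n"
  have "((?A \<otimes>\<^sub>k ?B) *\<^sub>v schmidt_form n s b b') $ (i * n + k)
      = (\<Sum>p<n. \<Sum>q<n. ?A $$ (i, p) * ?B $$ (k, q) * schmidt_form n s b b' $ (p * n + q))"
    using ik by (intro kron_mult_vec_index) simp_all
  also have "\<dots> = (\<Sum>p<n. ?A $$ (i, p) * (\<Sum>q<n. ?B $$ (k, q) * (\<Sum>l<n. complex_of_real (s l) * b l p * b' l q)))"
    by (simp add: schmidt_form_index sum_distrib_left mult_ac)
  also have "\<dots> = (\<Sum>p<n. ?A $$ (i, p) * (\<Sum>l<n. complex_of_real 1 * (complex_of_real (s l) * b l p) * a' l k))"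
    by (simp only: diag_op_apply[OF b' ik(2), of "\<lambda>_. 1"])
  also have "\<dots> = (\<Sum>p<n. ?A $$ (i, p) * (\<Sum>l<n. complex_of_real (s l) * a' l k * b l p))"
    by (simp add: mult_ac)
  also have "\<dots> = (\<Sum>l<n. complex_of_real (d l) * (complex_of_real (s l) * a' l k) * a l i)"
    by (rule diag_op_apply[OF b ik(1)])
  also have "\<dots> = schmidt_form n (\<lambda>l. d l * s l) a a' $ (i * n + k)"
    using ik by (simp add: schmidt_form_index mult_ac)
  finally show "((?A \<otimes>\<^sub>k ?B) *\<^sub>v schmidt_form n s b b') $ (i * n + k)
      = schmidt_form n (\<lambda>l. d l * s l) a a' $ (i * n + k)" .
qed simp

text \<open>The case distinction takes care of the division by zero: on the kernel of the state the
  measurement is arbitrary.\<close>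

lemma measurement_weights:
  fixes W :: "nat \<Rightarrow> nat \<Rightarrow> real" and \<mu> :: "nat \<Rightarrow> real"
  assumes "0 < k" and W: "\<And>t l. t < k \<Longrightarrow> l < n \<Longrightarrow> 0 \<le> W t l"
    and \<mu>: "\<And>l. l < n \<Longrightarrow> (\<Sum>t<k. W t l) = \<mu> l"
  shows "\<exists>d. (\<forall>l<n. (\<Sum>t<k. (d t l)\<^sup>2) = 1) \<and> (\<forall>t<k. \<forall>l<n. d t l * sqrt (\<mu> l) = sqrt (W t l))"
proof -
  define d where "d t l = (if \<mu> l = 0 then of_bool (t = 0) else sqrt (W t l / \<mu> l))" for t l
  have \<mu>_nonneg: "0 \<le> \<mu> l" if "l < n" for l
    unfolding \<mu>[OF that, symmetric] using W that by (intro sum_nonneg) auto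
  have "(\<Sum>t<k. (d t l)\<^sup>2) = 1" if l: "l < n" for l
  proof (cases "\<mu> l = 0")
    case True
    then have "(\<Sum>t<k. (d t l)\<^sup>2) = (\<Sum>t<k. 1 * of_bool (t = 0))"
      by (intro sum.cong) (auto simp: d_def)
    then show ?thesis using \<open>0 < k\<close> by (simp add: sum_of_bool_mult del: sum_mult_of_bool_eq mult_1 mult_1_left)
  next
    case False
    then have "(\<Sum>t<k. (d t l)\<^sup>2) = (\<Sum>t<k. W t l / \<mu> l)"
      using W[OF _ l] \<mu>_nonneg[OF l] by (intro sum.cong) (auto simp: d_def)
    then show ?thesis using False \<mu>[OF l] by (simp flip: sum_divide_distrib)
  qed
  moreover have "d t l * sqrt (\<mu> l) = sqrt (W t l)" if "t < k" "l < n" for t l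
  proof (cases "\<mu> l = 0")
    case True
    then have "(\<Sum>t<k. W t l) = 0" using \<mu>[OF that(2)] by simp
    then have "W t l = 0" using W that by (subst (asm) sum_nonneg_eq_0_iff) auto
    with True show ?thesis by (simp add: d_def)
  next
    case False
    then show ?thesis by (simp add: d_def real_sqrt_divide)
  qed
  ultimately show ?thesis by blast
qed

section \<open>From decompositions to operations\<close>

definition std_basis :: "nat \<Rightarrow> nat \<Rightarrow> complex" where
  "std_basis l i = of_bool (i = l)"

lemma orthonormal_std_basis: "orthonormal n n std_basis"
  unfolding orthonormal_def cinner_def std_basis_def
  by (auto simp: sum_of_bool_mult simp del: sum_of_bool_mult_eq sum_mult_of_bool_eq)

lemma average_schmidt_vector:
  assumes "decomposition (n * n) \<rho> k q \<phi>"
  shows "schmidt_vector n (average_schmidt n k q \<phi>)"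
proof -
  have sv: "schmidt_vector n (schmidt_coeffs n (\<phi> t))" and q: "0 \<le> q t" if "t < k" for t
    using assms that pure_state_schmidt(1) unfolding decomposition_def by auto
  have "(\<Sum>l<n. \<Sum>t<k. q t * schmidt_coeffs n (\<phi> t) $ l) = (\<Sum>t<k. \<Sum>l<n. q t * schmidt_coeffs n (\<phi> t) $ l)"
    by (rule sum.swap)
  also have "\<dots> = (\<Sum>t<k. q t * (\<Sum>l<n. schmidt_coeffs n (\<phi> t) $ l))" by (simp add: sum_distrib_left)
  also have "\<dots> = (\<Sum>t<k. q t)" using sv by (simp add: schmidt_vector_def)
  also have "\<dots> = 1" using assms by (simp add: decomposition_def)
  finally have "(\<Sum>l<n. \<Sum>t<k. q t * schmidt_coeffs n (\<phi> t) $ l) = 1" .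
  then show ?thesis
    using sv q by (auto simp: schmidt_vector_def average_schmidt_def intro!: sum_nonneg sum_mono mult_left_mono)
qed

lemma decomposition_schmidt:
  assumes "decomposition (n * n) \<rho> k q \<phi>"
  obtains u v where "\<And>t. t < k \<Longrightarrow> orthonormal n n (u t)" "\<And>t. t < k \<Longrightarrow> orthonormal n n (v t)"
    "\<And>t. t < k \<Longrightarrow> \<phi> t = schmidt_form n (\<lambda>r. sqrt (schmidt_coeffs n (\<phi> t) $ r)) (u t) (v t)"
proof -
  have "\<exists>u v. orthonormal n n u \<and> orthonormal n n v
      \<and> \<phi> t = schmidt_form n (\<lambda>r. sqrt (schmidt_coeffs n (\<phi> t) $ r)) u v" if "t < k" for t
    using pure_state_schmidt(2) assms that unfolding decomposition_def by blast
  then show ?thesis using that by metis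
qed

text \<open>The starting state may be chosen freely within \<open>S_set\<close>; with the average
  \<nu> as its Schmidt vector, its membership is the hypothesis \<open>maj\<close> itself. The
  weights \<open>q t * ?sc t $ l\<close> add up to \<open>\<nu> $ l\<close>, so they are the
  branches of a measurement on it.\<close>

lemma decomposition_imp_S_plus:
  assumes dec: "decomposition (n * n) \<rho> k q \<phi>"
    and maj: "weak_supermajorizes (p \<cdot>\<^sub>v average_schmidt n k q \<phi>) \<mu>"
  shows "\<rho> \<in> S_plus n \<mu> p"
proof -
  let ?sc = "\<lambda>t. schmidt_coeffs n (\<phi> t)"
  define \<nu> where "\<nu> = average_schmidt n k q \<phi>"
  have \<nu>: "schmidt_vector n \<nu>" unfolding \<nu>_def by (rule average_schmidt_vector[OF dec])
  have q: "0 \<le> q t" "pure_state (n * n) (\<phi> t)" if "t < k" for t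
    using dec that by (auto simp: decomposition_def)
  have sc: "0 \<le> ?sc t $ l" if "t < k" "l < n" for t l
    using pure_state_schmidt(1)[OF q(2)[OF that(1)]] that(2) by (simp add: schmidt_vector_def)
  obtain u v where uv: "\<And>t. t < k \<Longrightarrow> orthonormal n n (u t)" "\<And>t. t < k \<Longrightarrow> orthonormal n n (v t)"
    "\<And>t. t < k \<Longrightarrow> \<phi> t = schmidt_form n (\<lambda>r. sqrt (?sc t $ r)) (u t) (v t)"
    using decomposition_schmidt[OF dec] by metis
  have "0 < k" using dec by (cases k) (auto simp: decomposition_def)
  obtain d where d: "\<And>l. l < n \<Longrightarrow> (\<Sum>t<k. (d t l)\<^sup>2) = 1"
    "\<And>t l. t < k \<Longrightarrow> l < n \<Longrightarrow> d t l * sqrt (\<nu> $ l) = sqrt (q t * ?sc t $ l)"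
  proof -
    have "0 \<le> q t * ?sc t $ l" if "t < k" "l < n" for t l using q(1) sc that by simp
    moreover have "(\<Sum>t<k. q t * ?sc t $ l) = \<nu> $ l" if "l < n" for l
      using that by (simp add: \<nu>_def average_schmidt_def)
    ultimately show ?thesis
      using that measurement_weights[OF \<open>0 < k\<close>, of n "\<lambda>t l. q t * ?sc t $ l" "\<lambda>l. \<nu> $ l"] by blast
  qed
  define \<psi> where "\<psi> = schmidt_form n (\<lambda>l. sqrt (\<nu> $ l)) std_basis std_basis"
  note std = orthonormal_std_basis[of n]
  \<comment> \<open>Diagonal in one common basis, hence commuting. Moving to the Schmidt bases of
    \<open>\<phi> t\<close> is left to the unitaries.\<close>
  define A where "A t = diag_op n (d t) std_basis std_basis" for t
  define U where "U t = diag_op n (\<lambda>_. 1) (u t) std_basis" for t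
  define V where "V t = diag_op n (\<lambda>_. 1) (v t) std_basis" for t
  define \<L> where "\<L> = (\<lambda>\<sigma>. mat_sum (n * n) k (\<lambda>i. conj_by ((U i * A i) \<otimes>\<^sub>k V i) \<sigma>))"
  have "\<L> \<in> LOCC1A n"
    unfolding LOCC1A_def mem_Collect_eq
  proof (intro exI conjI allI impI)
    show "\<L> = (\<lambda>\<sigma>. mat_sum (n * n) k (\<lambda>i. conj_by ((U i * A i) \<otimes>\<^sub>k V i) \<sigma>))" by (rule \<L>_def)
    show "A i \<in> carrier_mat n n" for i by (simp add: A_def)
    show "unitary_mat n (U i)" "unitary_mat n (V i)" if "i < k" for i
      unfolding U_def V_def using uv(1,2)[OF that] by (auto intro: diag_op_unitary std)
    show "A i * A j = A j * A i" for i j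
      unfolding A_def diag_op_mult[OF std] by (simp add: mult.commute)
    show "mat_sum n k (\<lambda>i. mat_adjoint (A i) * A i) = 1\<^sub>m n"
      unfolding A_def by (rule diag_op_kraus) (use std d(1) in auto)
  qed
  moreover have sc_\<psi>: "schmidt_coeffs n \<psi> = \<nu>"
  proof -
    have "schmidt_coeffs n \<psi> = vec n (\<lambda>r. (sqrt (\<nu> $ r))\<^sup>2)"
      unfolding \<psi>_def by (rule schmidt_coeffs_schmidt_form) (use \<nu> std in \<open>auto simp: schmidt_vector_def\<close>)
    also have "\<dots> = \<nu>" using \<nu> by (intro eq_vecI) (auto simp: schmidt_vector_def)
    finally show ?thesis .
  qed
  moreover have \<psi>: "pure_state (n * n) \<psi>"
    using \<nu> by (simp add: pure_state_iff \<psi>_def norm_sq_schmidt_form[OF std std] schmidt_vector_def)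
  moreover have "projector \<psi> \<in> S_set n \<mu> p"
  proof -
    have "projector \<psi> = mat_sum (n * n) 1 (\<lambda>t. complex_of_real 1 \<cdot>\<^sub>m projector \<psi>)"
      using \<psi> by (intro eq_matI) (auto simp: projector_def pure_state_def)
    moreover have "weak_supermajorizes (p \<cdot>\<^sub>v schmidt_coeffs n \<psi>) \<mu>"
      using maj by (simp add: sc_\<psi> \<nu>_def)
    ultimately show ?thesis unfolding S_set_def convex_closure_def mem_Collect_eq
      using \<psi> by (intro exI[of _ 1] exI[of _ "\<lambda>_. 1"] exI[of _ "\<lambda>_. projector \<psi>"]) auto
  qed
  moreover have "\<L> (projector \<psi>) = \<rho>"
  proof -
    have "conj_by ((U t * A t) \<otimes>\<^sub>k V t) (projector \<psi>) = complex_of_real (q t) \<cdot>\<^sub>m projector (\<phi> t)"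
      if t: "t < k" for t
    proof -
      have UA: "U t * A t = diag_op n (d t) (u t) std_basis"
        unfolding U_def A_def diag_op_mult[OF std] by simp
      have c: "(U t * A t) \<otimes>\<^sub>k V t \<in> carrier_mat (n * n) (n * n)"
        by (rule kron_carrier) (simp_all add: UA V_def)
      have "((U t * A t) \<otimes>\<^sub>k V t) *\<^sub>v \<psi> = schmidt_form n (\<lambda>l. d t l * sqrt (\<nu> $ l)) (u t) (v t)"
        unfolding UA unfolding V_def \<psi>_def by (rule diag_op_schmidt_form[OF std std])
      also have "\<dots> = schmidt_form n (\<lambda>l. sqrt (q t) * sqrt (?sc t $ l)) (u t) (v t)"
        using d(2)[OF t] by (intro schmidt_form_cong) (simp add: real_sqrt_mult)
      also have "\<dots> = complex_of_real (sqrt (q t)) \<cdot>\<^sub>v \<phi> t"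
        by (subst uv(3)[OF t]) (simp add: schmidt_form_smult)
      finally have eq: "((U t * A t) \<otimes>\<^sub>k V t) *\<^sub>v \<psi> = complex_of_real (sqrt (q t)) \<cdot>\<^sub>v \<phi> t" .
      have "conj_by ((U t * A t) \<otimes>\<^sub>k V t) (ensemble (n * n) [\<psi>])
          = ensemble (n * n) (map ((*\<^sub>v) ((U t * A t) \<otimes>\<^sub>k V t)) [\<psi>])"
        by (rule conj_by_ensemble[OF c]) (use \<psi> in \<open>auto simp: pure_state_def\<close>)
      also have "\<dots> = projector (complex_of_real (sqrt (q t)) \<cdot>\<^sub>v \<phi> t)"
        using q(2)[OF t] by (simp add: eq ensemble_singleton pure_state_def)
      also have "\<dots> = complex_of_real (q t) \<cdot>\<^sub>m projector (\<phi> t)"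
        unfolding projector_smult[symmetric] using q(1)[OF t] by simp
      finally show ?thesis using \<psi> by (simp add: ensemble_singleton pure_state_def)
    qed
    then have "\<L> (projector \<psi>) = mat_sum (n * n) k (\<lambda>t. complex_of_real (q t) \<cdot>\<^sub>m projector (\<phi> t))"
      unfolding \<L>_def by (rule mat_sum_cong)
    then show ?thesis using dec by (simp add: decomposition_def)
  qed
  ultimately show ?thesis unfolding S_plus_def by blast
qed

subsection \<open>Majorization and convex combinations of permutations\<close>

lemma prefix_transfer:
  fixes \<nu> :: "nat \<Rightarrow> real"
  assumes "j < k"
  shows "(\<Sum>i<l. (\<nu>(j := \<nu> j - \<delta>, k := \<nu> k + \<delta>)) i) = (\<Sum>i<l. \<nu> i) - (if j < l \<and> l \<le> k then \<delta> else 0)"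
proof -
  have "(\<Sum>i<l. (\<nu>(j := \<nu> j - \<delta>, k := \<nu> k + \<delta>)) i)
      = (\<Sum>i<l. \<nu> i + ((if i = k then \<delta> else 0) - (if i = j then \<delta> else 0)))"
    using assms by (intro sum.cong) auto
  also have "\<dots> = (\<Sum>i<l. \<nu> i) + ((\<Sum>i<l. if i = k then \<delta> else 0) - (\<Sum>i<l. if i = j then \<delta> else 0))"
    by (simp only: sum.distrib sum_subtractf)
  also have "(\<Sum>i<l. if i = k then \<delta> else 0) = (if k < l then \<delta> else 0)" by simp
  also have "(\<Sum>i<l. if i = j then \<delta> else 0) = (if j < l then \<delta> else 0)" by simp
  finally show ?thesis using assms by (auto simp del: fun_upd_apply)
qed

text \<open>Each step transfers mass from a coordinate where \<open>\<nu>\<close> is too large to a later one where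
  it is too small, which makes one more coordinate agree with \<open>x\<close>. The transfer is a convex
  combination of the identity and a transposition.\<close>

lemma majorized_convex_permutations:
  fixes x \<nu> :: "nat \<Rightarrow> real"
  assumes mono: "\<And>i j. i \<le> j \<Longrightarrow> j < n \<Longrightarrow> x j \<le> x i"
    and "\<And>l. l \<le> n \<Longrightarrow> (\<Sum>i<l. x i) \<le> (\<Sum>i<l. \<nu> i)" and "(\<Sum>i<n. x i) = (\<Sum>i<n. \<nu> i)"
  shows "\<exists>c. (\<forall>\<sigma>. 0 \<le> c \<sigma>) \<and> (\<Sum>\<sigma> | \<sigma> permutes {..<n}. c \<sigma>) = 1
    \<and> (\<forall>l<n. x l = (\<Sum>\<sigma> | \<sigma> permutes {..<n}. c \<sigma> * \<nu> (\<sigma> l)))"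
  using assms(2,3)
proof (induction "card {i \<in> {..<n}. x i \<noteq> \<nu> i}" arbitrary: \<nu> rule: less_induct)
  case less
  let ?P = "{\<sigma>. \<sigma> permutes {..<n}}"
  have fin: "finite ?P" by (rule finite_permutations) simp
  show ?case
  proof (cases "\<forall>i<n. x i = \<nu> i")
    case True
    have "id \<in> ?P" by (simp add: permutes_id)
    moreover have "(\<Sum>\<sigma>\<in>?P. of_bool (\<sigma> = id) * f \<sigma>) = f id" for f :: "_ \<Rightarrow> real"
      using fin \<open>id \<in> ?P\<close> by (rule sum_of_bool_mult)
    from this this[of "\<lambda>_. 1"] show ?thesis
      using True by (intro exI[of _ "\<lambda>\<sigma>. of_bool (\<sigma> = id)"]) (simp del: sum_of_bool_mult_eq sum_of_bool_eq)
  next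
    case False
    have "\<exists>k<n. \<nu> k < x k"
    proof (rule ccontr)
      assume "\<not> ?thesis"
      then have le: "\<And>i. i \<in> {..<n} \<Longrightarrow> x i \<le> \<nu> i" by (meson lessThan_iff not_less)
      from False obtain i where "i < n" "x i < \<nu> i" using le by (metis lessThan_iff less_le)
      then have "(\<Sum>i<n. x i) < (\<Sum>i<n. \<nu> i)" using le by (intro sum_strict_mono_ex1) auto
      with less.prems(2) show False by simp
    qed
    \<comment> \<open>With the least deficient coordinate, every earlier difference
      \<open>\<nu> i - x i\<close> is nonnegative; this keeps the prefix sums above those of
      \<open>x\<close> after the transfer.\<close>
    define k where "k = (LEAST k. k < n \<and> \<nu> k < x k)"
    have k: "k < n" "\<nu> k < x k"
      using LeastI_ex[OF \<open>\<exists>k<n. \<nu> k < x k\<close>] by (auto simp: k_def)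
    have before: "x i \<le> \<nu> i" if "i < k" for i
      using not_less_Least[of i "\<lambda>k. k < n \<and> \<nu> k < x k"] that k(1) by (auto simp: k_def)
    \<comment> \<open>Otherwise the prefix sum of \<nu> up to and including \<open>k\<close> would
      fall below that of \<open>x\<close>.\<close>
    have "\<exists>j<k. x j < \<nu> j"
    proof (rule ccontr)
      assume "\<not> ?thesis"
      then have "(\<Sum>i<k. \<nu> i) \<le> (\<Sum>i<k. x i)" by (intro sum_mono) (meson lessThan_iff not_less)
      with less.prems(1)[of "Suc k"] k show False by simp
    qed
    then obtain j where j: "j < k" "x j < \<nu> j" by blast
    \<comment> \<open>The largest transfer that overshoots neither target, so at least one of the
      two coordinates becomes exact.\<close>
    define \<delta> where "\<delta> = min (\<nu> j - x j) (x k - \<nu> k)"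
    have \<delta>: "0 < \<delta>" "\<delta> \<le> \<nu> j - x j" "\<delta> \<le> x k - \<nu> k" using j k by (auto simp: \<delta>_def)
    define \<nu>' where "\<nu>' = \<nu>(j := \<nu> j - \<delta>, k := \<nu> k + \<delta>)"
    have prefix: "(\<Sum>i<l. \<nu>' i) = (\<Sum>i<l. \<nu> i) - (if j < l \<and> l \<le> k then \<delta> else 0)" for l
      unfolding \<nu>'_def by (rule prefix_transfer[OF j(1)])
    have "{i \<in> {..<n}. x i \<noteq> \<nu>' i} \<subset> {i \<in> {..<n}. x i \<noteq> \<nu> i}"
    proof (rule psubsetI)
      show "{i \<in> {..<n}. x i \<noteq> \<nu>' i} \<subseteq> {i \<in> {..<n}. x i \<noteq> \<nu> i}"
        using j k by (auto simp: \<nu>'_def)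
      have "\<delta> = \<nu> j - x j \<or> \<delta> = x k - \<nu> k" by (simp add: \<delta>_def min_def)
      moreover have "\<nu>' j = \<nu> j - \<delta>" "\<nu>' k = \<nu> k + \<delta>" using j(1) by (simp_all add: \<nu>'_def)
      ultimately have "x j = \<nu>' j \<or> x k = \<nu>' k" by linarith
      then have "j \<notin> {i \<in> {..<n}. x i \<noteq> \<nu>' i} \<or> k \<notin> {i \<in> {..<n}. x i \<noteq> \<nu>' i}" by blast
      moreover have "j \<in> {i \<in> {..<n}. x i \<noteq> \<nu> i}" "k \<in> {i \<in> {..<n}. x i \<noteq> \<nu> i}" using j k by auto
      ultimately show "{i \<in> {..<n}. x i \<noteq> \<nu>' i} \<noteq> {i \<in> {..<n}. x i \<noteq> \<nu> i}" by blast
    qed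
    then have "card {i \<in> {..<n}. x i \<noteq> \<nu>' i} < card {i \<in> {..<n}. x i \<noteq> \<nu> i}"
      by (intro psubset_card_mono) auto
    moreover have "(\<Sum>i<l. x i) \<le> (\<Sum>i<l. \<nu>' i)" if "l \<le> n" for l
    proof (cases "j < l \<and> l \<le> k")
      case True
      have "\<nu> j - x j \<le> (\<Sum>i<l. \<nu> i - x i)"
        using True before by (intro member_le_sum[of j "{..<l}" "\<lambda>i. \<nu> i - x i"]) auto
      then show ?thesis using True \<delta> by (simp add: prefix sum_subtractf)
    next
      case False
      then show ?thesis using less.prems(1)[OF that] by (auto simp: prefix)
    qed
    moreover have "(\<Sum>i<n. x i) = (\<Sum>i<n. \<nu>' i)" using less.prems(2) k(1) by (simp add: prefix)
    ultimately obtain c where c: "\<And>\<sigma>. 0 \<le> c \<sigma>" "(\<Sum>\<sigma>\<in>?P. c \<sigma>) = 1"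
      "\<And>l. l < n \<Longrightarrow> x l = (\<Sum>\<sigma>\<in>?P. c \<sigma> * \<nu>' (\<sigma> l))"
      using less.hyps[of \<nu>'] by blast
    \<comment> \<open>As \<open>x\<close> decreases, \<open>\<nu> j - \<nu> k\<close> is at least
      the excess at \<open>j\<close> plus the deficit at \<open>k\<close>, hence at least twice
      \<delta>. So the weight \<theta> of the transposition is below 1.\<close>
    have gap: "\<delta> < \<nu> j - \<nu> k" using mono[of j k] j k \<delta> by simp
    define \<theta> where "\<theta> = \<delta> / (\<nu> j - \<nu> k)"
    have \<theta>: "0 \<le> \<theta>" "\<theta> \<le> 1" "\<theta> * (\<nu> j - \<nu> k) = \<delta>" using gap \<delta>(1) by (simp_all add: \<theta>_def)
    let ?\<tau> = "transpose j k"
    have \<nu>'_eq: "\<nu>' i = (1 - \<theta>) * \<nu> i + \<theta> * \<nu> (?\<tau> i)" for i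
      using \<theta>(3) j(1) by (auto simp: \<nu>'_def transpose_def algebra_simps)
    have \<tau>: "?\<tau> permutes {..<n}" using j k by (intro permutes_swap_id) auto
    have reindex: "(\<Sum>\<sigma>\<in>?P. f (?\<tau> \<circ> \<sigma>)) = (\<Sum>\<sigma>\<in>?P. f \<sigma>)" for f :: "_ \<Rightarrow> real"
      by (rule sum.reindex_bij_witness[of _ "\<lambda>\<sigma>. ?\<tau> \<circ> \<sigma>" "\<lambda>\<sigma>. ?\<tau> \<circ> \<sigma>"])
        (auto simp: o_assoc permutes_compose[OF _ \<tau>])
    \<comment> \<open>Composition with the transposition is an involution on the permutations, so
      its share can be moved from \<nu> to the coefficients by reindexing.\<close>
    define c' where "c' \<sigma> = (1 - \<theta>) * c \<sigma> + \<theta> * c (?\<tau> \<circ> \<sigma>)" for \<sigma>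
    have "(\<Sum>\<sigma>\<in>?P. c' \<sigma>) = (1 - \<theta>) * (\<Sum>\<sigma>\<in>?P. c \<sigma>) + \<theta> * (\<Sum>\<sigma>\<in>?P. c (?\<tau> \<circ> \<sigma>))"
      by (simp add: c'_def sum.distrib sum_distrib_left)
    then have "(\<Sum>\<sigma>\<in>?P. c' \<sigma>) = 1" using reindex[of c] c(2) by simp
    moreover have "x l = (\<Sum>\<sigma>\<in>?P. c' \<sigma> * \<nu> (\<sigma> l))" if "l < n" for l
    proof -
      have "x l = (1 - \<theta>) * (\<Sum>\<sigma>\<in>?P. c \<sigma> * \<nu> (\<sigma> l)) + \<theta> * (\<Sum>\<sigma>\<in>?P. c \<sigma> * \<nu> (?\<tau> (\<sigma> l)))"
        unfolding c(3)[OF that] \<nu>'_eq by (simp only: distrib_left sum.distrib sum_distrib_left mult_ac)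
      also have "(\<Sum>\<sigma>\<in>?P. c \<sigma> * \<nu> (?\<tau> (\<sigma> l))) = (\<Sum>\<sigma>\<in>?P. c (?\<tau> \<circ> \<sigma>) * \<nu> (\<sigma> l))"
        using reindex[of "\<lambda>\<sigma>. c \<sigma> * \<nu> (?\<tau> (\<sigma> l))"] by simp
      finally show ?thesis by (simp only: c'_def distrib_left distrib_right sum.distrib sum_distrib_left mult_ac)
    qed
    moreover have "0 \<le> c' \<sigma>" for \<sigma> using c(1) \<theta> by (simp add: c'_def)
    ultimately show ?thesis by (intro exI[of _ c']) auto
  qed
qed

lemma schmidt_form_permute:
  assumes "\<sigma> permutes {..<n}"
  shows "schmidt_form n (\<lambda>l. s (\<sigma> l)) (\<lambda>l. u (\<sigma> l)) (\<lambda>l. v (\<sigma> l)) = schmidt_form n s u v"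
proof (rule eq_vecI)
  fix i assume "i < dim_vec (schmidt_form n s u v)"
  then show "schmidt_form n (\<lambda>l. s (\<sigma> l)) (\<lambda>l. u (\<sigma> l)) (\<lambda>l. v (\<sigma> l)) $ i = schmidt_form n s u v $ i"
    using sum.permute[OF assms, of "\<lambda>l. complex_of_real (s l) * u l (i div n) * v l (i mod n)"]
    by (simp add: schmidt_form_def o_def)
qed simp

text \<open>Moving the missing weight \<open>1 - p\<close> to the largest coefficient turns weak
  supermajorization into majorization.\<close>

lemma weak_supermajorizes_permutations:
  assumes \<mu>: "schmidt_vector n \<mu>" and \<nu>: "schmidt_vector n \<nu>" and "0 < p" "p \<le> 1"
    and maj: "weak_supermajorizes (p \<cdot>\<^sub>v \<nu>) \<mu>"
  obtains J :: nat and c \<sigma> where "\<And>j. j < J \<Longrightarrow> 0 \<le> c j" "(\<Sum>j<J. c j) = 1" "\<And>j. j < J \<Longrightarrow> \<sigma> j permutes {..<n}"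
    "\<And>l. l < n \<Longrightarrow> \<mu> $ l = (\<Sum>j<J. c j * (p * \<nu> $ \<sigma> j l + (1 - p) * of_bool (\<sigma> j l = 0)))"
proof -
  define x where "x i = p * \<nu> $ i + (1 - p) * of_bool (i = 0)" for i
  have dims: "dim_vec \<mu> = n" "dim_vec \<nu> = n" using \<mu> \<nu> by (auto simp: schmidt_vector_def)
  have "0 < n" using \<mu> by (cases n) (auto simp: schmidt_vector_def)
  have x_sum: "(\<Sum>i<n. x i) = 1"
    using \<nu> \<open>0 < n\<close> sum_of_bool_mult(1)[of "{..<n}" 0 "\<lambda>_. 1 - p"]
    by (simp add: x_def sum.distrib schmidt_vector_def flip: sum_distrib_left del: sum_mult_of_bool_eq)
  have split: "(\<Sum>i<n. f i) = (\<Sum>i<l. f i) + (\<Sum>i = l..<n. f i)" if "l \<le> n" for l and f :: "nat \<Rightarrow> real"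
    using that by (metis atLeast0LessThan le0 sum.atLeastLessThan_concat)
  have prefix: "(\<Sum>i<l. \<mu> $ i) \<le> (\<Sum>i<l. x i)" if "l \<le> n" for l
  proof (cases "l = 0 \<or> l = n")
    case True
    then show ?thesis using x_sum \<mu> by (auto simp: schmidt_vector_def)
  next
    case False
    then have l: "0 < l" "l < n" using that by auto
    \<comment> \<open>This tail starts after index 0 and misses the added weight
      \<open>1 - p\<close>. The prefixes excluded here are settled by the empty sum and the equal
      totals.\<close>
    have "(\<Sum>i = l..<n. x i) = (\<Sum>i = l..<n. (p \<cdot>\<^sub>v \<nu>) $ i)"
      using l dims by (intro sum.cong) (auto simp: x_def)
    also have "\<dots> \<le> (\<Sum>i = l..<n. \<mu> $ i)"
      using maj l dims by (auto simp: weak_supermajorizes_def)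
    finally show ?thesis
      using split[OF that, of x] split[OF that, of "\<lambda>i. \<mu> $ i"] x_sum \<mu> by (simp add: schmidt_vector_def)
  qed
  let ?P = "{\<sigma>. \<sigma> permutes {..<n}}"
  have "\<exists>c. (\<forall>\<sigma>. 0 \<le> c \<sigma>) \<and> (\<Sum>\<sigma>\<in>?P. c \<sigma>) = 1 \<and> (\<forall>l<n. \<mu> $ l = (\<Sum>\<sigma>\<in>?P. c \<sigma> * x (\<sigma> l)))"
    by (rule majorized_convex_permutations[of n "\<lambda>i. \<mu> $ i" x])
      (use \<mu> prefix x_sum in \<open>auto simp: schmidt_vector_def\<close>)
  then obtain c where c: "\<And>\<sigma>. 0 \<le> c \<sigma>" "(\<Sum>\<sigma>\<in>?P. c \<sigma>) = 1"
    "\<And>l. l < n \<Longrightarrow> \<mu> $ l = (\<Sum>\<sigma>\<in>?P. c \<sigma> * x (\<sigma> l))" by blast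
  have "finite ?P" by (rule finite_permutations) simp
  then obtain h where h: "bij_betw h {0..<card ?P} ?P" using ex_bij_betw_nat_finite by blast
  have re: "(\<Sum>j<card ?P. f (h j)) = (\<Sum>\<sigma>\<in>?P. f \<sigma>)" for f :: "_ \<Rightarrow> real"
    using sum.reindex_bij_betw[OF h, of f] by (simp add: lessThan_atLeast0)
  show ?thesis
  proof (rule that[of "card ?P" "\<lambda>j. c (h j)" h])
    show "0 \<le> c (h j)" for j by (rule c(1))
    show "(\<Sum>j<card ?P. c (h j)) = 1" unfolding re by (rule c(2))
    show "h j permutes {..<n}" if "j < card ?P" for j
      using bij_betwE[OF h] that by auto
    show "\<mu> $ l = (\<Sum>j<card ?P. c (h j) * (p * \<nu> $ h j l + (1 - p) * of_bool (h j l = 0)))" if "l < n" for l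
      using c(3)[OF that] re[of "\<lambda>\<sigma>. c \<sigma> * x (\<sigma> l)"] by (simp add: x_def)
  qed
qed

text \<open>A branch is a permutation \<open>j\<close> together with \<open>i\<close>, where
  \<open>i < k\<close> names a member of the ensemble and \<open>i = k\<close> is failure. The
  equation for \<mu> splits each of its entries among these branches, so
  \<open>measurement_weights\<close> turns it into one measurement by Alice. Success has total
  weight \<open>p\<close> because the \<open>c j\<close> sum to 1.\<close>

lemma decomposition_imp_locc_convertible:
  assumes \<mu>: "schmidt_vector n \<mu>" and \<psi>: "pure_state (n * n) \<psi>" "schmidt_coeffs n \<psi> = \<mu>"
    and p: "0 < p" "p \<le> 1" and dec: "decomposition (n * n) \<rho> k q \<phi>"
    and maj: "weak_supermajorizes (p \<cdot>\<^sub>v average_schmidt n k q \<phi>) \<mu>"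
  shows "locc_convertible n \<psi> \<rho> p"
proof -
  let ?sc = "\<lambda>i. schmidt_coeffs n (\<phi> i)"
  have q: "0 \<le> q i" "pure_state (n * n) (\<phi> i)" if "i < k" for i
    using dec that by (auto simp: decomposition_def)
  have sc: "0 \<le> ?sc i $ l" if "i < k" "l < n" for i l
    using pure_state_schmidt(1)[OF q(2)[OF that(1)]] that(2) by (simp add: schmidt_vector_def)
  obtain u v where uv: "\<And>i. i < k \<Longrightarrow> orthonormal n n (u i)" "\<And>i. i < k \<Longrightarrow> orthonormal n n (v i)"
    "\<And>i. i < k \<Longrightarrow> \<phi> i = schmidt_form n (\<lambda>r. sqrt (?sc i $ r)) (u i) (v i)"
    using decomposition_schmidt[OF dec] by metis
  obtain u0 v0 where uv0: "orthonormal n n u0" "orthonormal n n v0"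
    "\<psi> = schmidt_form n (\<lambda>r. sqrt (\<mu> $ r)) u0 v0"
    using pure_state_schmidt(2)[OF \<psi>(1), unfolded \<psi>(2)] by blast
  obtain J :: nat and c \<sigma> where c: "\<And>j. j < J \<Longrightarrow> 0 \<le> c j" "(\<Sum>j<J. c j) = 1"
    and \<sigma>: "\<And>j. j < J \<Longrightarrow> \<sigma> j permutes {..<n}"
    and \<mu>_eq: "\<And>l. l < n \<Longrightarrow> \<mu> $ l = (\<Sum>j<J. c j * (p * average_schmidt n k q \<phi> $ \<sigma> j l + (1 - p) * of_bool (\<sigma> j l = 0)))"
    using that by (rule weak_supermajorizes_permutations[OF \<mu> average_schmidt_vector[OF dec] p maj])
  have "0 < J" using c(2) by (cases J) auto
  have \<sigma>_less: "\<sigma> j l < n" if "j < J" "l < n" for j l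
    using permutes_in_image[OF \<sigma>[OF that(1)]] that(2) by auto
  \<comment> \<open>Decodes a branch number \<open>t = j * Suc k + i\<close>; the \<open>Suc\<close>
    makes room for the failure branch.\<close>
  define j' i' where "j' t = t div Suc k" and "i' t = t mod Suc k" for t
  have ji: "j' (j * Suc k + i) = j" "i' (j * Suc k + i) = i" if "j < J" "i < Suc k" for j i
    using pair_index[OF that] by (simp_all add: j'_def i'_def)
  have bounds: "j' t < J" "i' t < Suc k" if "t < J * Suc k" for t
    using that by (auto simp: j'_def i'_def less_mult_imp_div_less)
  define W where "W t l = (if i' t < k then c (j' t) * p * q (i' t) * ?sc (i' t) $ \<sigma> (j' t) l
    else c (j' t) * (1 - p) * of_bool (\<sigma> (j' t) l = 0))" for t l
  define a where "a t l = (if i' t < k then u (i' t) (\<sigma> (j' t) l) else std_basis l)" for t l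
  define b where "b t l = (if i' t < k then v (i' t) (\<sigma> (j' t) l) else std_basis l)" for t l
  have a: "orthonormal n n (a t)" and b: "orthonormal n n (b t)" if "t < J * Suc k" for t
    using orthonormal_permute[OF uv(1) \<sigma>[OF bounds(1)[OF that]]] orthonormal_permute[OF uv(2) \<sigma>[OF bounds(1)[OF that]]]
      orthonormal_std_basis[of n] unfolding a_def[abs_def] b_def[abs_def] by (cases "i' t < k"; simp)+
  have W_nonneg: "0 \<le> W t l" if "t < J * Suc k" "l < n" for t l
    using bounds[OF that(1)] that(2) c(1) q(1) sc p \<sigma>_less by (auto simp: W_def)
  have W_sum: "(\<Sum>t<J * Suc k. W t l) = \<mu> $ l" if "l < n" for l
  proof -
    have "(\<Sum>t<J * Suc k. W t l) = (\<Sum>j<J. \<Sum>i<Suc k. W (j * Suc k + i) l)" by (rule sum_pair_index)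
    also have "\<dots> = (\<Sum>j<J. c j * (p * average_schmidt n k q \<phi> $ \<sigma> j l + (1 - p) * of_bool (\<sigma> j l = 0)))"
    proof (intro sum.cong refl)
      fix j assume "j \<in> {..<J}"
      then have j: "j < J" by simp
      have "(\<Sum>i<Suc k. W (j * Suc k + i) l)
          = (\<Sum>i<Suc k. if i < k then c j * p * q i * ?sc i $ \<sigma> j l else c j * (1 - p) * of_bool (\<sigma> j l = 0))"
        using ji[OF j] unfolding W_def by (intro sum.cong) auto
      also have "\<dots> = c j * (p * (\<Sum>i<k. q i * ?sc i $ \<sigma> j l) + (1 - p) * of_bool (\<sigma> j l = 0))"
        by (simp add: sum_distrib_left algebra_simps)
      also have "(\<Sum>i<k. q i * ?sc i $ \<sigma> j l) = average_schmidt n k q \<phi> $ \<sigma> j l"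
        using \<sigma>_less[OF j that] by (simp add: average_schmidt_def)
      finally show "(\<Sum>i<Suc k. W (j * Suc k + i) l)
          = c j * (p * average_schmidt n k q \<phi> $ \<sigma> j l + (1 - p) * of_bool (\<sigma> j l = 0))" .
    qed
    finally show ?thesis using \<mu>_eq[OF that] by simp
  qed
  have "0 < J * Suc k" using \<open>0 < J\<close> by simp
  have "\<exists>d. (\<forall>l<n. (\<Sum>t<J * Suc k. (d t l)\<^sup>2) = 1)
      \<and> (\<forall>t<J * Suc k. \<forall>l<n. d t l * sqrt (\<mu> $ l) = sqrt (W t l))"
    by (rule measurement_weights[of "J * Suc k" n W "\<lambda>l. \<mu> $ l"]) (use \<open>0 < J * Suc k\<close> W_nonneg W_sum in auto)
  then obtain d where d_all: "(\<forall>l<n. (\<Sum>t<J * Suc k. (d t l)\<^sup>2) = 1)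
      \<and> (\<forall>t<J * Suc k. \<forall>l<n. d t l * sqrt (\<mu> $ l) = sqrt (W t l))" ..
  have d: "(\<Sum>t<J * Suc k. (d t l)\<^sup>2) = 1"
    "t < J * Suc k \<Longrightarrow> d t l * sqrt (\<mu> $ l) = sqrt (W t l)" if "l < n" for t l
    using d_all that by blast+
  define K where "K t = diag_op n (d t) (a t) u0" for t
  define V where "V t = diag_op n (\<lambda>_. 1) (b t) v0" for t
  have K_carrier: "K t \<in> carrier_mat n n" for t by (simp add: K_def)
  have K_sum: "mat_sum n (J * Suc k) (\<lambda>t. mat_adjoint (K t) * K t) = 1\<^sub>m n"
    unfolding K_def by (rule diag_op_kraus[OF a uv0(1) d(1)])
  have V_unitary: "unitary_mat n (V t)" if "t < J * Suc k" for t
    unfolding V_def by (rule diag_op_unitary[OF b[OF that] uv0(2)])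
  from locc_one_way[of "J * Suc k" K n V "\<lambda>t. i' t < k", OF K_carrier K_sum V_unitary]
  obtain E :: "bool \<Rightarrow> cmat \<Rightarrow> cmat" where E: "locc n n n n E"
    "\<And>xs. (\<And>x. x \<in> set xs \<Longrightarrow> x \<in> carrier_vec (n * n)) \<Longrightarrow> E True (ensemble (n * n) xs)
      = mat_sum (n * n) (J * Suc k) (\<lambda>t. if i' t < k then ensemble (n * n) (map ((*\<^sub>v) (K t \<otimes>\<^sub>k V t)) xs)
          else 0\<^sub>m (n * n) (n * n))"
    by blast
  have out: "(K t \<otimes>\<^sub>k V t) *\<^sub>v \<psi> = complex_of_real (sqrt (c (j' t) * p * q (i' t))) \<cdot>\<^sub>v \<phi> (i' t)"
    if t: "t < J * Suc k" "i' t < k" for t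
  proof -
    have "(K t \<otimes>\<^sub>k V t) *\<^sub>v \<psi> = schmidt_form n (\<lambda>l. d t l * sqrt (\<mu> $ l)) (a t) (b t)"
      unfolding K_def V_def uv0(3) by (rule diag_op_schmidt_form[OF uv0(1,2)])
    also have "\<dots> = schmidt_form n (\<lambda>l. sqrt (c (j' t) * p * q (i' t)) * sqrt (?sc (i' t) $ \<sigma> (j' t) l)) (a t) (b t)"
      using d(2)[OF _ t(1)] t(2) by (intro schmidt_form_cong) (simp add: W_def real_sqrt_mult)
    also have "\<dots> = schmidt_form n (\<lambda>l. sqrt (c (j' t) * p * q (i' t)) * sqrt (?sc (i' t) $ \<sigma> (j' t) l))
        (\<lambda>l. u (i' t) (\<sigma> (j' t) l)) (\<lambda>l. v (i' t) (\<sigma> (j' t) l))"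
      using t(2) by (simp add: a_def[abs_def] b_def[abs_def])
    \<comment> \<open>Coefficients and both bases are permuted alike, which merely reorders the sum
      over Schmidt terms.\<close>
    also have "\<dots> = schmidt_form n (\<lambda>l. sqrt (c (j' t) * p * q (i' t)) * sqrt (?sc (i' t) $ l)) (u (i' t)) (v (i' t))"
      by (rule schmidt_form_permute[OF \<sigma>[OF bounds(1)[OF t(1)]],
            where s="\<lambda>l. sqrt (c (j' t) * p * q (i' t)) * sqrt (?sc (i' t) $ l)"])
    also have "\<dots> = complex_of_real (sqrt (c (j' t) * p * q (i' t))) \<cdot>\<^sub>v \<phi> (i' t)"
      by (subst uv(3)[OF t(2)]) (simp only: schmidt_form_smult)
    finally show ?thesis .
  qed
  have \<psi>_carrier: "\<psi> \<in> carrier_vec (n * n)" using \<psi>(1) by (simp add: pure_state_def)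
  have \<phi>_dim: "dim_vec (\<phi> i) = n * n" if "i < k" for i using q(2)[OF that] by (simp add: pure_state_def)
  have "E True (projector \<psi>) = complex_of_real p \<cdot>\<^sub>m \<rho>"
  proof (rule eq_matI)
    have \<rho>: "\<rho> = mat_sum (n * n) k (\<lambda>i. complex_of_real (q i) \<cdot>\<^sub>m projector (\<phi> i))"
      using dec by (simp add: decomposition_def)
    have E\<psi>: "E True (projector \<psi>) = mat_sum (n * n) (J * Suc k)
        (\<lambda>t. if i' t < k then ensemble (n * n) [(K t \<otimes>\<^sub>k V t) *\<^sub>v \<psi>] else 0\<^sub>m (n * n) (n * n))"
      using E(2)[of "[\<psi>]"] \<psi>_carrier by (simp add: ensemble_singleton cong: if_cong)
    show "dim_row (E True (projector \<psi>)) = dim_row (complex_of_real p \<cdot>\<^sub>m \<rho>)"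
      "dim_col (E True (projector \<psi>)) = dim_col (complex_of_real p \<cdot>\<^sub>m \<rho>)"
      unfolding E\<psi> \<rho> by simp_all
    fix x y assume "x < dim_row (complex_of_real p \<cdot>\<^sub>m \<rho>)" "y < dim_col (complex_of_real p \<cdot>\<^sub>m \<rho>)"
    then have xy: "x < n * n" "y < n * n" by (simp_all add: \<rho>)
    define f where "f t = (if i' t < k then complex_of_real (c (j' t) * p * q (i' t))
        * (\<phi> (i' t) $ x * cnj (\<phi> (i' t) $ y)) else 0)" for t
    have "E True (projector \<psi>) $$ (x, y) = (\<Sum>t<J * Suc k. f t)"
    proof -
      have "(if i' t < k then ensemble (n * n) [(K t \<otimes>\<^sub>k V t) *\<^sub>v \<psi>] else 0\<^sub>m (n * n) (n * n)) $$ (x, y) = f t"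
        if t: "t < J * Suc k" for t
      proof (cases "i' t < k")
        case True
        let ?r = "c (j' t) * p * q (i' t)"
        have "0 \<le> ?r" using c(1) p q(1) bounds[OF t] True by simp
        then have "complex_of_real (sqrt ?r) * complex_of_real (sqrt ?r) = complex_of_real ?r"
          unfolding of_real_mult[symmetric] by (simp only: real_sqrt_mult_self abs_of_nonneg)
        then show ?thesis using True xy \<phi>_dim[OF True] unfolding f_def out[OF t True]
          by (simp add: mult_ac del: of_real_mult)
      next
        case False
        then show ?thesis using xy by (simp add: f_def)
      qed
      then show ?thesis unfolding E\<psi> using xy by (simp only: mat_sum_index) simp
    qed
    also have "\<dots> = (\<Sum>j<J. \<Sum>i<Suc k. f (j * Suc k + i))" by (rule sum_pair_index)
    also have "\<dots> = (\<Sum>j<J. complex_of_real (c j) * (\<Sum>i<k. complex_of_real (p * q i) * (\<phi> i $ x * cnj (\<phi> i $ y))))"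
    proof (intro sum.cong refl)
      fix j assume "j \<in> {..<J}"
      then have j: "j < J" by simp
      have "(\<Sum>i<Suc k. f (j * Suc k + i))
          = (\<Sum>i<Suc k. if i < k then complex_of_real (c j * p * q i) * (\<phi> i $ x * cnj (\<phi> i $ y)) else 0)"
        using ji[OF j] unfolding f_def by (intro sum.cong) auto
      then show "(\<Sum>i<Suc k. f (j * Suc k + i))
          = complex_of_real (c j) * (\<Sum>i<k. complex_of_real (p * q i) * (\<phi> i $ x * cnj (\<phi> i $ y)))"
        by (simp add: sum_distrib_left mult_ac)
    qed
    also have "\<dots> = complex_of_real (\<Sum>j<J. c j) * (\<Sum>i<k. complex_of_real (p * q i) * (\<phi> i $ x * cnj (\<phi> i $ y)))"
      by (simp add: sum_distrib_right)
    also have "\<dots> = (complex_of_real p \<cdot>\<^sub>m \<rho>) $$ (x, y)"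
      using xy \<phi>_dim unfolding \<rho> c(2) by (simp add: projector_def sum_distrib_left mult_ac)
    finally show "E True (projector \<psi>) $$ (x, y) = (complex_of_real p \<cdot>\<^sub>m \<rho>) $$ (x, y)" .
  qed
  with E(1) show ?thesis unfolding locc_convertible_def by blast
qed

section \<open>The characterization\<close>

text \<open>The protocol gives the tail inequalities with its actual success probability
  \<open>s\<close>. They weaken to \<open>p\<close> because the tails of a Schmidt vector are
  nonnegative.\<close>

lemma locc_convertible_imp_decomposition:
  assumes \<mu>: "schmidt_vector n \<mu>" and \<psi>: "pure_state (n * n) \<psi>" "schmidt_coeffs n \<psi> = \<mu>"
    and "0 < p" and \<rho>: "density_matrix (n * n) \<rho>" and conv: "locc_convertible n \<psi> \<rho> p"
  shows "\<exists>k q \<phi>. decomposition (n * n) \<rho> k q \<phi> \<and> weak_supermajorizes (p \<cdot>\<^sub>v average_schmidt n k q \<phi>) \<mu>"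
proof -
  have "0 < n" using \<mu> by (cases n) (auto simp: schmidt_vector_def)
  obtain E :: "bool \<Rightarrow> cmat \<Rightarrow> cmat" and s where E: "locc n n n n E" "p \<le> s"
    "E True (projector \<psi>) = complex_of_real s \<cdot>\<^sub>m \<rho>"
    using conv unfolding locc_convertible_def by blast
  have "mat_sum (n * n) 1 (\<lambda>t. complex_of_real 1 \<cdot>\<^sub>m projector \<psi>) = projector \<psi>"
    using \<psi>(1) by (intro eq_matI) (auto simp: projector_def pure_state_def)
  then have "E True (mat_sum (n * n) 1 (\<lambda>t. complex_of_real 1 \<cdot>\<^sub>m projector \<psi>)) = complex_of_real s \<cdot>\<^sub>m \<rho>"
    using E(3) by simp
  from locc_decomposition[where B="\<lambda>l. \<Sum>i = l..<n. \<mu> $ i", OF E(1) \<open>0 < n\<close> _ _ this _ \<rho>]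
  obtain k q \<phi> where dec: "decomposition (n * n) \<rho> k q \<phi>"
    and tail: "\<And>l. l < n \<Longrightarrow> s * (\<Sum>i = l..<n. average_schmidt n k q \<phi> $ i) \<le> (\<Sum>i = l..<n. \<mu> $ i)"
    using \<psi> E(2) \<open>0 < p\<close> by auto
  have av: "schmidt_vector n (average_schmidt n k q \<phi>)" by (rule average_schmidt_vector[OF dec])
  have "p * (\<Sum>i = l..<n. average_schmidt n k q \<phi> $ i) \<le> (\<Sum>i = l..<n. \<mu> $ i)" if "l < n" for l
  proof -
    have "0 \<le> (\<Sum>i = l..<n. average_schmidt n k q \<phi> $ i)"
      using av by (intro sum_nonneg) (simp add: schmidt_vector_def)
    then have "p * (\<Sum>i = l..<n. average_schmidt n k q \<phi> $ i) \<le> s * (\<Sum>i = l..<n. average_schmidt n k q \<phi> $ i)"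
      using E(2) by (intro mult_right_mono)
    then show ?thesis using tail[OF that] by simp
  qed
  then have "weak_supermajorizes (p \<cdot>\<^sub>v average_schmidt n k q \<phi>) \<mu>"
    using av \<mu> by (auto simp: weak_supermajorizes_def schmidt_vector_def sum_distrib_left)
  with dec show ?thesis by blast
qed

text \<open>Instead of identifying the pure input with a generator of \<open>S_set\<close>, the
  mixture that represents it is fed to \<open>locc_decomposition\<close>. Each generator has tails
  at most those of \<mu> over \<open>p\<close>, and so has the average.\<close>

lemma S_plus_imp_decomposition:
  assumes \<mu>: "schmidt_vector n \<mu>" and "0 < p" and \<rho>: "density_matrix (n * n) \<rho>" and mem: "\<rho> \<in> S_plus n \<mu> p"
  shows "\<exists>k q \<phi>. decomposition (n * n) \<rho> k q \<phi> \<and> weak_supermajorizes (p \<cdot>\<^sub>v average_schmidt n k q \<phi>) \<mu>"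
proof -
  have "0 < n" using \<mu> by (cases n) (auto simp: schmidt_vector_def)
  have \<mu>_dim: "dim_vec \<mu> = n" using \<mu> by (simp add: schmidt_vector_def)
  obtain \<L> \<psi> where \<L>: "\<L> \<in> LOCC1A n" "\<rho> = \<L> (projector \<psi>)" and \<psi>: "\<psi> \<in> carrier_vec (n * n)"
    and S: "projector \<psi> \<in> S_set n \<mu> p"
    using mem unfolding S_plus_def pure_state_def by blast
  obtain E :: "bool \<Rightarrow> cmat \<Rightarrow> cmat" where E: "locc n n n n E"
    "\<And>\<psi>. \<psi> \<in> carrier_vec (n * n) \<Longrightarrow> E True (projector \<psi>) = \<L> (projector \<psi>)"
    using LOCC1A_locc[OF \<L>(1)] by blast
  obtain k q F where F: "projector \<psi> = mat_sum (n * n) k (\<lambda>t. complex_of_real (q t) \<cdot>\<^sub>m F t)"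
    and q: "\<And>t. t < k \<Longrightarrow> 0 \<le> q t" "(\<Sum>t<k. q t) = 1"
    and F_mem: "\<And>t. t < k \<Longrightarrow> \<exists>\<phi>. F t = projector \<phi> \<and> pure_state (n * n) \<phi>
        \<and> weak_supermajorizes (p \<cdot>\<^sub>v schmidt_coeffs n \<phi>) \<mu>"
    using S unfolding S_set_def convex_closure_def by auto
  obtain \<phi> where \<phi>: "\<And>t. t < k \<Longrightarrow> F t = projector (\<phi> t)" "\<And>t. t < k \<Longrightarrow> pure_state (n * n) (\<phi> t)"
    "\<And>t. t < k \<Longrightarrow> weak_supermajorizes (p \<cdot>\<^sub>v schmidt_coeffs n (\<phi> t)) \<mu>"
    using F_mem by metis
  have "mat_sum (n * n) k (\<lambda>t. complex_of_real (q t) \<cdot>\<^sub>m projector (\<phi> t)) = projector \<psi>"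
    unfolding F by (intro mat_sum_cong) (simp add: \<phi>(1))
  then have out: "E True (mat_sum (n * n) k (\<lambda>t. complex_of_real (q t) \<cdot>\<^sub>m projector (\<phi> t))) = complex_of_real 1 \<cdot>\<^sub>m \<rho>"
    using E(2)[OF \<psi>] \<L>(2) by (intro eq_matI) auto
  have "(\<Sum>t<k. q t * (\<Sum>i = l..<n. schmidt_coeffs n (\<phi> t) $ i)) \<le> (\<Sum>i = l..<n. \<mu> $ i) / p" if "l < n" for l
  proof -
    have "p * (\<Sum>i = l..<n. schmidt_coeffs n (\<phi> t) $ i) \<le> (\<Sum>i = l..<n. \<mu> $ i)" if t: "t < k" for t
    proof -
      have "dim_vec (schmidt_coeffs n (\<phi> t)) = n"
        using pure_state_schmidt(1)[OF \<phi>(2)[OF t]] by (simp add: schmidt_vector_def)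
      then show ?thesis using \<phi>(3)[OF t] \<mu>_dim \<open>l < n\<close>
        by (auto simp: weak_supermajorizes_def sum_distrib_left)
    qed
    then have "(\<Sum>i = l..<n. schmidt_coeffs n (\<phi> t) $ i) \<le> (\<Sum>i = l..<n. \<mu> $ i) / p" if "t < k" for t
      using that \<open>0 < p\<close> by (simp add: pos_le_divide_eq mult.commute)
    then have "(\<Sum>t<k. q t * (\<Sum>i = l..<n. schmidt_coeffs n (\<phi> t) $ i)) \<le> (\<Sum>t<k. q t * ((\<Sum>i = l..<n. \<mu> $ i) / p))"
      using q(1) by (intro sum_mono mult_left_mono) auto
    also have "\<dots> = (\<Sum>t<k. q t) * ((\<Sum>i = l..<n. \<mu> $ i) / p)" by (rule sum_distrib_right[symmetric])
    also have "\<dots> = (\<Sum>i = l..<n. \<mu> $ i) / p" by (simp only: q(2) mult_1)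
    finally show ?thesis .
  qed
  from locc_decomposition[where B="\<lambda>l. (\<Sum>i = l..<n. \<mu> $ i) / p", OF E(1) \<open>0 < n\<close> _ this out _ \<rho>]
  obtain k' q' \<phi>' where dec: "decomposition (n * n) \<rho> k' q' \<phi>'"
    and tail: "\<And>l. l < n \<Longrightarrow> (\<Sum>i = l..<n. average_schmidt n k' q' \<phi>' $ i) \<le> (\<Sum>i = l..<n. \<mu> $ i) / p"
    using q(1) \<phi>(2) by auto
  have "p * (\<Sum>i = l..<n. average_schmidt n k' q' \<phi>' $ i) \<le> (\<Sum>i = l..<n. \<mu> $ i)" if "l < n" for l
    using tail[OF that] \<open>0 < p\<close> by (simp add: pos_le_divide_eq mult.commute)
  then have "weak_supermajorizes (p \<cdot>\<^sub>v average_schmidt n k' q' \<phi>') \<mu>"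
    using average_schmidt_vector[OF dec] \<mu>_dim
    by (auto simp: weak_supermajorizes_def schmidt_vector_def sum_distrib_left)
  with dec show ?thesis by blast
qed

theorem theorem2:
  fixes n :: nat and \<mu> :: "real vec" and \<psi>\<^sub>\<mu> :: "complex vec" and p :: real and \<rho> :: "complex mat"
  assumes "schmidt_vector n \<mu>"
    and "pure_state (n * n) \<psi>\<^sub>\<mu>" and "schmidt_coeffs n \<psi>\<^sub>\<mu> = \<mu>"
    and "0 < p" and "p \<le> 1"
    and "density_matrix (n * n) \<rho>"
  shows "(\<rho> \<in> S_plus n \<mu> p \<longleftrightarrow>
           (\<exists>k q \<phi>. decomposition (n * n) \<rho> k q \<phi> \<and>
              weak_supermajorizes (p \<cdot>\<^sub>v average_schmidt n k q \<phi>) \<mu>))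
       \<and> (locc_convertible n \<psi>\<^sub>\<mu> \<rho> p \<longleftrightarrow> \<rho> \<in> S_plus n \<mu> p)"
  \<comment> \<open>Convertibility and membership in \<open>S_plus\<close> are never compared
    directly; each is equivalent to the existence of the decomposition.\<close>
  using S_plus_imp_decomposition[OF assms(1,4,6)] decomposition_imp_S_plus
    locc_convertible_imp_decomposition[OF assms(1-4,6)] decomposition_imp_locc_convertible[OF assms(1-5)]
  by blast

end
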